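(* Let $T>0$, $u_0\in\mathbb{R}$, and let $\alpha,\beta,f\in C^\infty(\mathbb{R})$ be real analytic functions such that the Itô stochastic differential equation $du=\alpha(u)\,dt+\beta(u)\,dW$, $u(0)=u_0$, admits a unique solution on $[0,T]$. Then the Martin–Siggia–Rose path integral expectation $\mathbb{E}^{\mathrm{MSR}}[f(u_t)]=\sum_{N\ge0}M_N(t)$ coincides, as a formal power series, with the exotic B-series representing $\mathbb{E}^{u_0}[f(u_t)]$: for every $N\ge 0$ and $t\in[0,T]$, $$M_N(t)=\sum_{\tau\in\mathcal{T}^{\mathfrak e}_{\alpha,\beta},\ |\tau|=N+1}\frac{|\tau|}{\sigma_{\mathfrak e}(\tau)\,\tau!}\,\Upsilon^{\alpha,\beta,f}_{u_0}(\tau)\,t^{|\tau|-1}.$$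
   Context: MSR expectation (Itô prescription): $\Theta$ is the Heaviside function with $\Theta(0)=0$. The formal series $\mathbb{E}^{\mathrm{MSR}}[f(u_t)]=\sum_{N\ge0}M_N(t)$ is the perturbative expansion $$\Gamma^{mloc}_\Theta\Big[f(\psi(t))\otimes \exp_{\otimes}\Big(\int_0^T\big(\tilde\psi_s\alpha(\psi_s)+\tfrac12\tilde\psi_s^2\beta^2(\psi_s)\big)ds\Big)\Big]\Big|_{\psi=u_0,\ \tilde\psi=0},$$ where $\Gamma^{mloc}_\Theta$ contracts, in all possible ways, fields $\psi$ with auxiliary fields $\tilde\psi$ belonging to different factors, replacing a pair $(\psi_s,\tilde\psi_r)$ by $\Theta(s-r)$. Explicitly, $$M_N(t):=\frac1{N!}\int_{[0,T]^N}\Big[e^{D}\Big(f(x_0)\prod_{i=1}^N\big(y_i\alpha(x_i)+\tfrac12y_i^2\beta(x_i)^2\big)\Big)\Big]_{x_0=\dots=x_N=u_0,\ y_1=\dots=y_N=0}ds_1\cdots ds_N,$$ with $s_0:=t$ and $D:=\sum_{0\le i\le N,\ 1\le j\le N,\ i\neq j}\Theta(s_i-s_j)\,\partial_{x_i}\partial_{y_j}$ (the exponential acts as a finite sum since the argument is polynomial in the $y_j$). Exotic coloured trees: an exotic coloured tree $\tau$ is a finite non-planar rooted tree with edges oriented towards the root $\rho_\tau$; the root is uncoloured; every non-root vertex $v$ has a colour $\mathfrak t(v)\in\{\alpha,\beta\}$; the set $\mathcal V_\beta(\tau)$ of $\beta$-coloured vertices has even cardinality and is equipped with an exotic decoration $\mathfrak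 e$, i.e. a partition of $\mathcal V_\beta(\tau)$ into pairs ($\mathfrak e(v)=\mathfrak e(w)$ iff $v,w$ are in the same pair; labels irrelevant). Paired vertices may be anywhere in the tree. $\mathcal V_\alpha(\tau)$ is the set of $\alpha$-coloured vertices. $\mathcal{T}^{\mathfrak e}_{\alpha,\beta}$ is the set of isomorphism classes of such trees (including the single root $\bullet$). Set $|\tau|:=|\mathcal V_\alpha(\tau)|+\tfrac12|\mathcal V_\beta(\tau)|+1$, and let $\mathfrak n(v)$ be the number of incoming edges (children) of $v$. Symmetry factor: $\sigma_{\mathfrak e}(\tau)$ is the number of automorphisms of the rooted tree $\tau$ preserving the colours and the partition of $\mathcal V_\beta(\tau)$ into pairs (pairs may be permuted among themselves). Tree factorial: $1/\tau!$ is defined recursively by $1/\bullet!=1$ and, for $|\tau|>1$, $$\frac{|\tau|}{\tau!}=\sum_{\tau'}\frac{m_\alpha(\tau',\tau)}{\tau'!}+\sum_{\tau'}\frac{m_\beta(\tau',\tau)}{\tau'!},$$ where $m_\alpha(\tau',\tau)$ is the number of $\alpha$-coloured leaves of $\tau$ whose removal yields $\tau'$, $m_\beta(\tau',\tau)$ is the number of pairs of $\beta$-vertices with the same exotic decoration, both leaves of $\tau$, whose simultaneous removal yields $\tau'$, and sums run over isomorphism classes. Empty sums are zero (in which case $1/\tau!=0$). Elementary differential: for $x\in\mathbb{R}$, $\Upsilon^{\alpha,\beta,f}_{x}(\tau):=f^{(\mathfrak n(\rho_\tau))}(x)\prod_{v\ne\rho_\tau}\mathfrak t(v)^{(\mathfrak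 n(v))}(x)$, where $\mathfrak t(v)\in\{\alpha,\beta\}$ is regarded as the corresponding coefficient function. *)

theory Defs
  imports "HOL-Probability.Probability" "HOL-Library.Disjoint_Sets"
begin

section \<open>Coefficient functions\<close>

definition C_infinity :: "(real \<Rightarrow> real) \<Rightarrow> bool" where
  "C_infinity g \<longleftrightarrow> (\<forall>n x. (deriv ^^ n) g differentiable (at x))"

definition real_analytic :: "(real \<Rightarrow> real) \<Rightarrow> bool" where
  "real_analytic g \<longleftrightarrow>
     (\<forall>x. \<exists>r>0. \<exists>a. \<forall>y. \<bar>y - x\<bar> < r \<longrightarrow> (\<lambda>n. a n * (y - x) ^ n) sums g y)"


section \<open>Stochastic differential equations\<close>

definition brownian_motion ::
  "'a measure \<Rightarrow> (real \<Rightarrow> 'a measure) \<Rightarrow> (real \<Rightarrow> 'a \<Rightarrow> real) \<Rightarrow> bool" where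
  "brownian_motion M F W \<longleftrightarrow>
     prob_space M \<and> filtration (space M) F \<and> (\<forall>t. subalgebra M (F t)) \<and>
     (\<forall>t\<ge>0. W t \<in> borel_measurable (F t)) \<and>
     (\<forall>\<omega>\<in>space M. continuous_on {0..} (\<lambda>t. W t \<omega>)) \<and>
     (AE \<omega> in M. W 0 \<omega> = 0) \<and>
     (\<forall>s t. 0 \<le> s \<and> s < t \<longrightarrow>
        distributed M lborel (\<lambda>\<omega>. W t \<omega> - W s \<omega>) (normal_density 0 (sqrt (t - s))) \<and>
        prob_space.indep_set M (sets (F s))
          (sets (vimage_algebra (space M) (\<lambda>\<omega>. W t \<omega> - W s \<omega>) borel)))"

definition tendsto_in_probability ::
  "'a measure \<Rightarrow> (nat \<Rightarrow> 'a \<Rightarrow> real) \<Rightarrow> ('a \<Rightarrow> real) \<Rightarrow> bool" where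
  "tendsto_in_probability M X Y \<longleftrightarrow>
     (\<forall>\<epsilon>>0. (\<lambda>k. measure M {\<omega>\<in>space M. \<bar>X k \<omega> - Y \<omega>\<bar> > \<epsilon>}) \<longlonglongrightarrow> 0)"

text \<open>A simple process on $[0,t]$ is given by a grid
  \<open>0 = p 0 < \<dots> < p n = t\<close> and bounded weights \<open>\<xi> i\<close> known at time \<open>p i\<close>; it takes the value
  \<open>\<xi> i\<close> on the interval \<open>{p i<..p (Suc i)}\<close>.\<close>

definition simple_process ::
  "(real \<Rightarrow> 'a measure) \<Rightarrow> real \<Rightarrow> nat \<Rightarrow> (nat \<Rightarrow> real) \<Rightarrow> (nat \<Rightarrow> 'a \<Rightarrow> real) \<Rightarrow> bool" where
  "simple_process F t n p \<xi> \<longleftrightarrow>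
     p 0 = 0 \<and> p n = t \<and> strict_mono_on {0..n} p \<and>
     (\<forall>i<n. \<xi> i \<in> borel_measurable (F (p i)) \<and> (\<exists>C. \<forall>\<omega>\<in>space (F (p i)). \<bar>\<xi> i \<omega>\<bar> \<le> C))"

definition simple_value ::
  "nat \<Rightarrow> (nat \<Rightarrow> real) \<Rightarrow> (nat \<Rightarrow> 'a \<Rightarrow> real) \<Rightarrow> real \<Rightarrow> 'a \<Rightarrow> real" where
  "simple_value n p \<xi> s \<omega> = (\<Sum>i<n. \<xi> i \<omega> * indicator {p i<..p (Suc i)} s)"

definition simple_integral ::
  "(real \<Rightarrow> 'a \<Rightarrow> real) \<Rightarrow> nat \<Rightarrow> (nat \<Rightarrow> real) \<Rightarrow> (nat \<Rightarrow> 'a \<Rightarrow> real) \<Rightarrow> 'a \<Rightarrow> real" where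
  "simple_integral W n p \<xi> \<omega> = (\<Sum>i<n. \<xi> i \<omega> * (W (p (Suc i)) \<omega> - W (p i) \<omega>))"

text \<open>\<open>has_ito_integral M F W H t I\<close>: the random variable \<open>I\<close> is (a version of) the It\^o integral
  $\int_0^t H_s\,dW_s$, obtained by approximating the integrand by simple processes. The integrand
  is jointly measurable with almost surely square integrable paths, so that the integrals
  inside the definition are not subject to the totality conventions of the Bochner integral.\<close>

definition has_ito_integral ::
  "'a measure \<Rightarrow> (real \<Rightarrow> 'a measure) \<Rightarrow> (real \<Rightarrow> 'a \<Rightarrow> real) \<Rightarrow> (real \<Rightarrow> 'a \<Rightarrow> real) \<Rightarrow> real \<Rightarrow>
     ('a \<Rightarrow> real) \<Rightarrow> bool" where
  "has_ito_integral M F W H t I \<longleftrightarrow>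
     I \<in> borel_measurable M \<and>
     (\<lambda>(s, \<omega>). H s \<omega>) \<in> borel_measurable (restrict_space borel {0..t} \<Otimes>\<^sub>M M) \<and>
     (\<forall>s\<in>{0..t}. H s \<in> borel_measurable (F s)) \<and>
     (AE \<omega> in M. set_integrable lborel {0..t} (\<lambda>s. (H s \<omega>)\<^sup>2)) \<and>
     (\<exists>n p \<xi>. (\<forall>k. simple_process F t (n k) (p k) (\<xi> k)) \<and>
        tendsto_in_probability M
          (\<lambda>k \<omega>. LINT s:{0..t}|lborel. (simple_value (n k) (p k) (\<xi> k) s \<omega> - H s \<omega>)\<^sup>2) (\<lambda>_. 0) \<and>
        tendsto_in_probability M (\<lambda>k. simple_integral W (n k) (p k) (\<xi> k)) I)"

definition sde_solution ::
  "'a measure \<Rightarrow> (real \<Rightarrow> 'a measure) \<Rightarrow> (real \<Rightarrow> 'a \<Rightarrow> real) \<Rightarrow> (real \<Rightarrow> real) \<Rightarrow> (real \<Rightarrow> real) \<Rightarrow>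
     real \<Rightarrow> real \<Rightarrow> (real \<Rightarrow> 'a \<Rightarrow> real) \<Rightarrow> bool" where
  "sde_solution M F W \<alpha> \<beta> u\<^sub>0 T u \<longleftrightarrow>
     (\<forall>t\<in>{0..T}. u t \<in> borel_measurable (F t)) \<and>
     (\<forall>\<omega>\<in>space M. continuous_on {0..T} (\<lambda>t. u t \<omega>)) \<and>
     (\<forall>t\<in>{0..T}. \<exists>I. has_ito_integral M F W (\<lambda>s \<omega>. \<beta> (u s \<omega>)) t I \<and>
        (AE \<omega> in M. u t \<omega> = u\<^sub>0 + (LINT s:{0..t}|lborel. \<alpha> (u s \<omega>)) + I \<omega>))"

text \<open>Uniqueness is pathwise: any two solutions are indistinguishable on $[0,T]$.\<close>

definition sde_unique_solution ::
  "'a measure \<Rightarrow> (real \<Rightarrow> 'a measure) \<Rightarrow> (real \<Rightarrow> 'a \<Rightarrow> real) \<Rightarrow> (real \<Rightarrow> real) \<Rightarrow> (real \<Rightarrow> real) \<Rightarrow>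
     real \<Rightarrow> real \<Rightarrow> bool" where
  "sde_unique_solution M F W \<alpha> \<beta> u\<^sub>0 T \<longleftrightarrow>
     (\<exists>u. sde_solution M F W \<alpha> \<beta> u\<^sub>0 T u) \<and>
     (\<forall>u v. sde_solution M F W \<alpha> \<beta> u\<^sub>0 T u \<longrightarrow> sde_solution M F W \<alpha> \<beta> u\<^sub>0 T v \<longrightarrow>
        (AE \<omega> in M. \<forall>t\<in>{0..T}. u t \<omega> = v t \<omega>))"


section \<open>The Martin--Siggia--Rose expansion\<close>

definition heaviside :: "real \<Rightarrow> real" where
  "heaviside x = (if x > 0 then 1 else 0)"

text \<open>A function of the variables $x_0, x_1, \dots$ and $y_0, y_1, \dots$ is represented by a function
  of two families indexed by the naturals.\<close>

type_synonym field_fun = "(nat \<Rightarrow> real) \<Rightarrow> (nat \<Rightarrow> real) \<Rightarrow> real"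

definition pdx :: "nat \<Rightarrow> field_fun \<Rightarrow> field_fun" where
  "pdx i G = (\<lambda>x y. deriv (\<lambda>z. G (x(i := z)) y) (x i))"

definition pdy :: "nat \<Rightarrow> field_fun \<Rightarrow> field_fun" where
  "pdy j G = (\<lambda>x y. deriv (\<lambda>z. G x (y(j := z))) (y j))"

definition contraction :: "nat \<Rightarrow> (nat \<Rightarrow> real) \<Rightarrow> field_fun \<Rightarrow> field_fun" where
  "contraction N s G =
     (\<lambda>x y. \<Sum>i\<in>{0..N}. \<Sum>j\<in>{1..N} - {i}. heaviside (s i - s j) * pdx i (pdy j G) x y)"

text \<open>If \<open>G\<close> is polynomial in the \<open>y j\<close>, only finitely many terms of the series are nonzero.\<close>

definition exp_contraction :: "nat \<Rightarrow> (nat \<Rightarrow> real) \<Rightarrow> field_fun \<Rightarrow> field_fun" where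
  "exp_contraction N s G = (\<lambda>x y. \<Sum>k. ((contraction N s ^^ k) G) x y / fact k)"

definition msr_integrand ::
  "(real \<Rightarrow> real) \<Rightarrow> (real \<Rightarrow> real) \<Rightarrow> (real \<Rightarrow> real) \<Rightarrow> nat \<Rightarrow> field_fun" where
  "msr_integrand \<alpha> \<beta> f N =
     (\<lambda>x y. f (x 0) * (\<Prod>i\<in>{1..N}. y i * \<alpha> (x i) + 1/2 * (y i)\<^sup>2 * (\<beta> (x i))\<^sup>2))"

definition msr_term ::
  "(real \<Rightarrow> real) \<Rightarrow> (real \<Rightarrow> real) \<Rightarrow> (real \<Rightarrow> real) \<Rightarrow> real \<Rightarrow> real \<Rightarrow> nat \<Rightarrow> real \<Rightarrow> real" where
  "msr_term \<alpha> \<beta> f u\<^sub>0 T N t =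
     1 / fact N *
     (LINT s : (\<Pi>\<^sub>E i\<in>{1..N}. {0..T}) | (\<Pi>\<^sub>M i\<in>{1..N}. lborel).
        exp_contraction N (s(0 := t)) (msr_integrand \<alpha> \<beta> f N) (\<lambda>_. u\<^sub>0) (\<lambda>_. 0))"


section \<open>Exotic coloured trees\<close>

datatype colour = Alpha | Beta

text \<open>A concrete tree has vertices in the naturals; an edge \<open>(v, w)\<close> leads from \<open>v\<close> to its parent \<open>w\<close>.
  The exotic decoration is the set of pairs of the partition.\<close>

record etree =
  verts :: "nat set"
  tree_root :: nat
  edges :: "(nat \<times> nat) set"
  colour :: "nat \<rightharpoonup> colour"
  pairs :: "nat set set"

definition coloured :: "etree \<Rightarrow> colour \<Rightarrow> nat set" where
  "coloured \<tau> c = {v \<in> verts \<tau>. colour \<tau> v = Some c}"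

definition children :: "etree \<Rightarrow> nat \<Rightarrow> nat set" where
  "children \<tau> v = {u. (u, v) \<in> edges \<tau>}"

definition is_etree :: "etree \<Rightarrow> bool" where
  "is_etree \<tau> \<longleftrightarrow>
     finite (verts \<tau>) \<and> tree_root \<tau> \<in> verts \<tau> \<and> edges \<tau> \<subseteq> verts \<tau> \<times> verts \<tau> \<and>
     (\<forall>w. (tree_root \<tau>, w) \<notin> edges \<tau>) \<and>
     (\<forall>v\<in>verts \<tau> - {tree_root \<tau>}. \<exists>!w. (v, w) \<in> edges \<tau>) \<and>
     (\<forall>v\<in>verts \<tau>. (v, tree_root \<tau>) \<in> (edges \<tau>)\<^sup>*) \<and>
     dom (colour \<tau>) = verts \<tau> - {tree_root \<tau>} \<and>
     partition_on (coloured \<tau> Beta) (pairs \<tau>) \<and> (\<forall>p\<in>pairs \<tau>. card p = 2)"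

definition etree_iso :: "(nat \<Rightarrow> nat) \<Rightarrow> etree \<Rightarrow> etree \<Rightarrow> bool" where
  "etree_iso \<phi> \<tau> \<tau>' \<longleftrightarrow>
     bij_betw \<phi> (verts \<tau>) (verts \<tau>') \<and> \<phi> (tree_root \<tau>) = tree_root \<tau>' \<and>
     edges \<tau>' = map_prod \<phi> \<phi> ` edges \<tau> \<and>
     (\<forall>v\<in>verts \<tau>. colour \<tau>' (\<phi> v) = colour \<tau> v) \<and>
     pairs \<tau>' = (`) \<phi> ` pairs \<tau>"

definition etree_equiv :: "etree \<Rightarrow> etree \<Rightarrow> bool" where
  "etree_equiv \<tau> \<tau>' \<longleftrightarrow> is_etree \<tau> \<and> is_etree \<tau>' \<and> (\<exists>\<phi>. etree_iso \<phi> \<tau> \<tau>')"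

definition remove_verts :: "nat set \<Rightarrow> etree \<Rightarrow> etree" where
  "remove_verts S \<tau> =
     \<lparr>verts = verts \<tau> - S, tree_root = tree_root \<tau>,
      edges = edges \<tau> \<inter> (verts \<tau> - S) \<times> (verts \<tau> - S),
      colour = colour \<tau> |` (verts \<tau> - S),
      pairs = {p \<in> pairs \<tau>. p \<inter> S = {}}\<rparr>"

definition etree_size :: "etree \<Rightarrow> nat" where
  "etree_size \<tau> = card (coloured \<tau> Alpha) + card (coloured \<tau> Beta) div 2 + 1"

definition alpha_removals :: "etree \<Rightarrow> etree \<Rightarrow> nat set" where
  "alpha_removals \<tau>' \<tau> =
     {v \<in> coloured \<tau> Alpha. children \<tau> v = {} \<and> etree_equiv \<tau>' (remove_verts {v} \<tau>)}"

definition beta_removals :: "etree \<Rightarrow> etree \<Rightarrow> nat set set" where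
  "beta_removals \<tau>' \<tau> =
     {p \<in> pairs \<tau>. (\<forall>v\<in>p. children \<tau> v = {}) \<and> etree_equiv \<tau>' (remove_verts p \<tau>)}"

text \<open>Automorphisms are made extensional, so that each is counted once.\<close>

definition etree_auts :: "etree \<Rightarrow> (nat \<Rightarrow> nat) set" where
  "etree_auts \<tau> = {\<phi> \<in> extensional (verts \<tau>). etree_iso \<phi> \<tau> \<tau>}"

fun coeff_fun :: "(real \<Rightarrow> real) \<Rightarrow> (real \<Rightarrow> real) \<Rightarrow> colour \<Rightarrow> real \<Rightarrow> real" where
  "coeff_fun \<alpha> \<beta> Alpha = \<alpha>"
| "coeff_fun \<alpha> \<beta> Beta = \<beta>"

definition etree_diff ::
  "(real \<Rightarrow> real) \<Rightarrow> (real \<Rightarrow> real) \<Rightarrow> (real \<Rightarrow> real) \<Rightarrow> real \<Rightarrow> etree \<Rightarrow> real" where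
  "etree_diff \<alpha> \<beta> f x \<tau> =
     (deriv ^^ card (children \<tau> (tree_root \<tau>))) f x *
     (\<Prod>v\<in>verts \<tau> - {tree_root \<tau>}.
        (deriv ^^ card (children \<tau> v)) (coeff_fun \<alpha> \<beta> (the (colour \<tau> v))) x)"


subsection \<open>Invariance under isomorphism\<close>

lemma etree_iso_id: "etree_iso id \<tau> \<tau>"
  by (simp add: etree_iso_def prod.map_id0)

lemma etree_iso_comp:
  assumes "etree_iso \<phi> \<tau> \<tau>'" "etree_iso \<psi> \<tau>' \<tau>''"
  shows "etree_iso (\<psi> \<circ> \<phi>) \<tau> \<tau>''"
  using assms unfolding etree_iso_def
  by (auto simp: image_comp map_prod.comp bij_betw_apply intro: bij_betw_trans)

lemma etree_pairs_subset: "is_etree \<tau> \<Longrightarrow> p \<in> pairs \<tau> \<Longrightarrow> p \<subseteq> coloured \<tau> Beta"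
  using partition_onD1[of "coloured \<tau> Beta" "pairs \<tau>"] by (simp add: is_etree_def Union_upper)

lemma coloured_subset: "coloured \<tau> c \<subseteq> verts \<tau>"
  by (auto simp: coloured_def)

lemma etree_iso_cong:
  assumes "is_etree \<tau>" "etree_iso \<phi> \<tau> \<tau>'" "\<And>v. v \<in> verts \<tau> \<Longrightarrow> \<psi> v = \<phi> v"
  shows "etree_iso \<psi> \<tau> \<tau>'"
proof -
  have 1: "map_prod \<psi> \<psi> ` edges \<tau> = map_prod \<phi> \<phi> ` edges \<tau>"
  proof (rule image_cong[OF refl])
    fix e assume "e \<in> edges \<tau>"
    then have "e \<in> verts \<tau> \<times> verts \<tau>" using assms(1) unfolding is_etree_def by blast
    then show "map_prod \<psi> \<psi> e = map_prod \<phi> \<phi> e" using assms(3) by auto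
  qed
  have "p \<subseteq> verts \<tau>" if "p \<in> pairs \<tau>" for p
    using etree_pairs_subset[OF assms(1) that] coloured_subset by blast
  then have 2: "(`) \<psi> ` pairs \<tau> = (`) \<phi> ` pairs \<tau>"
    using assms(3) by (intro image_cong) (auto intro!: image_cong)
  have 3: "bij_betw \<psi> (verts \<tau>) (verts \<tau>')"
    using assms(2,3) bij_betw_cong[of "verts \<tau>" \<psi> \<phi>] by (auto simp: etree_iso_def)
  have 4: "\<psi> (tree_root \<tau>) = tree_root \<tau>'"
    using assms by (simp add: is_etree_def etree_iso_def)
  have 5: "\<forall>v\<in>verts \<tau>. colour \<tau>' (\<psi> v) = colour \<tau> v"
    using assms(2,3) by (simp add: etree_iso_def)
  show ?thesis
    using assms(2) 3 4 5 unfolding etree_iso_def 1 2 by blast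
qed

lemma iso_inj_on: "etree_iso \<phi> \<tau> \<tau>' \<Longrightarrow> inj_on \<phi> (verts \<tau>)"
  by (simp add: etree_iso_def bij_betw_def)

lemma etree_iso_inv:
  assumes "is_etree \<tau>" "etree_iso \<phi> \<tau> \<tau>'"
  shows "etree_iso (inv_into (verts \<tau>) \<phi>) \<tau>' \<tau>"
proof -
  let ?\<psi> = "inv_into (verts \<tau>) \<phi>"
  have bij: "bij_betw \<phi> (verts \<tau>) (verts \<tau>')" using assms by (simp add: etree_iso_def)
  have inv: "?\<psi> (\<phi> v) = v" if "v \<in> verts \<tau>" for v
    using bij that by (simp add: bij_betw_def)
  have r: "?\<psi> (tree_root \<tau>') = tree_root \<tau>"
    using inv[of "tree_root \<tau>"] assms by (simp add: etree_iso_def is_etree_def)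
  have e: "edges \<tau>' = map_prod \<phi> \<phi> ` edges \<tau>" "edges \<tau> \<subseteq> verts \<tau> \<times> verts \<tau>"
    using assms by (simp_all add: etree_iso_def is_etree_def)
  have "map_prod ?\<psi> ?\<psi> (map_prod \<phi> \<phi> x) = x" if "x \<in> edges \<tau>" for x
  proof -
    have "x \<in> verts \<tau> \<times> verts \<tau>" using e that by blast
    then show ?thesis using inv by auto
  qed
  then have E: "edges \<tau> = map_prod ?\<psi> ?\<psi> ` edges \<tau>'"
    unfolding e(1) image_image by simp
  have p: "pairs \<tau>' = (`) \<phi> ` pairs \<tau>" using assms(2) by (simp add: etree_iso_def)
  have "?\<psi> ` \<phi> ` p = p" if "p \<in> pairs \<tau>" for p
  proof (rule inv_into_image_cancel[OF iso_inj_on[OF assms(2)]])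
    show "p \<subseteq> verts \<tau>"
      using etree_pairs_subset[OF assms(1) that] coloured_subset by (rule order_trans)
  qed
  then have P: "pairs \<tau> = (`) ?\<psi> ` pairs \<tau>'"
    unfolding p image_image by simp
  have c: "\<forall>v\<in>verts \<tau>'. colour \<tau> (?\<psi> v) = colour \<tau>' v"
  proof
    fix v assume "v \<in> verts \<tau>'"
    then obtain w where "w \<in> verts \<tau>" "v = \<phi> w"
      using bij unfolding bij_betw_def by blast
    then show "colour \<tau> (?\<psi> v) = colour \<tau>' v"
      using assms(2) inv by (simp add: etree_iso_def)
  qed
  show ?thesis
    unfolding etree_iso_def using bij_betw_inv_into[OF bij] r E P c by blast
qed

lemma etree_equiv_refl: "is_etree \<tau> \<Longrightarrow> etree_equiv \<tau> \<tau>"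
  using etree_iso_id by (auto simp: etree_equiv_def)

lemma etree_equiv_sym: "etree_equiv \<tau> \<tau>' \<Longrightarrow> etree_equiv \<tau>' \<tau>"
  using etree_iso_inv by (auto simp: etree_equiv_def)

lemma etree_equiv_trans: "etree_equiv \<tau> \<tau>' \<Longrightarrow> etree_equiv \<tau>' \<tau>'' \<Longrightarrow> etree_equiv \<tau> \<tau>''"
  using etree_iso_comp unfolding etree_equiv_def by blast

definition single_root :: etree where
  "single_root = \<lparr>verts = {0}, tree_root = 0, edges = {}, colour = Map.empty, pairs = {}\<rparr>"

lemma is_etree_single_root: "is_etree single_root"
  by (auto simp: single_root_def is_etree_def coloured_def partition_on_def)

quotient_type exotic_tree = etree / partial: etree_equiv
proof (rule part_equivpI)
  show "\<exists>\<tau>. etree_equiv \<tau> \<tau>"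
    using etree_equiv_refl is_etree_single_root by blast
  show "symp etree_equiv" by (auto intro: sympI etree_equiv_sym)
  show "transp etree_equiv" by (auto intro: transpI etree_equiv_trans)
qed

lemma etree_equiv_cong:
  assumes "etree_equiv \<sigma> \<sigma>'" "etree_equiv \<tau> \<tau>'"
  shows "etree_equiv \<sigma> \<tau> \<longleftrightarrow> etree_equiv \<sigma>' \<tau>'"
  using assms etree_equiv_sym etree_equiv_trans by blast

lemma iso_coloured:
  assumes "etree_iso \<phi> \<tau> \<tau>'"
  shows "coloured \<tau>' c = \<phi> ` coloured \<tau> c"
proof -
  have V: "verts \<tau>' = \<phi> ` verts \<tau>" and c: "\<forall>v\<in>verts \<tau>. colour \<tau>' (\<phi> v) = colour \<tau> v"
    using assms by (simp_all add: etree_iso_def bij_betw_def)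
  show ?thesis using c unfolding coloured_def V by auto
qed

lemma iso_children:
  assumes "is_etree \<tau>" "etree_iso \<phi> \<tau> \<tau>'" "v \<in> verts \<tau>"
  shows "children \<tau>' (\<phi> v) = \<phi> ` children \<tau> v"
proof -
  have e: "edges \<tau> \<subseteq> verts \<tau> \<times> verts \<tau>" "edges \<tau>' = map_prod \<phi> \<phi> ` edges \<tau>"
    using assms by (auto simp: is_etree_def etree_iso_def)
  show ?thesis
  proof
    show "\<phi> ` children \<tau> v \<subseteq> children \<tau>' (\<phi> v)"
      using e(2) by (force simp: children_def)
    show "children \<tau>' (\<phi> v) \<subseteq> \<phi> ` children \<tau> v"
    proof
      fix z assume "z \<in> children \<tau>' (\<phi> v)"
      then obtain a b where ab: "(a, b) \<in> edges \<tau>" "z = \<phi> a" "\<phi> v = \<phi> b"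
        using e(2) by (auto simp: children_def)
      then have "b = v" using e(1) assms(3) iso_inj_on[OF assms(2)] by (auto dest: inj_onD)
      then show "z \<in> \<phi> ` children \<tau> v" using ab by (auto simp: children_def)
    qed
  qed
qed

lemma children_subset: "is_etree \<tau> \<Longrightarrow> children \<tau> v \<subseteq> verts \<tau>"
  by (auto simp: is_etree_def children_def)

lemma iso_card_children:
  assumes "is_etree \<tau>" "etree_iso \<phi> \<tau> \<tau>'" "v \<in> verts \<tau>"
  shows "card (children \<tau>' (\<phi> v)) = card (children \<tau> v)"
  unfolding iso_children[OF assms]
  by (rule card_image) (meson assms children_subset inj_on_subset iso_inj_on)

lemma etree_size_cong:
  assumes "etree_equiv \<tau> \<tau>'"
  shows "etree_size \<tau> = etree_size \<tau>'"
proof -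
  obtain \<phi> where \<phi>: "etree_iso \<phi> \<tau> \<tau>'" using assms by (auto simp: etree_equiv_def)
  have "card (coloured \<tau>' c) = card (coloured \<tau> c)" for c
    unfolding iso_coloured[OF \<phi>]
    by (rule card_image) (meson \<phi> coloured_subset inj_on_subset iso_inj_on)
  then show ?thesis by (simp add: etree_size_def)
qed

lemma etree_diff_cong:
  assumes "etree_equiv \<tau> \<tau>'"
  shows "etree_diff \<alpha> \<beta> f x \<tau> = etree_diff \<alpha> \<beta> f x \<tau>'"
proof -
  obtain \<phi> where \<phi>: "etree_iso \<phi> \<tau> \<tau>'" and t: "is_etree \<tau>"
    using assms by (auto simp: etree_equiv_def)
  have r: "tree_root \<tau>' = \<phi> (tree_root \<tau>)" "tree_root \<tau> \<in> verts \<tau>"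
    using \<phi> t by (auto simp: etree_iso_def is_etree_def)
  have V: "verts \<tau>' - {tree_root \<tau>'} = \<phi> ` (verts \<tau> - {tree_root \<tau>})"
    using \<phi> r iso_inj_on[OF \<phi>] by (auto simp: etree_iso_def bij_betw_def dest: inj_onD)
  have inj: "inj_on \<phi> (verts \<tau> - {tree_root \<tau>})"
    using iso_inj_on[OF \<phi>] by (rule inj_on_subset) auto
  have c: "colour \<tau>' (\<phi> v) = colour \<tau> v" if "v \<in> verts \<tau>" for v
    using \<phi> that by (simp add: etree_iso_def)
  show ?thesis
    unfolding etree_diff_def V prod.reindex[OF inj] comp_def
    using iso_card_children[OF t \<phi>] r c by simp
qed

lemma finite_etree_auts: "is_etree \<tau> \<Longrightarrow> finite (etree_auts \<tau>)"
proof -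
  assume t: "is_etree \<tau>"
  have "etree_auts \<tau> \<subseteq> verts \<tau> \<rightarrow>\<^sub>E verts \<tau>"
    by (auto simp: etree_auts_def etree_iso_def PiE_def dest: bij_betw_apply)
  then show "finite (etree_auts \<tau>)"
    using t by (auto simp: is_etree_def intro: finite_subset finite_PiE)
qed

lemma card_etree_auts_le:
  assumes "is_etree \<tau>" "is_etree \<tau>'" "etree_iso \<phi> \<tau> \<tau>'"
  shows "card (etree_auts \<tau>) \<le> card (etree_auts \<tau>')"
proof -
  let ?\<psi> = "inv_into (verts \<tau>) \<phi>"
  let ?c = "\<lambda>g. restrict (\<phi> \<circ> (g \<circ> ?\<psi>)) (verts \<tau>')"
  have bij: "bij_betw \<phi> (verts \<tau>) (verts \<tau>')" using assms by (simp add: etree_iso_def)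
  have inv: "?\<psi> (\<phi> v) = v" if "v \<in> verts \<tau>" for v
    using bij that by (simp add: bij_betw_def)
  have "inj_on ?c (etree_auts \<tau>)"
  proof (rule inj_onI)
    fix g h assume g: "g \<in> etree_auts \<tau>" and h: "h \<in> etree_auts \<tau>" and eq: "?c g = ?c h"
    have "g v = h v" if v: "v \<in> verts \<tau>" for v
    proof -
      have "\<phi> v \<in> verts \<tau>'" using bij v by (auto dest: bij_betw_apply)
      then have "\<phi> (g v) = \<phi> (h v)"
        using fun_cong[OF eq, of "\<phi> v"] v inv by simp
      moreover have "g v \<in> verts \<tau>" "h v \<in> verts \<tau>"
        using g h v by (auto simp: etree_auts_def etree_iso_def dest: bij_betw_apply)
      ultimately show ?thesis using iso_inj_on[OF assms(3)] by (auto dest: inj_onD)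
    qed
    then show "g = h"
      using g h by (auto simp: etree_auts_def intro: extensionalityI)
  qed
  moreover have "?c g \<in> etree_auts \<tau>'" if "g \<in> etree_auts \<tau>" for g
  proof -
    have "etree_iso (\<phi> \<circ> (g \<circ> ?\<psi>)) \<tau>' \<tau>'"
      using that assms etree_iso_inv[OF assms(1,3)]
      by (intro etree_iso_comp) (auto simp: etree_auts_def)
    then show ?thesis
      using etree_iso_cong[OF assms(2)] by (auto simp: etree_auts_def)
  qed
  ultimately show ?thesis
    using finite_etree_auts[OF assms(2)] by (intro card_inj_on_le[of ?c]) auto
qed

lemma card_etree_auts_cong:
  assumes "etree_equiv \<tau> \<tau>'"
  shows "card (etree_auts \<tau>) = card (etree_auts \<tau>')"
  using assms etree_equiv_sym[OF assms] card_etree_auts_le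
  unfolding etree_equiv_def by (meson order_antisym)

lemma iso_remove_verts:
  assumes "is_etree \<tau>" "etree_iso \<phi> \<tau> \<tau>'" "S \<subseteq> verts \<tau>"
  shows "etree_iso \<phi> (remove_verts S \<tau>) (remove_verts (\<phi> ` S) \<tau>')"
proof -
  have inj: "inj_on \<phi> (verts \<tau>)" by (rule iso_inj_on[OF assms(2)])
  have V: "verts \<tau>' - \<phi> ` S = \<phi> ` (verts \<tau> - S)"
    using assms inj by (simp add: etree_iso_def bij_betw_def inj_on_image_set_diff[of \<phi> "verts \<tau>"])
  have bij: "bij_betw \<phi> (verts \<tau> - S) (\<phi> ` (verts \<tau> - S))"
    using inj by (auto simp: bij_betw_def intro: inj_on_subset)
  have e: "edges \<tau> \<subseteq> verts \<tau> \<times> verts \<tau>" "edges \<tau>' = map_prod \<phi> \<phi> ` edges \<tau>"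
    using assms by (auto simp: is_etree_def etree_iso_def)
  have E: "edges \<tau>' \<inter> \<phi> ` (verts \<tau> - S) \<times> \<phi> ` (verts \<tau> - S)
      = map_prod \<phi> \<phi> ` (edges \<tau> \<inter> (verts \<tau> - S) \<times> (verts \<tau> - S))" (is "?L = ?R")
  proof
    show "?R \<subseteq> ?L" using e by auto
    show "?L \<subseteq> ?R"
    proof
      fix z assume z: "z \<in> ?L"
      then obtain a b where ab: "(a, b) \<in> edges \<tau>" "z = (\<phi> a, \<phi> b)" using e by auto
      then have "a \<in> verts \<tau>" "b \<in> verts \<tau>" using e by auto
      with z ab have "a \<in> verts \<tau> - S" "b \<in> verts \<tau> - S"
        using inj_on_image_mem_iff[OF inj, of _ "verts \<tau> - S"] by auto
      with ab show "z \<in> ?R" by auto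
    qed
  qed
  have P: "{p \<in> pairs \<tau>'. p \<inter> \<phi> ` S = {}} = (`) \<phi> ` {p \<in> pairs \<tau>. p \<inter> S = {}}"
  proof -
    have "\<phi> ` p \<inter> \<phi> ` S = {} \<longleftrightarrow> p \<inter> S = {}" if "p \<in> pairs \<tau>" for p
    proof -
      have "p \<subseteq> verts \<tau>"
        using etree_pairs_subset[OF assms(1) that] coloured_subset by blast
      then have "\<phi> ` p \<inter> \<phi> ` S = \<phi> ` (p \<inter> S)"
        using inj_on_image_Int[OF inj] assms(3) by auto
      then show ?thesis by simp
    qed
    then show ?thesis
      using assms(2) by (auto simp: etree_iso_def)
  qed
  have r: "\<phi> (tree_root \<tau>) = tree_root \<tau>'"
    and c: "\<forall>v\<in>verts \<tau>. colour \<tau>' (\<phi> v) = colour \<tau> v"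
    using assms(2) by (simp_all add: etree_iso_def)
  show ?thesis
    unfolding etree_iso_def remove_verts_def using r c bij E P
    by (simp add: V)
qed

lemma is_etree_iso:
  assumes "is_etree \<tau>" "etree_iso \<phi> \<tau> \<tau>'"
  shows "dom (colour \<tau>') \<subseteq> verts \<tau>' \<Longrightarrow> is_etree \<tau>'"
proof -
  assume d: "dom (colour \<tau>') \<subseteq> verts \<tau>'"
  have inj: "inj_on \<phi> (verts \<tau>)" by (rule iso_inj_on[OF assms(2)])
  have V: "verts \<tau>' = \<phi> ` verts \<tau>" using assms(2) by (auto simp: etree_iso_def bij_betw_def)
  have e: "edges \<tau> \<subseteq> verts \<tau> \<times> verts \<tau>" "edges \<tau>' = map_prod \<phi> \<phi> ` edges \<tau>"
    using assms by (auto simp: is_etree_def etree_iso_def)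
  have r: "tree_root \<tau>' = \<phi> (tree_root \<tau>)" "tree_root \<tau> \<in> verts \<tau>"
    using assms by (auto simp: is_etree_def etree_iso_def)
  have mem: "(\<phi> v, z) \<in> edges \<tau>' \<longleftrightarrow> (\<exists>w. (v, w) \<in> edges \<tau> \<and> z = \<phi> w)" if "v \<in> verts \<tau>" for v z
    using that e inj by (auto dest!: inj_onD[OF inj])
  have nr: "v \<noteq> tree_root \<tau>" if "\<phi> v \<noteq> tree_root \<tau>'" for v using that r by auto
  have c: "colour \<tau>' (\<phi> v) = colour \<tau> v" if "v \<in> verts \<tau>" for v
    using assms that by (auto simp: etree_iso_def)
  have star: "(\<phi> v, \<phi> w) \<in> (edges \<tau>')\<^sup>*" if "(v, w) \<in> (edges \<tau>)\<^sup>*" for v w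
    using that by induction (auto simp: e(2) intro: rtrancl_into_rtrancl)
  have 1: "finite (verts \<tau>')" using assms V by (auto simp: is_etree_def)
  have 2: "tree_root \<tau>' \<in> verts \<tau>'" "edges \<tau>' \<subseteq> verts \<tau>' \<times> verts \<tau>'" using r e V by auto
  have 3: "(tree_root \<tau>', w) \<notin> edges \<tau>'" for w
    using mem[OF r(2)] assms(1) r by (auto simp: is_etree_def)
  have 4: "\<exists>!w. (v, w) \<in> edges \<tau>'" if v': "v \<in> verts \<tau>' - {tree_root \<tau>'}" for v
  proof -
    obtain v0 where v: "v0 \<in> verts \<tau>" "v = \<phi> v0" using v' V by auto
    then have "\<exists>!w. (v0, w) \<in> edges \<tau>"
      using v' nr assms(1) by (auto simp: is_etree_def)
    then show ?thesis using mem[OF v(1)] v(2) by auto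
  qed
  have 5: "(v, tree_root \<tau>') \<in> (edges \<tau>')\<^sup>*" if "v \<in> verts \<tau>'" for v
    using that V star r assms(1) by (auto simp: is_etree_def)
  have domv: "(\<exists>y. colour \<tau> v = Some y) \<longleftrightarrow> v \<in> verts \<tau> - {tree_root \<tau>}" for v
    using assms(1) unfolding is_etree_def dom_def by blast
  have 6: "dom (colour \<tau>') = verts \<tau>' - {tree_root \<tau>'}"
  proof (rule set_eqI)
    fix z
    show "z \<in> dom (colour \<tau>') \<longleftrightarrow> z \<in> verts \<tau>' - {tree_root \<tau>'}"
    proof (cases "z \<in> verts \<tau>'")
      case True
      then obtain v where v: "v \<in> verts \<tau>" "z = \<phi> v" using V by auto
      have "\<phi> v = tree_root \<tau>' \<longleftrightarrow> v = tree_root \<tau>" using r v inj by (auto dest: inj_onD)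
      then show ?thesis using v True c[OF v(1)] domv[of v] by (auto simp: dom_def)
    qed (use d in auto)
  qed
  have P: "pairs \<tau>' = (`) \<phi> ` pairs \<tau>" using assms(2) by (simp add: etree_iso_def)
  have injb: "inj_on \<phi> (coloured \<tau> Beta)"
    by (rule inj_on_subset[OF inj coloured_subset])
  have part: "partition_on (coloured \<tau> Beta) (pairs \<tau>)"
    using assms(1) by (simp add: is_etree_def)
  have "(`) \<phi> ` pairs \<tau> - {{}} = (`) \<phi> ` pairs \<tau>"
    using partition_onD3[OF part] by auto
  then have 7: "partition_on (coloured \<tau>' Beta) (pairs \<tau>')"
    using partition_on_inj_image[OF part injb] by (simp add: P iso_coloured[OF assms(2)])
  have 8: "card p = 2" if pp: "p \<in> pairs \<tau>'" for p
  proof -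
    obtain q where q: "q \<in> pairs \<tau>" "p = \<phi> ` q" using pp P by auto
    then have "inj_on \<phi> q"
      using etree_pairs_subset[OF assms(1)] injb inj_on_subset by blast
    then show ?thesis using q assms(1) by (simp add: card_image is_etree_def)
  qed
  show "is_etree \<tau>'"
    unfolding is_etree_def by (intro conjI allI ballI 1 2 3 4 5 6 7 8)
qed

lemma equiv_remove_verts:
  assumes "etree_equiv \<sigma> (remove_verts S \<tau>)" "is_etree \<tau>" "is_etree \<tau>'" "etree_iso \<phi> \<tau> \<tau>'"
    "S \<subseteq> verts \<tau>"
  shows "etree_equiv \<sigma> (remove_verts (\<phi> ` S) \<tau>')"
proof -
  have iso: "etree_iso \<phi> (remove_verts S \<tau>) (remove_verts (\<phi> ` S) \<tau>')"
    by (rule iso_remove_verts[OF assms(2,4,5)])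
  have t: "is_etree (remove_verts S \<tau>)" using assms(1) by (simp add: etree_equiv_def)
  have "dom (colour (remove_verts (\<phi> ` S) \<tau>')) \<subseteq> verts (remove_verts (\<phi> ` S) \<tau>')"
    by (auto simp: remove_verts_def)
  then have "is_etree (remove_verts (\<phi> ` S) \<tau>')" by (rule is_etree_iso[OF t iso])
  then have "etree_equiv (remove_verts S \<tau>) (remove_verts (\<phi> ` S) \<tau>')"
    unfolding etree_equiv_def using iso t by blast
  with assms(1) show ?thesis by (rule etree_equiv_trans)
qed

lemma finite_removals:
  assumes "is_etree \<tau>"
  shows "finite (alpha_removals \<sigma> \<tau>)" "finite (beta_removals \<sigma> \<tau>)"
proof -
  have f: "finite (verts \<tau>)" using assms by (simp add: is_etree_def)
  show "finite (alpha_removals \<sigma> \<tau>)"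
    by (rule finite_subset[OF _ f]) (auto simp: alpha_removals_def coloured_def)
  have "pairs \<tau> \<subseteq> Pow (verts \<tau>)"
    using etree_pairs_subset[OF assms] coloured_subset by blast
  then show "finite (beta_removals \<sigma> \<tau>)"
    using f by (auto simp: beta_removals_def intro: finite_subset)
qed

lemma card_removals_le:
  assumes "etree_equiv \<sigma> \<sigma>'" "etree_equiv \<tau> \<tau>'"
  shows "card (alpha_removals \<sigma> \<tau>) \<le> card (alpha_removals \<sigma>' \<tau>')"
    and "card (beta_removals \<sigma> \<tau>) \<le> card (beta_removals \<sigma>' \<tau>')"
proof -
  obtain \<phi> where \<phi>: "etree_iso \<phi> \<tau> \<tau>'" and t: "is_etree \<tau>" "is_etree \<tau>'"
    using assms by (auto simp: etree_equiv_def)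
  have inj: "inj_on \<phi> (verts \<tau>)" by (rule iso_inj_on[OF \<phi>])
  have rem: "etree_equiv \<sigma>' (remove_verts (\<phi> ` S) \<tau>')"
    if "etree_equiv \<sigma> (remove_verts S \<tau>)" "S \<subseteq> verts \<tau>" for S
    using etree_equiv_sym[OF assms(1)] equiv_remove_verts[OF that(1) t \<phi> that(2)]
    by (rule etree_equiv_trans)
  have "\<phi> v \<in> alpha_removals \<sigma>' \<tau>'" if v: "v \<in> alpha_removals \<sigma> \<tau>" for v
  proof -
    have vt: "v \<in> coloured \<tau> Alpha" "v \<in> verts \<tau>" "children \<tau> v = {}"
      and "etree_equiv \<sigma> (remove_verts {v} \<tau>)"
      using v by (simp_all add: alpha_removals_def coloured_def)
    then have "etree_equiv \<sigma>' (remove_verts {\<phi> v} \<tau>')" using rem[of "{v}"] by simp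
    moreover have "children \<tau>' (\<phi> v) = {}" using iso_children[OF t(1) \<phi> vt(2)] vt(3) by simp
    moreover have "\<phi> v \<in> coloured \<tau>' Alpha" using iso_coloured[OF \<phi>] vt(1) by simp
    ultimately show ?thesis by (simp add: alpha_removals_def)
  qed
  moreover have "inj_on \<phi> (alpha_removals \<sigma> \<tau>)"
    by (rule inj_on_subset[OF inj]) (auto simp: alpha_removals_def coloured_def)
  ultimately show "card (alpha_removals \<sigma> \<tau>) \<le> card (alpha_removals \<sigma>' \<tau>')"
    using finite_removals[OF t(2)] by (intro card_inj_on_le[of \<phi>]) auto
  have sub: "p \<subseteq> verts \<tau>" if "p \<in> pairs \<tau>" for p
    using etree_pairs_subset[OF t(1) that] coloured_subset by blast
  have "\<phi> ` p \<in> beta_removals \<sigma>' \<tau>'" if p: "p \<in> beta_removals \<sigma> \<tau>" for p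
  proof -
    have "p \<in> pairs \<tau>" using p by (simp add: beta_removals_def)
    then have "\<phi> ` p \<in> pairs \<tau>'" using \<phi> by (simp add: etree_iso_def)
    moreover have "etree_equiv \<sigma>' (remove_verts (\<phi> ` p) \<tau>')"
      using p sub[of p] by (intro rem) (simp_all add: beta_removals_def)
    moreover have "children \<tau>' (\<phi> v) = {}" if "v \<in> p" for v
    proof -
      have "v \<in> verts \<tau>" "children \<tau> v = {}"
        using that p sub[of p] by (auto simp: beta_removals_def)
      then show ?thesis using iso_children[OF t(1) \<phi>] by simp
    qed
    ultimately show ?thesis by (simp add: beta_removals_def)
  qed
  moreover have "inj_on ((`) \<phi>) (beta_removals \<sigma> \<tau>)"
    using sub inj
    by (auto simp: beta_removals_def inj_on_image_eq_iff intro!: inj_onI)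
  ultimately show "card (beta_removals \<sigma> \<tau>) \<le> card (beta_removals \<sigma>' \<tau>')"
    using finite_removals[OF t(2)] by (intro card_inj_on_le[of "(`) \<phi>"]) auto
qed


subsection \<open>Isomorphism classes\<close>

lift_definition tree_size :: "exotic_tree \<Rightarrow> nat" is etree_size
  by (rule etree_size_cong)

lift_definition symmetry_factor :: "exotic_tree \<Rightarrow> nat" is "\<lambda>\<tau>. card (etree_auts \<tau>)"
  by (rule card_etree_auts_cong)

lift_definition elementary_differential ::
  "(real \<Rightarrow> real) \<Rightarrow> (real \<Rightarrow> real) \<Rightarrow> (real \<Rightarrow> real) \<Rightarrow> real \<Rightarrow> exotic_tree \<Rightarrow> real" is etree_diff
  by (rule etree_diff_cong)

lift_definition m_alpha :: "exotic_tree \<Rightarrow> exotic_tree \<Rightarrow> nat" is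
  "\<lambda>\<tau>' \<tau>. card (alpha_removals \<tau>' \<tau>)"
  by (intro order_antisym card_removals_le(1)) (simp_all add: etree_equiv_sym)

lift_definition m_beta :: "exotic_tree \<Rightarrow> exotic_tree \<Rightarrow> nat" is
  "\<lambda>\<tau>' \<tau>. card (beta_removals \<tau>' \<tau>)"
  by (intro order_antisym card_removals_le(2)) (simp_all add: etree_equiv_sym)

lemma removals_size:
  assumes "is_etree \<tau>"
  shows "v \<in> alpha_removals \<sigma> \<tau> \<Longrightarrow> etree_size \<sigma> < etree_size \<tau>"
    and "p \<in> beta_removals \<sigma> \<tau> \<Longrightarrow> etree_size \<sigma> < etree_size \<tau>"
proof -
  have fin: "finite (coloured \<tau> c)" for c
    using assms by (auto simp: is_etree_def intro: finite_subset[OF coloured_subset])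
  have rem: "coloured (remove_verts S \<tau>) c = coloured \<tau> c - S" for S c
    by (auto simp: coloured_def remove_verts_def)
  show "etree_size \<sigma> < etree_size \<tau>" if v: "v \<in> alpha_removals \<sigma> \<tau>"
  proof -
    have "etree_size \<sigma> = etree_size (remove_verts {v} \<tau>)"
      using v by (auto simp: alpha_removals_def intro: etree_size_cong)
    moreover have "v \<in> coloured \<tau> Alpha" "v \<notin> coloured \<tau> Beta"
      using v by (auto simp: alpha_removals_def coloured_def)
    ultimately show ?thesis
      using card_Diff1_less[OF fin, of v Alpha] by (simp add: etree_size_def rem)
  qed
  show "etree_size \<sigma> < etree_size \<tau>" if p: "p \<in> beta_removals \<sigma> \<tau>"
  proof -
    have pp: "p \<in> pairs \<tau>" using p by (simp add: beta_removals_def)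
    have sub: "p \<subseteq> coloured \<tau> Beta" by (rule etree_pairs_subset[OF assms pp])
    have c2: "card p = 2" using assms pp by (auto simp: is_etree_def)
    have "coloured \<tau> Alpha - p = coloured \<tau> Alpha" using sub by (auto simp: coloured_def)
    moreover have "card (coloured \<tau> Beta - p) = card (coloured \<tau> Beta) - 2"
      using sub c2 fin by (simp add: card_Diff_subset finite_subset)
    moreover have "2 \<le> card (coloured \<tau> Beta)" using card_mono[OF fin sub] c2 by simp
    moreover have "etree_size \<sigma> = etree_size (remove_verts p \<tau>)"
      using p by (auto simp: beta_removals_def intro: etree_size_cong)
    ultimately show ?thesis by (simp add: etree_size_def rem)
  qed
qed

lemma m_alpha_size: "m_alpha \<tau>' \<tau> \<noteq> 0 \<Longrightarrow> tree_size \<tau>' < tree_size \<tau>"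
proof (transfer, goal_cases)
  case (1 \<tau>' \<tau>)
  then obtain v where "v \<in> alpha_removals \<tau>' \<tau>" by fastforce
  with 1 show ?case using removals_size(1) by (auto simp: etree_equiv_def)
qed

lemma m_beta_size: "m_beta \<tau>' \<tau> \<noteq> 0 \<Longrightarrow> tree_size \<tau>' < tree_size \<tau>"
proof (transfer, goal_cases)
  case (1 \<tau>' \<tau>)
  then obtain p where "p \<in> beta_removals \<tau>' \<tau>" by fastforce
  with 1 show ?case using removals_size(2) by (auto simp: etree_equiv_def)
qed

text \<open>The reciprocal $1/\tau!$. The sums range over those isomorphism classes \<open>\<tau>'\<close> with nonzero
  multiplicity; these are finitely many, see below.\<close>

function inv_tree_factorial :: "exotic_tree \<Rightarrow> real" where
  "inv_tree_factorial \<tau> =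
     (if tree_size \<tau> = 1 then 1
      else ((\<Sum>\<tau>'\<in>{\<tau>'. m_alpha \<tau>' \<tau> \<noteq> 0}. real (m_alpha \<tau>' \<tau>) * inv_tree_factorial \<tau>') +
            (\<Sum>\<tau>'\<in>{\<tau>'. m_beta \<tau>' \<tau> \<noteq> 0}. real (m_beta \<tau>' \<tau>) * inv_tree_factorial \<tau>')) /
           real (tree_size \<tau>))"
  by auto
termination
  by (relation "Wellfounded.measure tree_size") (auto simp: m_alpha_size m_beta_size)

declare inv_tree_factorial.simps [simp del]

lemma rep_exotic_tree: obtains \<rho> where "is_etree \<rho>" "abs_exotic_tree \<rho> = \<tau>"
  using Quotient3_abs_rep[OF Quotient3_exotic_tree]
    Quotient3_rep_reflp[OF Quotient3_exotic_tree] unfolding etree_equiv_def by blast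

lemma finite_m_support: "finite {\<tau>'. m_alpha \<tau>' \<tau> \<noteq> 0}" "finite {\<tau>'. m_beta \<tau>' \<tau> \<noteq> 0}"
proof -
  obtain \<rho> where \<rho>: "is_etree \<rho>" "abs_exotic_tree \<rho> = \<tau>" by (rule rep_exotic_tree)
  have f: "finite (verts \<rho>)" using \<rho> by (simp add: is_etree_def)
  have fp: "finite (pairs \<rho>)"
    using etree_pairs_subset[OF \<rho>(1)] coloured_subset[of \<rho> Beta] f
    by (intro finite_subset[of "pairs \<rho>" "Pow (verts \<rho>)"]) auto
  show "finite {\<tau>'. m_alpha \<tau>' \<tau> \<noteq> 0}"
  proof (rule finite_subset)
    show "finite ((\<lambda>v. abs_exotic_tree (remove_verts {v} \<rho>)) ` verts \<rho>)" using f by simp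
    show "{\<tau>'. m_alpha \<tau>' \<tau> \<noteq> 0} \<subseteq> (\<lambda>v. abs_exotic_tree (remove_verts {v} \<rho>)) ` verts \<rho>"
    proof
      fix \<tau>' assume a: "\<tau>' \<in> {\<tau>'. m_alpha \<tau>' \<tau> \<noteq> 0}"
      obtain \<rho>' where \<rho>': "is_etree \<rho>'" "abs_exotic_tree \<rho>' = \<tau>'" by (rule rep_exotic_tree)
      have "card (alpha_removals \<rho>' \<rho>) \<noteq> 0"
        using a m_alpha.abs_eq[OF etree_equiv_refl[OF \<rho>'(1)] etree_equiv_refl[OF \<rho>(1)]]
        by (simp add: \<rho>(2) \<rho>'(2))
      then obtain v where "v \<in> alpha_removals \<rho>' \<rho>" by fastforce
      then have "v \<in> verts \<rho>" "etree_equiv \<rho>' (remove_verts {v} \<rho>)"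
        by (auto simp: alpha_removals_def coloured_def)
      then show "\<tau>' \<in> (\<lambda>v. abs_exotic_tree (remove_verts {v} \<rho>)) ` verts \<rho>"
        using Quotient3_rel_abs[OF Quotient3_exotic_tree] \<rho>'(2) by blast
    qed
  qed
  show "finite {\<tau>'. m_beta \<tau>' \<tau> \<noteq> 0}"
  proof (rule finite_subset)
    show "finite ((\<lambda>p. abs_exotic_tree (remove_verts p \<rho>)) ` pairs \<rho>)" using fp by simp
    show "{\<tau>'. m_beta \<tau>' \<tau> \<noteq> 0} \<subseteq> (\<lambda>p. abs_exotic_tree (remove_verts p \<rho>)) ` pairs \<rho>"
    proof
      fix \<tau>' assume a: "\<tau>' \<in> {\<tau>'. m_beta \<tau>' \<tau> \<noteq> 0}"
      obtain \<rho>' where \<rho>': "is_etree \<rho>'" "abs_exotic_tree \<rho>' = \<tau>'" by (rule rep_exotic_tree)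
      have "card (beta_removals \<rho>' \<rho>) \<noteq> 0"
        using a m_beta.abs_eq[OF etree_equiv_refl[OF \<rho>'(1)] etree_equiv_refl[OF \<rho>(1)]]
        by (simp add: \<rho>(2) \<rho>'(2))
      then obtain p where "p \<in> beta_removals \<rho>' \<rho>" by fastforce
      then have "p \<in> pairs \<rho>" "etree_equiv \<rho>' (remove_verts p \<rho>)"
        by (auto simp: beta_removals_def)
      then show "\<tau>' \<in> (\<lambda>p. abs_exotic_tree (remove_verts p \<rho>)) ` pairs \<rho>"
        using Quotient3_rel_abs[OF Quotient3_exotic_tree] \<rho>'(2) by blast
    qed
  qed
qed

end

theory Submission
  imports Defs "HOL-Library.Function_Algebras"
begin

text \<open>Both sides of the theorem equal $\frac{t^N}{N!}(\mathcal{G}^N f)(u_0)$, where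
$\mathcal{G}g = \alpha g' + \frac12\beta^2 g''$ is the generator of the stochastic differential
equation.

For the path integral (\<open>msr_term_eq_generator\<close>), fix the times. If some vertex $j \ge 1$ carries the
largest of all times, then no Heaviside factor allows $y_j$ to be contracted, and the integrand
vanishes at $y = 0$. Otherwise, outside a null set, all $s_j$ are distinct and smaller than $t$.
Then strip off the vertex $m$ with the smallest time. No $y_j$ is contracted with $x_m$, while
$y_m$ may be contracted with every other $x_i$; so a factor $y_m^k$ turns into the $k$-th power of
$\sum_{i \neq m}\partial_{x_i}$, which on the diagonal $x_i = z$ is $(d/dz)^k$. Vertex $m$ thus
applies $\alpha\,d/dz + \frac12\beta^2\,d^2/dz^2 = \mathcal{G}$ to what the other vertices produce
(\<open>exp_contraction_ordered\<close>). The integrand is therefore almost everywhere $(\mathcal{G}^N f)(u_0)$ on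
$[0,t]^N$ and zero on the rest of $[0,T]^N$, whatever the order of the times, and the integral is
the volume of a cube.

For the trees (\<open>generator_power_eq_tree_sum\<close>), differentiating an elementary differential raises
the number of children of one vertex by one. Hence $\mathcal{G}$ grafts either one $\alpha$-leaf or a
pair of $\beta$-leaves in all possible ways. Grafting is inverse to removing: the isomorphisms from
a graft of $\rho$ onto $\tau$ correspond to the choices of a removable bundle of leaves of $\tau$
together with an isomorphism from $\rho$ onto what remains (\<open>bij_betw_graft_isos\<close>). Counting both
sides expresses the number of graftings that yield $\tau$ through the removal multiplicities and the
two symmetry factors; the two orders of a $\beta$-pair cancel the factor $\frac12$. The coefficients
$|\tau|!/(\sigma(\tau)\,\tau!)$ obey the resulting recursion because of the recursion that defines
$\tau!$.\<close>


section \<open>Polynomial fields with smooth coefficients\<close>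

lemma C_infinity_deriv: "C_infinity g \<Longrightarrow> C_infinity (deriv g)"
  unfolding C_infinity_def by (metis comp_apply funpow_Suc_right)

lemma C_infinity_funpow_deriv: "C_infinity g \<Longrightarrow> C_infinity ((deriv ^^ n) g)"
  by (induction n) (auto intro: C_infinity_deriv)

lemma C_infinity_DERIV:
  assumes "C_infinity g"
  shows "(g has_field_derivative deriv g x) (at x)"
proof -
  have "(deriv ^^ 0) g differentiable (at x)" using assms unfolding C_infinity_def by blast
  then show ?thesis by (simp add: DERIV_deriv_iff_real_differentiable)
qed

text \<open>Functions of the fields form a commutative ring under pointwise operations. The rules that push
evaluation through these operations are removed from the simplifier, so that identities between
operators are proved in the ring; they are supplied where values at a point are meant.\<close>

lemmas pointwise = plus_fun_apply times_fun_apply zero_fun_apply one_fun_apply of_nat_fun_apply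

declare pointwise [simp del]

text \<open>The algebra generated by smooth functions of single variables $x_i$, $i \in I$, and by the variables
$y_j$, $j \in J$. Partial derivatives defined by \<open>deriv\<close> are additive, obey the product rule and
commute on this algebra, which they need not do for arbitrary functions; the index sets record on
which variables a function depends.\<close>

inductive polynomial_field :: "nat set \<Rightarrow> nat set \<Rightarrow> field_fun \<Rightarrow> bool" for I J where
  const: "polynomial_field I J (\<lambda>x y. c)"
| coeff: "i \<in> I \<Longrightarrow> C_infinity g \<Longrightarrow> polynomial_field I J (\<lambda>x y. g (x i))"
| aux: "j \<in> J \<Longrightarrow> polynomial_field I J (\<lambda>x y. y j)"
| add: "polynomial_field I J G \<Longrightarrow> polynomial_field I J H \<Longrightarrow> polynomial_field I J (G + H)"
| mult: "polynomial_field I J G \<Longrightarrow> polynomial_field I J H \<Longrightarrow> polynomial_field I J (G * H)"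

lemma polynomial_field_mono:
  assumes "polynomial_field I J G" "I \<subseteq> I'" "J \<subseteq> J'"
  shows "polynomial_field I' J' G"
  using assms(1)
  by induction (use assms(2,3) in \<open>auto intro: polynomial_field.intros\<close>)

lemma zero_polynomial_field: "polynomial_field I J 0"
  using polynomial_field.const[where c = 0] by (simp add: zero_fun_def)

lemma one_polynomial_field: "polynomial_field I J 1"
  using polynomial_field.const[where c = 1] by (simp add: one_fun_def)

lemma of_nat_polynomial_field: "polynomial_field I J (of_nat n)"
  using polynomial_field.const[where c = "of_nat n"] by (simp add: of_nat_fun)

lemma sum_polynomial_field:
  "(\<And>k. k \<in> K \<Longrightarrow> polynomial_field I J (G k)) \<Longrightarrow> polynomial_field I J (sum G K)"
  by (induction K rule: infinite_finite_induct)
     (auto intro: polynomial_field.intros zero_polynomial_field)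

lemma power_polynomial_field: "polynomial_field I J G \<Longrightarrow> polynomial_field I J (G ^ n)"
  by (induction n) (auto intro: polynomial_field.intros one_polynomial_field)

lemma differentiable_x:
  assumes "polynomial_field I J G"
  shows "(\<lambda>z. G (x(i := z)) y) differentiable (at w)"
  using assms
proof induction
  case (coeff k g)
  then show ?case using C_infinity_DERIV[of g w]
    by (cases "i = k") (auto simp: real_differentiable_def)
qed (auto simp: pointwise)

lemma differentiable_y:
  assumes "polynomial_field I J G"
  shows "(\<lambda>z. G x (y(j := z))) differentiable (at w)"
  using assms
proof induction
  case (aux k)
  then show ?case by (cases "j = k") auto
qed (auto simp: pointwise)

lemma DERIV_pdx:
  assumes "polynomial_field I J G"
  shows "((\<lambda>z. G (x(i := z)) y) has_field_derivative pdx i G x y) (at (x i))"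
  using differentiable_x[OF assms] unfolding pdx_def DERIV_deriv_iff_real_differentiable .

lemma DERIV_pdy:
  assumes "polynomial_field I J G"
  shows "((\<lambda>z. G x (y(j := z))) has_field_derivative pdy j G x y) (at (y j))"
  using differentiable_y[OF assms] unfolding pdy_def DERIV_deriv_iff_real_differentiable .

lemma pdx_eqI:
  "(\<And>x y. ((\<lambda>z. G (x(i := z)) y) has_field_derivative D x y) (at (x i))) \<Longrightarrow> pdx i G = D"
  unfolding pdx_def by (intro ext DERIV_imp_deriv) blast

lemma pdy_eqI:
  "(\<And>x y. ((\<lambda>z. G x (y(j := z))) has_field_derivative D x y) (at (y j))) \<Longrightarrow> pdy j G = D"
  unfolding pdy_def by (intro ext DERIV_imp_deriv) blast

lemma pdx_const [simp]: "pdx i (\<lambda>x y. c) = 0" and pdy_const [simp]: "pdy j (\<lambda>x y. c) = 0"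
  by (auto simp: pointwise intro!: pdx_eqI pdy_eqI)

lemma pdx_zero [simp]: "pdx i 0 = 0" and pdy_zero [simp]: "pdy j 0 = 0"
  by (auto simp: pointwise intro!: pdx_eqI pdy_eqI)

lemma pdx_aux [simp]: "pdx i (\<lambda>x y. y j) = 0" and pdy_coeff [simp]: "pdy j (\<lambda>x y. g (x i)) = 0"
  by (auto simp: pointwise intro!: pdx_eqI pdy_eqI)

lemma pdx_coeff:
  "C_infinity g \<Longrightarrow> pdx i (\<lambda>x y. g (x k)) = (if i = k then (\<lambda>x y. deriv g (x k)) else 0)"
  by (rule pdx_eqI) (auto simp: pointwise intro: C_infinity_DERIV)

lemma pdy_aux: "pdy j (\<lambda>x y. y k) = (if j = k then 1 else 0)"
  by (rule pdy_eqI) (auto simp: pointwise)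

lemma
  assumes "polynomial_field I J G" "polynomial_field I' J' H"
  shows pdx_add: "pdx i (G + H) = pdx i G + pdx i H"
    and pdy_add: "pdy i (G + H) = pdy i G + pdy i H"
    and pdx_mult: "pdx i (G * H) = pdx i G * H + G * pdx i H"
    and pdy_mult: "pdy i (G * H) = pdy i G * H + G * pdy i H"
  by (auto simp: pointwise intro!: pdx_eqI pdy_eqI derivative_eq_intros
       DERIV_pdx[OF assms(1)] DERIV_pdx[OF assms(2)]
       DERIV_pdy[OF assms(1)] DERIV_pdy[OF assms(2)])

lemma pdx_polynomial_field:
  assumes "polynomial_field I J G"
  shows "polynomial_field I J (pdx i G)"
  using assms
proof induction
  case (add G H) then show ?case by (auto simp: pdx_add intro: polynomial_field.intros)
next
  case (mult G H) then show ?case by (auto simp: pdx_mult intro: polynomial_field.intros)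
qed (auto simp: pdx_coeff zero_polynomial_field intro!: polynomial_field.coeff C_infinity_deriv)

lemma pdy_polynomial_field:
  assumes "polynomial_field I J G"
  shows "polynomial_field I J (pdy i G)"
  using assms
proof induction
  case (add G H) then show ?case by (auto simp: pdy_add intro: polynomial_field.intros)
next
  case (mult G H) then show ?case by (auto simp: pdy_mult intro: polynomial_field.intros)
qed (auto simp: pdy_aux zero_polynomial_field one_polynomial_field)

lemma pdx_outside:
  assumes "polynomial_field I J G" "i \<notin> I"
  shows "pdx i G = 0"
  using assms(1)
  by induction (use assms(2) in \<open>auto simp: pdx_coeff pdx_add pdx_mult\<close>)

lemma pdy_outside:
  assumes "polynomial_field I J G" "j \<notin> J"
  shows "pdy j G = 0"
  using assms(1)
  by induction (use assms(2) in \<open>auto simp: pdy_aux pdy_add pdy_mult\<close>)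

lemma pdx_sum:
  assumes "finite K" "\<And>k. k \<in> K \<Longrightarrow> polynomial_field I J (G k)"
  shows "pdx i (sum G K) = (\<Sum>k\<in>K. pdx i (G k))"
  using assms
proof (induction K rule: finite_induct)
  case (insert k K)
  then have "pdx i (G k + sum G K) = pdx i (G k) + pdx i (sum G K)"
    by (intro pdx_add[where I = I and J = J and I' = I and J' = J] sum_polynomial_field) auto
  then show ?case using insert by simp
qed simp

lemma pdx_scale:
  "polynomial_field I J G \<Longrightarrow> pdx i ((\<lambda>x y. c) * G) = (\<lambda>x y. c) * pdx i G"
  by (simp add: pdx_mult[OF polynomial_field.const])

lemma pdy_scale:
  "polynomial_field I J G \<Longrightarrow> pdy i ((\<lambda>x y. c) * G) = (\<lambda>x y. c) * pdy i G"
  by (simp add: pdy_mult[OF polynomial_field.const])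

lemma pdx_commute:
  assumes "polynomial_field I J G"
  shows "pdx i (pdx k G) = pdx k (pdx i G)"
  using assms
proof induction
  case (coeff l g) then show ?case by (auto simp: pdx_coeff C_infinity_deriv)
next
  case (add G H)
  then show ?case by (simp add: pdx_add pdx_add[OF pdx_polynomial_field pdx_polynomial_field])
next
  case (mult G H)
  then show ?case
    by (simp add: pdx_mult pdx_add[OF polynomial_field.mult polynomial_field.mult]
          pdx_mult[OF _ pdx_polynomial_field] pdx_mult[OF pdx_polynomial_field]
          pdx_polynomial_field algebra_simps)
qed auto

lemma pdx_pdy_commute:
  assumes "polynomial_field I J G"
  shows "pdx i (pdy k G) = pdy k (pdx i G)"
  using assms
proof induction
  case (coeff l g) then show ?case by (auto simp: pdx_coeff)
next
  case (aux j)
  then show ?case using pdx_const[of i 1] by (auto simp: pdy_aux one_fun_def)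
next
  case (add G H)
  then show ?case
    by (simp add: pdx_add pdy_add pdx_add[OF pdy_polynomial_field pdy_polynomial_field]
          pdy_add[OF pdx_polynomial_field pdx_polynomial_field])
next
  case (mult G H)
  then show ?case
    by (simp add: pdx_mult pdy_mult pdx_polynomial_field pdy_polynomial_field
          pdx_add[OF polynomial_field.mult polynomial_field.mult]
          pdy_add[OF polynomial_field.mult polynomial_field.mult]
          pdx_mult[OF _ pdy_polynomial_field] pdx_mult[OF pdy_polynomial_field]
          pdy_mult[OF _ pdx_polynomial_field] pdy_mult[OF pdx_polynomial_field] algebra_simps)
qed auto

section \<open>The contraction operator\<close>

text \<open>The derivative along the diagonal direction in the variables $x_i$, $i \in I$; compare
\<open>DERIV_diagonal\<close>.\<close>

definition diagonal_deriv :: "nat set \<Rightarrow> field_fun \<Rightarrow> field_fun" where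
  "diagonal_deriv I G = (\<Sum>i\<in>I. pdx i G)"

lemma diagonal_deriv_polynomial_field: "polynomial_field I' J G \<Longrightarrow> polynomial_field I' J (diagonal_deriv I G)"
  unfolding diagonal_deriv_def by (intro sum_polynomial_field pdx_polynomial_field)

lemma diagonal_deriv_funpow_in: "polynomial_field I' J G \<Longrightarrow> polynomial_field I' J ((diagonal_deriv I ^^ k) G)"
  by (induction k) (auto intro: diagonal_deriv_polynomial_field)

lemma sum_fun2_apply: "(\<Sum>k\<in>K. G k) x y = (\<Sum>k\<in>K. G k x y)"
  by (induction K rule: infinite_finite_induct) (auto simp: pointwise)

text \<open>The chain rule for the diagonal embedding of the line. It is what turns contractions with all
vertices at once into an ordinary derivative.\<close>

lemma DERIV_diagonal:
  assumes "polynomial_field I J G" "finite I"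
  shows "((\<lambda>z. G (\<lambda>_. z) y) has_field_derivative diagonal_deriv I G (\<lambda>_. z) y) (at z)"
  using assms(1)
proof induction
  case (const c)
  then show ?case by (simp add: diagonal_deriv_def pointwise)
next
  case (coeff i g)
  then have "diagonal_deriv I (\<lambda>x y. g (x i)) = (\<lambda>x y. deriv g (x i))"
    using assms(2) by (simp add: diagonal_deriv_def pdx_coeff)
  then show ?case using C_infinity_DERIV[OF coeff(2)] by simp
next
  case (aux j)
  then show ?case by (simp add: diagonal_deriv_def pointwise)
next
  case (add G H)
  then have eq: "diagonal_deriv I (G + H) = diagonal_deriv I G + diagonal_deriv I H"
    by (simp add: diagonal_deriv_def pdx_add sum.distrib)
  have "((\<lambda>z. (G + H) (\<lambda>_. z) y) has_field_derivative diagonal_deriv I (G + H) (\<lambda>_. z) y) (at z)"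
    unfolding eq using DERIV_add[OF add.IH] by (simp add: pointwise algebra_simps)
  then show ?case .
next
  case (mult G H)
  then have eq: "diagonal_deriv I (G * H) = diagonal_deriv I G * H + G * diagonal_deriv I H"
    by (simp add: diagonal_deriv_def pdx_mult sum.distrib sum_distrib_left sum_distrib_right)
  have "((\<lambda>z. (G * H) (\<lambda>_. z) y) has_field_derivative diagonal_deriv I (G * H) (\<lambda>_. z) y) (at z)"
    unfolding eq using DERIV_mult[OF mult.IH] by (simp add: pointwise algebra_simps)
  then show ?case .
qed

lemma contraction_alt:
  "contraction N s G =
     (\<Sum>i\<in>{0..N}. \<Sum>j\<in>{1..N} - {i}. (\<lambda>x y. heaviside (s i - s j)) * pdx i (pdy j G))"
  by (intro ext) (simp add: contraction_def sum_fun2_apply pointwise)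

lemma contraction_polynomial_field:
  "polynomial_field I J G \<Longrightarrow> polynomial_field I J (contraction N s G)"
  unfolding contraction_alt
  by (intro sum_polynomial_field polynomial_field.mult polynomial_field.const pdx_polynomial_field
        pdy_polynomial_field)

lemma contraction_funpow_in:
  "polynomial_field I J G \<Longrightarrow> polynomial_field I J ((contraction N s ^^ n) G)"
  by (induction n) (auto intro: contraction_polynomial_field)

lemma contraction_add:
  assumes "polynomial_field I J G" "polynomial_field I J H"
  shows "contraction N s (G + H) = contraction N s G + contraction N s H"
  using assms unfolding contraction_alt
  by (simp add: pdy_add pdx_add[OF pdy_polynomial_field pdy_polynomial_field]
       sum.distrib distrib_left)

lemma contraction_scale:
  assumes "polynomial_field I J G"
  shows "contraction N s ((\<lambda>x y. c) * G) = (\<lambda>x y. c) * contraction N s G"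
  unfolding contraction_alt sum_distrib_left
  by (intro sum.cong refl)
     (simp only: pdy_scale[OF assms] pdx_scale[OF pdy_polynomial_field[OF assms]] mult.left_commute)

lemma contraction_funpow_add:
  assumes "polynomial_field I J G" "polynomial_field I J H"
  shows "(contraction N s ^^ n) (G + H) = (contraction N s ^^ n) G + (contraction N s ^^ n) H"
  using assms
  by (induction n) (auto simp: contraction_add[OF contraction_funpow_in contraction_funpow_in])

lemma contraction_funpow_scale:
  assumes "polynomial_field I J G"
  shows "(contraction N s ^^ n) ((\<lambda>x y. c) * G) = (\<lambda>x y. c) * (contraction N s ^^ n) G"
  using assms
  by (induction n) (auto simp: contraction_scale[OF contraction_funpow_in])

lemma contraction_pdx_commute:
  assumes "polynomial_field I J G"
  shows "contraction N s (pdx k G) = pdx k (contraction N s G)"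
proof -
  note in_alg = assms pdx_polynomial_field pdy_polynomial_field sum_polynomial_field
    polynomial_field.mult polynomial_field.const
  have "pdx k (contraction N s G) =
     (\<Sum>i\<in>{0..N}. \<Sum>j\<in>{1..N} - {i}. pdx k ((\<lambda>x y. heaviside (s i - s j)) * pdx i (pdy j G)))"
    unfolding contraction_alt
    by (subst pdx_sum[where I = I and J = J], simp, blast intro: in_alg)
       (intro sum.cong refl pdx_sum[where I = I and J = J], simp, blast intro: in_alg)
  also have "\<dots> = contraction N s (pdx k G)"
    unfolding contraction_alt
  proof (intro sum.cong refl)
    fix i j
    have "pdx k (pdx i (pdy j G)) = pdx i (pdy j (pdx k G))"
      using pdx_commute[OF pdy_polynomial_field[OF assms]] pdx_pdy_commute[OF assms] by simp
    then show "pdx k ((\<lambda>x y. heaviside (s i - s j)) * pdx i (pdy j G)) =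
       (\<lambda>x y. heaviside (s i - s j)) * pdx i (pdy j (pdx k G))"
      using pdx_scale[OF pdx_polynomial_field[OF pdy_polynomial_field[OF assms]]] by simp
  qed
  finally show ?thesis by simp
qed

text \<open>Constant coefficient differential operators commute. This allows the diagonal derivatives created
by contracting one vertex to be taken after all other contractions.\<close>

lemma contraction_diagonal_deriv_commute:
  assumes "polynomial_field I J G" "finite K"
  shows "contraction N s (diagonal_deriv K G) = diagonal_deriv K (contraction N s G)"
  unfolding diagonal_deriv_def contraction_pdx_commute[OF assms(1), symmetric]
  using assms(2)
proof (induction K rule: finite_induct)
  case empty
  show ?case by (simp add: contraction_alt)
next
  case (insert k K)
  then show ?case
    using contraction_add[OF pdx_polynomial_field[OF assms(1)]
        sum_polynomial_field[where K = K and G = "\<lambda>i. pdx i G" and I = I and J = J]]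
        pdx_polynomial_field[OF assms(1)]
    by simp
qed

lemma contraction_funpow_diagonal_deriv_commute:
  assumes "polynomial_field I J G" "finite K"
  shows "(contraction N s ^^ n) ((diagonal_deriv K ^^ k) G) = (diagonal_deriv K ^^ k) ((contraction N s ^^ n) G)"
proof -
  have 1: "(contraction N s ^^ n) (diagonal_deriv K G) = diagonal_deriv K ((contraction N s ^^ n) G)"
    if "polynomial_field I J G" for G
    using that
    by (induction n)
       (auto simp: contraction_diagonal_deriv_commute[OF contraction_funpow_in[where I = I and J = J] assms(2)])
  show ?thesis
    by (induction k) (auto simp: 1 diagonal_deriv_funpow_in assms(1))
qed

lemma pdy_power_aux:
  "pdy j ((\<lambda>x y. y m) ^ k) = (if j = m then of_nat k * (\<lambda>x y. y m) ^ (k - 1) else 0)"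
proof (induction k)
  case 0
  then show ?case using pdy_const[of j 1] by (simp add: one_fun_def zero_fun_def[symmetric])
next
  case (Suc k)
  have a: "polynomial_field {} {m} (\<lambda>x y. y m)" by (auto intro: polynomial_field.aux)
  show ?case
    using Suc
    by (cases k) (auto simp: pdy_mult[OF a power_polynomial_field[OF a]] pdy_aux algebra_simps
          pdy_mult[OF a polynomial_field.mult[OF a power_polynomial_field[OF a]]])
qed

lemma pdx_power_aux: "pdx i ((\<lambda>x y. y m) ^ k) = 0"
  by (rule pdx_outside[where I = "{}" and J = "{m}"]) (auto intro: power_polynomial_field polynomial_field.aux)

section \<open>Contracting the earliest vertex\<close>

text \<open>Vertex \<open>m\<close> carries a smaller time than the root and all vertices in \<open>J\<close>. The field \<open>C\<close> plays the role
of its coefficient, $\alpha(x_m)$ or $\frac12\beta(x_m)^2$.\<close>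

locale earliest_vertex =
  fixes N m :: nat and s :: "nat \<Rightarrow> real" and J :: "nat set" and C :: field_fun
  assumes J: "J \<subseteq> {1..N}" and m: "m \<in> {1..N}" "m \<notin> J"
    and earliest: "\<And>i. i \<in> insert 0 J \<Longrightarrow> s m < s i"
    and C: "polynomial_field {m} {} C"
begin

abbreviation "later \<equiv> insert 0 J"

abbreviation monomial :: "nat \<Rightarrow> field_fun \<Rightarrow> field_fun" where
  "monomial k H \<equiv> H * (\<lambda>x y. y m) ^ k * C"

lemma monomial_polynomial_field:
  assumes "polynomial_field later J H"
  shows "polynomial_field (insert m later) (insert m J) (monomial k H)"
  by (intro polynomial_field.mult power_polynomial_field polynomial_field.aux
      polynomial_field_mono[OF assms] polynomial_field_mono[OF C]) auto

text \<open>Since $m$ is earliest, $\Theta(s_m - s_j) = 0$ for $j \in J$, so $C$ is never differentiated, and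
$\Theta(s_i - s_m) = 1$ for all other vertices $i$, so a contraction that uses $y_m$ lowers the
exponent and differentiates $H$ in every $x_i$ with equal weight.\<close>

lemma contraction_monomial:
  assumes H: "polynomial_field later J H"
  shows "contraction N s (monomial k H) =
    monomial k (contraction N s H) + of_nat k * monomial (k - 1) (diagonal_deriv later H)"
proof -
  let ?Y = "\<lambda>(x::nat \<Rightarrow> real) (y::nat \<Rightarrow> real). y m"
  have Y: "polynomial_field {} {m} (?Y ^ l)" for l
    by (intro power_polynomial_field polynomial_field.aux) simp
  have YC: "polynomial_field {m} {m} (?Y ^ l * C)" for l
    by (intro polynomial_field.mult polynomial_field_mono[OF Y] polynomial_field_mono[OF C]) auto
  have n: "polynomial_field later J (of_nat l)" for l by (rule of_nat_polynomial_field)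
  have dy: "pdy j (monomial k H) =
      pdy j H * (?Y ^ k * C) + (if j = m then of_nat k * H * (?Y ^ (k - 1) * C) else 0)" for j
  proof -
    have "pdy j (monomial k H) = pdy j (H * (?Y ^ k * C))" by (simp only: mult.assoc)
    also have "\<dots> = pdy j H * (?Y ^ k * C) + H * (pdy j (?Y ^ k) * C + ?Y ^ k * pdy j C)"
      by (simp only: pdy_mult[OF H YC] pdy_mult[OF Y C])
    finally show ?thesis
      by (simp add: pdy_power_aux pdy_outside[OF C] mult_ac)
  qed
  have dx: "pdx i (?Y ^ l * C) = ?Y ^ l * pdx i C" for i l
    by (simp add: pdx_mult[OF Y C] pdx_power_aux)
  have dn: "pdx i (of_nat k * H) = of_nat k * pdx i H" for i
    by (simp add: pdx_mult[OF n H] pdx_outside[where I = "{}" and J = "{}", OF of_nat_polynomial_field])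
  have dxdy: "pdx i (pdy j (monomial k H)) =
      pdx i (pdy j H) * (?Y ^ k * C) + pdy j H * (?Y ^ k * pdx i C) +
      (if j = m then of_nat k * (pdx i H * (?Y ^ (k - 1) * C) + H * (?Y ^ (k - 1) * pdx i C)) else 0)" for i j
  proof -
    note [simp] = pdx_mult[OF pdy_polynomial_field[OF H] YC] dx
    have "pdx i (of_nat k * H * (?Y ^ (k - 1) * C)) =
        of_nat k * (pdx i H * (?Y ^ (k - 1) * C) + H * (?Y ^ (k - 1) * pdx i C))"
      by (simp only: pdx_mult[OF polynomial_field.mult[OF n H] YC] dn dx) (simp add: algebra_simps)
    moreover have "pdx i (pdy j H * (?Y ^ k * C) + of_nat k * H * (?Y ^ (k - 1) * C)) =
        pdx i (pdy j H * (?Y ^ k * C)) + pdx i (of_nat k * H * (?Y ^ (k - 1) * C))"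
    proof (rule pdx_add)
      show "polynomial_field (insert m later) (insert m J) (pdy j H * (?Y ^ k * C))"
        by (intro polynomial_field.mult[OF polynomial_field_mono[OF pdy_polynomial_field[OF H]]
              polynomial_field_mono[OF YC]]) auto
      show "polynomial_field (insert m later) (insert m J) (of_nat k * H * (?Y ^ (k - 1) * C))"
        by (intro polynomial_field.mult[OF polynomial_field_mono[OF polynomial_field.mult[OF n H]]
              polynomial_field_mono[OF YC]]) auto
    qed
    ultimately show ?thesis
      unfolding dy by auto
  qed
  have heavy: "(\<lambda>(x::nat \<Rightarrow> real) (y::nat \<Rightarrow> real). heaviside (s i - s j)) * pdx i (pdy j (monomial k H)) =
      (\<lambda>x y. heaviside (s i - s j)) * pdx i (pdy j H) * (?Y ^ k * C) +
      (if j = m then of_nat k * (pdx i H * (?Y ^ (k - 1) * C)) else 0)" if ij: "i \<noteq> j" for i j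
  proof (cases "j = m")
    case True
    then have "pdx i C = 0" "pdy j H = 0" using ij m pdx_outside[OF C] pdy_outside[OF H] by auto
    moreover have "(\<lambda>x y. heaviside (s i - s j)) * pdx i H = pdx i H"
    proof (cases "i \<in> later")
      case True
      then have "heaviside (s i - s j) = 1" using earliest[OF True] \<open>j = m\<close> by (simp add: heaviside_def)
      then show ?thesis by (simp add: fun_eq_iff pointwise)
    qed (simp add: pdx_outside[OF H])
    then have "(\<lambda>x y. heaviside (s i - s j)) * (of_nat k * (pdx i H * Z)) = of_nat k * (pdx i H * Z)" for Z
      by (metis mult.assoc mult.left_commute)
    ultimately show ?thesis
      unfolding dxdy using True by simp
  next
    case False
    show ?thesis
    proof (cases "i = m \<and> j \<in> J")
      case True
      then have "heaviside (s i - s j) = 0" using earliest[of j] by (auto simp: heaviside_def)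
      then show ?thesis using False by (simp add: zero_fun_def[symmetric])
    next
      case F: False
      then have "pdx i C = 0 \<or> pdy j H = 0"
        using pdx_outside[OF C, of i] pdy_outside[OF H, of j] by auto
      then show ?thesis
        unfolding dxdy using False by (auto simp: algebra_simps)
    qed
  qed
  have "contraction N s (monomial k H) =
     (\<Sum>i\<in>{0..N}. \<Sum>j\<in>{1..N} - {i}. (\<lambda>x y. heaviside (s i - s j)) * pdx i (pdy j H) * (?Y ^ k * C) +
        (if j = m then of_nat k * (pdx i H * (?Y ^ (k - 1) * C)) else 0))"
    unfolding contraction_alt by (intro sum.cong refl heavy) auto
  also have "\<dots> = monomial k (contraction N s H) +
     (\<Sum>i\<in>{0..N}. \<Sum>j\<in>{1..N} - {i}. if j = m then of_nat k * (pdx i H * (?Y ^ (k - 1) * C)) else 0)"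
    unfolding contraction_alt by (simp add: sum.distrib sum_distrib_right mult.assoc)
  also have "(\<Sum>i\<in>{0..N}. \<Sum>j\<in>{1..N} - {i}. if j = m then of_nat k * (pdx i H * (?Y ^ (k - 1) * C)) else 0)
     = (\<Sum>i\<in>{0..N}. of_nat k * (pdx i H * (?Y ^ (k - 1) * C)))"
    using m pdx_outside[OF H] J by (intro sum.cong refl) (auto simp: sum.delta)
  also have "\<dots> = (\<Sum>i\<in>later. of_nat k * (pdx i H * (?Y ^ (k - 1) * C)))"
    using J pdx_outside[OF H] by (intro sum.mono_neutral_right) auto
  also have "\<dots> = of_nat k * monomial (k - 1) (diagonal_deriv later H)"
    by (simp only: diagonal_deriv_def sum_distrib_left sum_distrib_right mult.assoc)
  finally show ?thesis .
qed

lemma finite_J: "finite J"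
  using J finite_subset by blast

text \<open>At $y_m = 0$ only those terms survive in which exactly $k$ of the $n$ contractions use $y_m$. There
are $n!/(n-k)!$ ways to place them; after division by $n!$ the remaining contractions carry the
weight $1/(n-k)!$ that they have in the exponential series.\<close>

lemma contraction_funpow_monomial:
  assumes H: "polynomial_field later J H" and y: "y m = 0"
  shows "(contraction N s ^^ n) (monomial k H) x y =
    (if k \<le> n then fact n / fact (n - k) * (contraction N s ^^ (n - k)) ((diagonal_deriv later ^^ k) H) x y * C x y
     else 0)"
  using H
proof (induction n arbitrary: k H)
  case 0
  then show ?case using y by (cases k) (auto simp: pointwise)
next
  case (Suc n)
  note D = contraction_polynomial_field[OF Suc.prems] diagonal_deriv_polynomial_field[OF Suc.prems]
  have nat: "of_nat k = (\<lambda>(x::nat \<Rightarrow> real) (y::nat \<Rightarrow> real). real k)" by (simp add: of_nat_fun)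
  have "(contraction N s ^^ Suc n) (monomial k H) =
      (contraction N s ^^ n) (monomial k (contraction N s H) + of_nat k * monomial (k - 1) (diagonal_deriv later H))"
    by (simp add: funpow_Suc_right contraction_monomial[OF Suc.prems] del: funpow.simps)
  also have "\<dots> = (contraction N s ^^ n) (monomial k (contraction N s H)) +
      (contraction N s ^^ n) (of_nat k * monomial (k - 1) (diagonal_deriv later H))"
    by (rule contraction_funpow_add[OF monomial_polynomial_field[OF D(1)]
          polynomial_field.mult[OF of_nat_polynomial_field monomial_polynomial_field[OF D(2)]]])
  also have "(contraction N s ^^ n) (of_nat k * monomial (k - 1) (diagonal_deriv later H)) =
      (\<lambda>x y. real k) * (contraction N s ^^ n) (monomial (k - 1) (diagonal_deriv later H))"
    unfolding nat by (rule contraction_funpow_scale[OF monomial_polynomial_field[OF D(2)]])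
  finally have sum: "(contraction N s ^^ Suc n) (monomial k H) =
      (contraction N s ^^ n) (monomial k (contraction N s H)) +
      (\<lambda>x y. real k) * (contraction N s ^^ n) (monomial (k - 1) (diagonal_deriv later H))" .
  have step: "(contraction N s ^^ Suc n) (monomial k H) x y =
      (contraction N s ^^ n) (monomial k (contraction N s H)) x y +
      real k * (contraction N s ^^ n) (monomial (k - 1) (diagonal_deriv later H)) x y"
    unfolding sum by (simp only: pointwise)
  have comm: "(diagonal_deriv later ^^ k) (contraction N s H) = contraction N s ((diagonal_deriv later ^^ k) H)"
    using contraction_funpow_diagonal_deriv_commute[OF Suc.prems, where N = N and s = s and n = 1] finite_J by simp
  define V where "V l = (contraction N s ^^ l) ((diagonal_deriv later ^^ k) H) x y * C x y" for l
  have 1: "(contraction N s ^^ n) (monomial k (contraction N s H)) x y =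
      (if k \<le> n then fact n / fact (n - k) * V (Suc n - k) else 0)"
    unfolding Suc.IH[OF D(1)] comm V_def
    by (auto simp: Suc_diff_le funpow_Suc_right simp del: funpow.simps)
  have 2: "real k * (contraction N s ^^ n) (monomial (k - 1) (diagonal_deriv later H)) x y =
      (if 1 \<le> k \<and> k \<le> Suc n then real k * (fact n / fact (Suc n - k)) * V (Suc n - k) else 0)"
    unfolding Suc.IH[OF D(2)] V_def
    by (cases k) (auto simp: funpow_Suc_right simp del: funpow.simps)
  show ?case
    unfolding step 1 2
  proof (cases "k \<le> n")
    case True
    have "(fact (Suc n) :: real) / fact (Suc n - k) =
       fact n / fact (n - k) + real k * (fact n / fact (Suc n - k))"
    proof -
      obtain r where "n = k + r" using True le_Suc_ex by blast
      then have r: "Suc n - k = Suc r" "n - k = r" "real k = real n - real r" by auto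
      define X :: real where "X = fact n / ((1 + real r) * fact r)"
      have "1 + real r \<noteq> 0" by (metis of_nat_Suc of_nat_eq_0_iff nat.distinct(1))
      then have "fact n / fact r = (1 + real r) * X" by (simp add: X_def)
      moreover have "(fact (Suc n) :: real) / fact (Suc r) = (1 + real n) * X"
        "fact n / fact (Suc r) = X" by (simp_all add: X_def)
      ultimately show ?thesis unfolding r by (simp add: algebra_simps)
    qed
    then show "(if k \<le> n then fact n / fact (n - k) * V (Suc n - k) else 0) +
      (if 1 \<le> k \<and> k \<le> Suc n then real k * (fact n / fact (Suc n - k)) * V (Suc n - k) else 0) =
      (if k \<le> Suc n then fact (Suc n) / fact (Suc n - k) *
         (contraction N s ^^ (Suc n - k)) ((diagonal_deriv later ^^ k) H) x y * C x y else 0)"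
      using True by (cases k) (auto simp: V_def algebra_simps)
  next
    case False
    then show "(if k \<le> n then fact n / fact (n - k) * V (Suc n - k) else 0) +
      (if 1 \<le> k \<and> k \<le> Suc n then real k * (fact n / fact (Suc n - k)) * V (Suc n - k) else 0) =
      (if k \<le> Suc n then fact (Suc n) / fact (Suc n - k) *
         (contraction N s ^^ (Suc n - k)) ((diagonal_deriv later ^^ k) H) x y * C x y else 0)"
      by (cases "k = Suc n") (auto simp: V_def algebra_simps)
  qed
qed

end

section \<open>The generator and ordered times\<close>

definition generator :: "(real \<Rightarrow> real) \<Rightarrow> (real \<Rightarrow> real) \<Rightarrow> (real \<Rightarrow> real) \<Rightarrow> real \<Rightarrow> real" where
  "generator \<alpha> \<beta> g = (\<lambda>x. \<alpha> x * deriv g x + 1/2 * (\<beta> x)\<^sup>2 * deriv (deriv g) x)"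

lemma deriv_diagonal_sum:
  assumes "\<And>n. polynomial_field I J (G n)" "finite I"
  shows "deriv (\<lambda>z. \<Sum>n<K::nat. G n (\<lambda>_. z) y / c n) =
    (\<lambda>z. \<Sum>n<K. diagonal_deriv I (G n) (\<lambda>_. z) y / c n)"
  by (intro ext DERIV_imp_deriv DERIV_sum DERIV_cdivide DERIV_diagonal[OF assms])

lemma diagonal_deriv_vanish:
  assumes "\<And>x. G x y = 0"
  shows "(diagonal_deriv I ^^ k) G x y = 0"
  using assms
proof (induction k arbitrary: x)
  case (Suc k)
  then show ?case by (simp add: diagonal_deriv_def sum_fun2_apply pdx_def)
qed simp

text \<open>The integrand with only the vertices in \<open>J\<close> present. A set of vertices is used because vertices are
removed in the order of their times rather than of their labels.\<close>

definition truncated_integrand ::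
  "(real \<Rightarrow> real) \<Rightarrow> (real \<Rightarrow> real) \<Rightarrow> (real \<Rightarrow> real) \<Rightarrow> nat set \<Rightarrow> field_fun" where
  "truncated_integrand \<alpha> \<beta> f J =
     (\<lambda>x y. f (x 0) * (\<Prod>i\<in>J. y i * \<alpha> (x i) + 1/2 * (y i)\<^sup>2 * (\<beta> (x i))\<^sup>2))"

lemma truncated_integrand_insert:
  assumes "finite J" "m \<notin> J"
  shows "truncated_integrand \<alpha> \<beta> f (insert m J) =
    truncated_integrand \<alpha> \<beta> f J * (\<lambda>x y. y m) ^ 1 * (\<lambda>x y. \<alpha> (x m)) +
    truncated_integrand \<alpha> \<beta> f J * (\<lambda>x y. y m) ^ 2 * (\<lambda>x y. 1/2 * (\<beta> (x m))\<^sup>2)"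
  using assms
  by (intro ext) (simp add: truncated_integrand_def pointwise power2_eq_square algebra_simps)

lemma truncated_integrand_polynomial_field:
  assumes "C_infinity \<alpha>" "C_infinity \<beta>" "C_infinity f" "finite J"
  shows "polynomial_field (insert 0 J) J (truncated_integrand \<alpha> \<beta> f J)"
  using assms(4)
proof (induction J rule: finite_induct)
  case empty
  show ?case using assms by (auto simp: truncated_integrand_def intro: polynomial_field.coeff)
next
  case (insert m J)
  have "(\<lambda>(x::nat \<Rightarrow> real) (y::nat \<Rightarrow> real). 1/2 * (\<beta> (x m))\<^sup>2) =
      (\<lambda>x y. 1/2) * ((\<lambda>x y. \<beta> (x m)) * (\<lambda>x y. \<beta> (x m)))"
    by (simp add: fun_eq_iff pointwise power2_eq_square)
  then have "polynomial_field (insert 0 (insert m J)) (insert m J) (\<lambda>x y. 1/2 * (\<beta> (x m))\<^sup>2)"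
    using assms by (auto intro!: polynomial_field.intros)
  moreover have "polynomial_field (insert 0 (insert m J)) (insert m J) (truncated_integrand \<alpha> \<beta> f J)"
    by (rule polynomial_field_mono[OF insert.IH]) auto
  ultimately show ?case
    unfolding truncated_integrand_insert[OF insert(1,2)]
    using assms
    by (intro polynomial_field.add polynomial_field.mult power_polynomial_field polynomial_field.aux)
       (auto intro: polynomial_field.coeff)
qed

text \<open>Induction on the number of vertices, removing the one with the smallest time. The claim that the
contractions eventually vanish at $y = 0$ is part of the induction: it makes the exponential series
a finite sum, which can be differentiated along the diagonal term by term.\<close>

lemma exp_contraction_ordered:
  assumes smooth: "C_infinity \<alpha>" "C_infinity \<beta>" "C_infinity f"
    and "J \<subseteq> {1..N}" "inj_on s J" "\<And>j. j \<in> J \<Longrightarrow> s j < s 0"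
  shows "\<exists>K. (\<forall>n\<ge>K. \<forall>x. (contraction N s ^^ n) (truncated_integrand \<alpha> \<beta> f J) x (\<lambda>_. 0) = 0) \<and>
    (\<forall>z. (\<Sum>n<K. (contraction N s ^^ n) (truncated_integrand \<alpha> \<beta> f J) (\<lambda>_. z) (\<lambda>_. 0) / fact n) =
       (generator \<alpha> \<beta> ^^ card J) f z)"
  using assms(4-6)
proof (induction "card J" arbitrary: J)
  case 0
  then have "J = {}" using finite_subset by fastforce
  have f: "polynomial_field {0} {} (\<lambda>x y. f (x 0))" using smooth by (auto intro: polynomial_field.coeff)
  have "contraction N s (\<lambda>x y. f (x 0)) = 0"
    by (simp add: contraction_alt)
  then have "(contraction N s ^^ Suc n) (\<lambda>x y. f (x 0)) = 0" for n
    by (induction n) (simp_all add: contraction_alt)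
  then have "(contraction N s ^^ n) (\<lambda>x y. f (x 0)) = 0" if "n \<ge> 1" for n
    using that by (cases n) (simp_all del: funpow.simps)
  then show ?case
    unfolding \<open>J = {}\<close>
    by (intro exI[of _ 1]) (auto simp: truncated_integrand_def pointwise)
next
  case (Suc k)
  have fin: "finite J" using Suc.prems(1) finite_subset by blast
  have "J \<noteq> {}" using Suc.hyps(2) by auto
  then have "Min (s ` J) \<in> s ` J" using fin by auto
  then obtain m where m: "m \<in> J" "s m = Min (s ` J)" by auto
  define J' where "J' = J - {m}"
  have J: "J = insert m J'" "m \<notin> J'" "finite J'" using m fin by (auto simp: J'_def)
  have min: "s m < s j" if "j \<in> J'" for j
  proof -
    have "s m \<le> s j" using that m(2) fin by (auto simp: J'_def)
    moreover have "s m \<noteq> s j" using that m(1) Suc.prems(2) by (auto simp: J'_def inj_on_def)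
    ultimately show ?thesis by simp
  qed
  have loc: "earliest_vertex N m s J' C" if "polynomial_field {m} {} C" for C
    using Suc.prems m(1) min that by unfold_locales (auto simp: J'_def)
  let ?H = "truncated_integrand \<alpha> \<beta> f J'"
  let ?D = "contraction N s" and ?d = "diagonal_deriv (insert 0 J')"
  have H: "polynomial_field (insert 0 J') J' ?H"
    by (rule truncated_integrand_polynomial_field[OF smooth J(3)])
  have card: "k = card J'" using Suc.hyps(2) J by simp
  have "\<exists>K. (\<forall>n\<ge>K. \<forall>x. (?D ^^ n) ?H x (\<lambda>_. 0) = 0) \<and>
      (\<forall>z. (\<Sum>n<K. (?D ^^ n) ?H (\<lambda>_. z) (\<lambda>_. 0) / fact n) = (generator \<alpha> \<beta> ^^ card J') f z)"
    using Suc.prems J by (intro Suc.hyps(1)[OF card]) (auto simp: inj_on_def)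
  then obtain K where K: "\<And>n x. n \<ge> K \<Longrightarrow> (?D ^^ n) ?H x (\<lambda>_. 0) = 0"
    and val: "(\<lambda>z. \<Sum>n<K. (?D ^^ n) ?H (\<lambda>_. z) (\<lambda>_. 0) / fact n) = (generator \<alpha> \<beta> ^^ card J') f"
    by (auto simp: fun_eq_iff)
  define W where "W l n x = (?d ^^ l) ((?D ^^ n) ?H) x (\<lambda>_. 0) / fact n" for l n x
  have W0: "W l n x = 0" if "n \<ge> K" for l n x
    using diagonal_deriv_vanish[of "(?D ^^ n) ?H" "\<lambda>_. 0"] K[OF that] by (simp add: W_def)
  have DnH: "polynomial_field (insert 0 J') J' ((?d ^^ l) ((?D ^^ n) ?H))" for l n
    by (rule diagonal_deriv_funpow_in[OF contraction_funpow_in[OF H]])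
  have finI: "finite (insert 0 J')" using J(3) by simp
  have d1: "deriv ((generator \<alpha> \<beta> ^^ card J') f) = (\<lambda>z. \<Sum>n<K. W 1 n (\<lambda>_. z))"
    unfolding val[symmetric] W_def
    using deriv_diagonal_sum[OF DnH[of 0] finI, where c = fact] by simp
  have d2: "deriv (deriv ((generator \<alpha> \<beta> ^^ card J') f)) = (\<lambda>z. \<Sum>n<K. W 2 n (\<lambda>_. z))"
    unfolding d1 W_def
    using deriv_diagonal_sum[OF DnH[of 1] finI, where c = fact] by (simp add: numeral_2_eq_2)
  let ?C1 = "\<lambda>(x::nat \<Rightarrow> real) (y::nat \<Rightarrow> real). \<alpha> (x m)"
  let ?C2 = "\<lambda>(x::nat \<Rightarrow> real) (y::nat \<Rightarrow> real). 1/2 * (\<beta> (x m))\<^sup>2"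
  have C1: "polynomial_field {m} {} ?C1" using smooth by (auto intro: polynomial_field.coeff)
  have "?C2 = (\<lambda>x y. 1/2) * ((\<lambda>x y. \<beta> (x m)) * (\<lambda>x y. \<beta> (x m)))"
    by (simp add: fun_eq_iff pointwise power2_eq_square)
  then have C2: "polynomial_field {m} {} ?C2" using smooth by (auto intro!: polynomial_field.intros)
  interpret v1: earliest_vertex N m s J' ?C1 by (rule loc[OF C1])
  interpret v2: earliest_vertex N m s J' ?C2 by (rule loc[OF C2])
  have comm: "(?D ^^ n) ((?d ^^ l) ?H) = (?d ^^ l) ((?D ^^ n) ?H)" for n l
    by (rule contraction_funpow_diagonal_deriv_commute[OF H finI])
  have step: "(?D ^^ n) (truncated_integrand \<alpha> \<beta> f J) x (\<lambda>_. 0) / fact n =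
      (if 1 \<le> n then \<alpha> (x m) * W 1 (n - 1) x else 0) +
      (if 2 \<le> n then 1/2 * (\<beta> (x m))\<^sup>2 * W 2 (n - 2) x else 0)" for n x
  proof -
    have "(?D ^^ n) (truncated_integrand \<alpha> \<beta> f J) =
      (?D ^^ n) (v1.monomial 1 ?H) + (?D ^^ n) (v2.monomial 2 ?H)"
      unfolding J(1) truncated_integrand_insert[OF J(3,2)]
      by (rule contraction_funpow_add[OF v1.monomial_polynomial_field[OF H]
            v2.monomial_polynomial_field[OF H]])
    then have "(?D ^^ n) (truncated_integrand \<alpha> \<beta> f J) x (\<lambda>_. 0) =
      (?D ^^ n) (v1.monomial 1 ?H) x (\<lambda>_. 0) + (?D ^^ n) (v2.monomial 2 ?H) x (\<lambda>_. 0)"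
      by (simp only: pointwise)
    then show ?thesis
      unfolding v1.contraction_funpow_monomial[OF H refl] v2.contraction_funpow_monomial[OF H refl]
        comm W_def
      by (auto simp: add_divide_distrib mult_ac)
  qed
  have shift: "a 0 + (\<Sum>n<K. a (Suc n)) = (\<Sum>n<K. a n)" if "a K = 0" for a :: "nat \<Rightarrow> real"
    using that sum.lessThan_Suc_shift[of a K] by (simp only: sum.lessThan_Suc)
  \<comment> \<open>One vertex raises the degree in the auxiliary variables by at most two, so \<open>K + 2\<close> terms suffice.\<close>
  have shift1: "(\<Sum>n<Suc (Suc K). if 1 \<le> n then a (n - 1) else 0) = (\<Sum>n<K. a n)"
    and shift2: "(\<Sum>n<Suc (Suc K). if 2 \<le> n then a (n - 2) else 0) = (\<Sum>n<K. a n)"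
    if "a K = 0" for a :: "nat \<Rightarrow> real"
    using shift[of a, OF that] by (simp_all add: sum.lessThan_Suc_shift del: sum.lessThan_Suc)
  have "(\<Sum>n<Suc (Suc K). (?D ^^ n) (truncated_integrand \<alpha> \<beta> f J) (\<lambda>_. z) (\<lambda>_. 0) / fact n) =
      (\<Sum>n<K. \<alpha> z * W 1 n (\<lambda>_. z)) + (\<Sum>n<K. 1/2 * (\<beta> z)\<^sup>2 * W 2 n (\<lambda>_. z))" for z
    unfolding step sum.distrib by (intro arg_cong2[of _ _ _ _ "(+)"] shift1 shift2) (simp_all add: W0)
  also have "(\<Sum>n<K. \<alpha> z * W 1 n (\<lambda>_. z)) + (\<Sum>n<K. 1/2 * (\<beta> z)\<^sup>2 * W 2 n (\<lambda>_. z)) =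
      generator \<alpha> \<beta> ((generator \<alpha> \<beta> ^^ card J') f) z" for z
    unfolding generator_def[where g = "(generator \<alpha> \<beta> ^^ card J') f"] d2 unfolding d1 by (simp add: sum_distrib_left)
  finally have "(\<Sum>n<Suc (Suc K). (?D ^^ n) (truncated_integrand \<alpha> \<beta> f J) (\<lambda>_. z) (\<lambda>_. 0) / fact n) =
      (generator \<alpha> \<beta> ^^ card J) f z" for z
    using J by simp
  moreover have "(?D ^^ n) (truncated_integrand \<alpha> \<beta> f J) x (\<lambda>_. 0) = 0" if "n \<ge> Suc (Suc K)" for n x
  proof -
    have "(?D ^^ n) (truncated_integrand \<alpha> \<beta> f J) x (\<lambda>_. 0) / fact n = 0"
      unfolding step using that by (simp add: W0)
    then show ?thesis by simp
  qed
  ultimately show ?case by (intro exI[of _ "Suc (Suc K)"]) blast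
qed

lemma exp_contraction_past:
  assumes smooth: "C_infinity \<alpha>" "C_infinity \<beta>" "C_infinity f"
    and "inj_on s {1..N}" "\<And>j. j \<in> {1..N} \<Longrightarrow> s j < s 0"
  shows "exp_contraction N s (msr_integrand \<alpha> \<beta> f N) (\<lambda>_. z) (\<lambda>_. 0) = (generator \<alpha> \<beta> ^^ N) f z"
proof -
  have "msr_integrand \<alpha> \<beta> f N = truncated_integrand \<alpha> \<beta> f {1..N}"
    by (simp add: msr_integrand_def truncated_integrand_def)
  moreover obtain K where
    "\<And>n x. n \<ge> K \<Longrightarrow> (contraction N s ^^ n) (truncated_integrand \<alpha> \<beta> f {1..N}) x (\<lambda>_. 0) = 0"
    "\<And>z. (\<Sum>n<K. (contraction N s ^^ n) (truncated_integrand \<alpha> \<beta> f {1..N}) (\<lambda>_. z) (\<lambda>_. 0) / fact n) =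
       (generator \<alpha> \<beta> ^^ N) f z"
    using exp_contraction_ordered[OF smooth order_refl assms(4,5)] by auto
  ultimately show ?thesis
    unfolding exp_contraction_def by (subst suminf_finite[of "{..<K}"]) (auto simp: not_less)
qed

text \<open>Each contraction preserves divisibility by $y_m$, in the weak form of vanishing for $y_m = 0$: the
only derivative that could destroy it is $\partial_{y_m}$, and that comes with
$\Theta(s_i - s_m) = 0$.\<close>

lemma exp_contraction_future:
  assumes "m \<in> {1..N}" "\<And>i. i \<in> {0..N} \<Longrightarrow> s i \<le> s m"
  shows "exp_contraction N s (msr_integrand \<alpha> \<beta> f N) x (\<lambda>_. 0) = 0"
proof -
  have step: "contraction N s G x y = 0" if G: "\<And>x y. y m = 0 \<Longrightarrow> G x y = 0" and y: "y m = 0" for G x y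
    unfolding contraction_def
  proof (intro sum.neutral ballI)
    fix i j assume ij: "i \<in> {0..N}" "j \<in> {1..N} - {i}"
    show "heaviside (s i - s j) * pdx i (pdy j G) x y = 0"
    proof (cases "j = m")
      case True
      then show ?thesis using assms(2)[OF ij(1)] by (simp add: heaviside_def)
    next
      case False
      then have "pdy j G x y = 0" for x using G y by (simp add: pdy_def)
      then show ?thesis by (simp add: pdx_def)
    qed
  qed
  have "msr_integrand \<alpha> \<beta> f N x y = 0" if "y m = 0" for x y
    using assms(1) that by (auto simp: msr_integrand_def intro!: prod_zero bexI[of _ m])
  then have "(contraction N s ^^ n) (msr_integrand \<alpha> \<beta> f N) x y = 0" if "y m = 0" for n x y
    using that by (induction n arbitrary: x y) (auto intro: step)
  then show ?thesis by (simp add: exp_contraction_def)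
qed

section \<open>The time integral\<close>

text \<open>With all other coordinates fixed, $s_i = g(s)$ determines $s_i$, and points are null sets. It is
applied to $g(s) = s_j$ and to the constant $t$.\<close>

lemma AE_PiM_lborel_neq:
  fixes g :: "('i \<Rightarrow> real) \<Rightarrow> real"
  assumes "finite I" "i \<in> I"
    and "g \<in> borel_measurable (\<Pi>\<^sub>M i\<in>I. lborel)" and upd: "\<And>s z. g (s(i := z)) = g s"
  shows "AE s in (\<Pi>\<^sub>M i\<in>I. lborel). s i \<noteq> g s"
proof -
  interpret product_sigma_finite "\<lambda>_::'i. lborel :: real measure" by standard
  let ?M = "\<Pi>\<^sub>M i\<in>I. (lborel :: real measure)"
  let ?I = "I - {i}"
  have I: "insert i ?I = I" "finite ?I" "i \<notin> ?I" using assms by auto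
  have meas: "{s \<in> space ?M. s i = g s} \<in> sets ?M"
    using assms by measurable
  have "emeasure ?M {s \<in> space ?M. s i = g s} =
     (\<integral>\<^sup>+ s. indicator {s \<in> space ?M. s i = g s} s \<partial>?M)" using meas by simp
  also have "\<dots> = (\<integral>\<^sup>+ s. (\<integral>\<^sup>+ z. indicator {s \<in> space ?M. s i = g s} (s(i := z)) \<partial>lborel)
       \<partial>(\<Pi>\<^sub>M i\<in>?I. lborel))"
    using product_nn_integral_insert[OF I(2,3), of "indicator {s \<in> space ?M. s i = g s}"] meas
    unfolding I(1) by simp
  also have "\<dots> = (\<integral>\<^sup>+ s. 0 \<partial>(\<Pi>\<^sub>M i\<in>?I. (lborel :: real measure)))"
  proof (rule nn_integral_cong)
    fix s
    have "(\<integral>\<^sup>+ z. indicator {s \<in> space ?M. s i = g s} (s(i := z)) \<partial>lborel) \<le>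
       (\<integral>\<^sup>+ z. indicator {g s} z \<partial>lborel)"
      by (intro nn_integral_mono) (auto simp: upd split: split_indicator)
    also have "\<dots> = 0" by simp
    finally show "(\<integral>\<^sup>+ z. indicator {s \<in> space ?M. s i = g s} (s(i := z)) \<partial>lborel) = 0" by simp
  qed
  finally show ?thesis using meas by (intro AE_I[of _ _ "{s \<in> space ?M. s i = g s}"]) auto
qed

lemma exp_contraction_cong:
  assumes "\<And>i j. i \<in> {0..N} \<Longrightarrow> j \<in> {1..N} \<Longrightarrow> heaviside (s i - s j) = heaviside (s' i - s' j)"
  shows "exp_contraction N s = exp_contraction N s'"
proof -
  have "contraction N s = contraction N s'"
    unfolding contraction_def using assms by (intro ext sum.cong refl) auto
  then show ?thesis by (intro ext) (simp add: exp_contraction_def)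
qed

text \<open>The value depends only on the order relation between the times, of which there are finitely many.\<close>

lemma exp_contraction_measurable:
  "(\<lambda>s. exp_contraction N (s(0 := t)) G x y) \<in> borel_measurable (\<Pi>\<^sub>M i\<in>{1..N}. lborel)"
proof -
  let ?M = "\<Pi>\<^sub>M i\<in>{1..N}. (lborel :: real measure)"
  \<comment> \<open>\<open>Q s\<close> is the order relation between the times, and \<open>V r\<close> the common value for all times with the
    relation \<open>r\<close>.\<close>
  define Q where "Q s = {(i, j) \<in> {0..N} \<times> {1..N}. s j < s i}" for s :: "nat \<Rightarrow> real"
  define P where "P = Pow ({0..N} \<times> {1..N})"
  define R where "R s = Q (s(0 := t))" for s
  define V where "V r = exp_contraction N (SOME s. Q s = r) G x y" for r
  have "R \<in> ?M \<rightarrow>\<^sub>M count_space P"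
  proof (rule measurable_count_space_eq2[THEN iffD2])
    show "finite P" by (simp add: P_def)
    show "R \<in> space ?M \<rightarrow> P \<and> (\<forall>r\<in>P. R -` {r} \<inter> space ?M \<in> sets ?M)"
    proof (intro conjI ballI)
      fix r assume "r \<in> P"
      then have r: "r \<subseteq> {0..N} \<times> {1..N}" by (simp add: P_def)
      have "R s = r \<longleftrightarrow>
          (\<forall>i\<in>{0..N}. \<forall>j\<in>{1..N}. (s(0 := t)) j < (s(0 := t)) i \<longleftrightarrow> (i, j) \<in> r)" for s
        unfolding R_def Q_def set_eq_iff split_paired_All mem_Collect_eq prod.case mem_Sigma_iff
        using r by blast
      then have eq: "R -` {r} \<inter> space ?M =
        {s \<in> space ?M. \<forall>i\<in>{0..N}. \<forall>j\<in>{1..N}. (s(0 := t)) j < (s(0 := t)) i \<longleftrightarrow> (i, j) \<in> r}"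
        by blast
      have c: "(\<lambda>s. (s(0 := t)) i) \<in> borel_measurable ?M" if "i \<in> {0..N}" for i
        using that by (cases "i = 0") auto
      have "{s \<in> space ?M. (s(0 := t)) j < (s(0 := t)) i \<longleftrightarrow> (i, j) \<in> r} \<in> sets ?M"
        if "i \<in> {0..N}" "j \<in> {1..N}" for i j
      proof -
        have less: "{s \<in> space ?M. (s(0 := t)) j < (s(0 := t)) i} \<in> sets ?M"
          using that by (intro borel_measurable_less c) auto
        show ?thesis
        proof (cases "(i, j) \<in> r")
          case True
          then show ?thesis using less by (simp only: simp_thms)
        next
          case False
          then show ?thesis using sets.sets_Collect_neg[OF less] by (simp only: simp_thms)
        qed
      qed
      then show "R -` {r} \<inter> space ?M \<in> sets ?M"
        unfolding eq by (intro sets.sets_Collect_finite_All) auto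
    qed (auto simp: R_def Q_def P_def)
  qed
  then have "(\<lambda>s. V (R s)) \<in> borel_measurable ?M"
    by (rule measurable_compose) simp
  moreover have "V (R s) = exp_contraction N (s(0 := t)) G x y" for s
  proof -
    have Q: "Q (SOME s'. Q s' = Q (s(0 := t))) = Q (s(0 := t))"
      by (rule someI[of "\<lambda>s'. Q s' = Q (s(0 := t))", OF refl])
    have "heaviside (s1 i - s1 j) = heaviside (s2 i - s2 j)"
      if "Q s1 = Q s2" "i \<in> {0..N}" "j \<in> {1..N}" for s1 s2 i j
    proof -
      have "(i, j) \<in> Q s1 \<longleftrightarrow> (i, j) \<in> Q s2" using that(1) by simp
      then show ?thesis using that(2,3) by (simp add: Q_def heaviside_def)
    qed
    from this[OF Q] have "exp_contraction N (SOME s'. Q s' = Q (s(0 := t))) = exp_contraction N (s(0 := t))"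
      by (rule exp_contraction_cong)
    then show ?thesis unfolding V_def R_def by (rule fun_cong[THEN fun_cong, THEN fun_cong])
  qed
  ultimately show ?thesis by simp
qed

lemma msr_term_eq_generator:
  assumes smooth: "C_infinity \<alpha>" "C_infinity \<beta>" "C_infinity f" and t: "0 \<le> t" "t \<le> T"
  shows "msr_term \<alpha> \<beta> f u\<^sub>0 T N t = t ^ N / fact N * (generator \<alpha> \<beta> ^^ N) f u\<^sub>0"
proof -
  interpret product_sigma_finite "\<lambda>_::nat. lborel :: real measure" by standard
  let ?M = "\<Pi>\<^sub>M i\<in>{1..N}. (lborel :: real measure)"
  let ?e = "\<lambda>s. exp_contraction N (s(0 := t)) (msr_integrand \<alpha> \<beta> f N) (\<lambda>_. u\<^sub>0) (\<lambda>_. 0)"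
  let ?box = "\<lambda>r. \<Pi>\<^sub>E i\<in>{1..N}. {0..r::real}"
  let ?G = "(generator \<alpha> \<beta> ^^ N) f u\<^sub>0"
  have box: "?box r \<in> sets ?M" for r by (intro sets_PiM_I_finite) auto
  have "AE s in ?M. s i \<noteq> s j" if "i \<in> {1..N}" "j \<in> {1..N}" "i \<noteq> j" for i j
    using that by (intro AE_PiM_lborel_neq) auto
  then have "AE s in ?M. \<forall>i\<in>{1..N}. \<forall>j\<in>{1..N}. i \<noteq> j \<longrightarrow> s i \<noteq> s j"
    by (intro AE_finite_allI) auto
  moreover have "AE s in ?M. \<forall>i\<in>{1..N}. s i \<noteq> t"
    by (intro AE_finite_allI AE_PiM_lborel_neq) auto
  ultimately have ae: "AE s in ?M. indicator (?box T) s *\<^sub>R ?e s = indicator (?box t) s *\<^sub>R ?G"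
  proof eventually_elim
    case (elim s)
    show ?case
    proof (cases "s \<in> ?box T")
      case False
      moreover have "?box t \<subseteq> ?box T" using t(2) by (intro PiE_mono) auto
      ultimately have "s \<notin> ?box t" by blast
      then show ?thesis using False by simp
    next
      case True
      show ?thesis
      proof (cases "\<forall>j\<in>{1..N}. s j < t")
        case past: True
        then have "s \<in> ?box t" using True by (auto simp: PiE_iff less_imp_le)
        moreover have "?e s = ?G"
          using elim past by (intro exp_contraction_past[OF smooth]) (auto simp: inj_on_def)
        ultimately show ?thesis using True by simp
      next
        case False
        then obtain j where j: "j \<in> {1..N}" "t < s j" using elim(2) by force
        \<comment> \<open>Vertex \<open>j\<close> lies after \<open>t\<close>, so the largest of all times is attained at a vertex other than the root.\<close>
        have "Max (s ` {1..N}) \<in> s ` {1..N}" using j by (intro Max_in) auto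
        then obtain m where m: "m \<in> {1..N}" "s m = Max (s ` {1..N})" by auto
        have le: "s i \<le> s m" if "i \<in> {1..N}" for i using that m(2) by simp
        have "?e s = 0"
        proof (rule exp_contraction_future[OF m(1)])
          fix i assume "i \<in> {0..N}"
          then show "(s(0 := t)) i \<le> (s(0 := t)) m"
            using le[of i] le[of j] j m(1) by (cases "i = 0") auto
        qed
        moreover have "s \<notin> ?box t" using j PiE_mem[of s "{1..N}" "\<lambda>_. {0..t}" j] by auto
        ultimately show ?thesis by simp
      qed
    qed
  qed
  have "(LINT s : ?box T | ?M. ?e s) = (LINT s | ?M. indicator (?box t) s *\<^sub>R ?G)"
    unfolding set_lebesgue_integral_def
  proof (rule integral_cong_AE[OF _ _ ae])
    show "(\<lambda>s. indicator (?box T) s *\<^sub>R ?e s) \<in> borel_measurable ?M"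
      using box[of T] exp_contraction_measurable by measurable
    show "(\<lambda>s. indicator (?box t) s *\<^sub>R ?G) \<in> borel_measurable ?M"
      using box[of t] by measurable
  qed
  also have "\<dots> = measure ?M (?box t) * ?G"
    using sets.sets_into_space[OF box[of t]] by (simp add: Int_absorb1)
  also have "measure ?M (?box t) = t ^ N"
  proof -
    have "emeasure ?M (?box t) = ennreal (t ^ N)"
      using t by (subst emeasure_PiM) (auto simp: ennreal_power)
    then show ?thesis using t by (simp add: measure_def)
  qed
  finally have eq: "(LINT s : ?box T | ?M. ?e s) = t ^ N * ?G" .
  show ?thesis unfolding msr_term_def eq by simp
qed

section \<open>Grafting leaves\<close>

lemma etree_edge_unique:
  assumes "is_etree \<tau>" "(v, w) \<in> edges \<tau>" "(v, w') \<in> edges \<tau>"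
  shows "w = w'"
proof -
  have "v \<in> verts \<tau> - {tree_root \<tau>}" using assms by (auto simp: is_etree_def)
  then show ?thesis using assms unfolding is_etree_def by blast
qed

lemma finite_verts: "is_etree \<tau> \<Longrightarrow> finite (verts \<tau>)"
  by (simp add: is_etree_def)

lemma etree_parent:
  assumes "is_etree \<tau>" "v \<in> verts \<tau>" "v \<noteq> tree_root \<tau>"
  obtains w where "(v, w) \<in> edges \<tau>"
proof -
  have "\<forall>v\<in>verts \<tau> - {tree_root \<tau>}. \<exists>!w. (v, w) \<in> edges \<tau>" using assms(1) by (simp add: is_etree_def)
  then show ?thesis using assms(2,3) that by blast
qed

lemma etree_dom_colour: "is_etree \<tau> \<Longrightarrow> dom (colour \<tau>) = verts \<tau> - {tree_root \<tau>}"
  by (simp add: is_etree_def)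

lemma pairs_subset_verts: "is_etree \<tau> \<Longrightarrow> q \<in> pairs \<tau> \<Longrightarrow> q \<subseteq> verts \<tau>"
  using etree_pairs_subset coloured_subset by blast

lemma is_etree_iso_remove_verts:
  assumes "is_etree \<rho>" "etree_iso \<psi> \<rho> (remove_verts U \<tau>)"
  shows "is_etree (remove_verts U \<tau>)"
  by (rule is_etree_iso[OF assms]) (auto simp: remove_verts_def)

lemma partition_on_disjoint_union:
  assumes "partition_on A P" "partition_on B Q" "A \<inter> B = {}"
  shows "partition_on (A \<union> B) (P \<union> Q)"
  using assms by (auto simp: partition_on_def intro: disjoint_union)

lemma image_image_cong:
  assumes "\<And>q. q \<in> Q \<Longrightarrow> q \<subseteq> A" "\<And>v. v \<in> A \<Longrightarrow> g v = h v"
  shows "(`) g ` Q = (`) h ` Q"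
proof (rule image_cong[OF refl])
  fix q assume "q \<in> Q"
  then show "g ` q = h ` q" using assms by (intro image_cong refl) blast
qed

lemma edge_of_iso: "etree_iso \<phi> \<rho> \<tau> \<Longrightarrow> (v, w) \<in> edges \<rho> \<Longrightarrow> (\<phi> v, \<phi> w) \<in> edges \<tau>"
  unfolding etree_iso_def by (metis map_prod_imageI)

text \<open>As for automorphisms, extensionality ensures that each isomorphism is counted once.\<close>

definition etree_isos :: "etree \<Rightarrow> etree \<Rightarrow> (nat \<Rightarrow> nat) set" where
  "etree_isos \<rho> \<tau> = {\<phi> \<in> extensional (verts \<rho>). etree_iso \<phi> \<rho> \<tau>}"

lemma finite_etree_isos:
  assumes "is_etree \<rho>" "is_etree \<tau>"
  shows "finite (etree_isos \<rho> \<tau>)"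
proof -
  have "etree_isos \<rho> \<tau> \<subseteq> verts \<rho> \<rightarrow>\<^sub>E verts \<tau>"
    by (auto simp: etree_isos_def etree_iso_def PiE_def dest: bij_betw_apply)
  then show ?thesis
    using assms by (auto simp: is_etree_def intro: finite_subset finite_PiE)
qed

lemma restrict_in_etree_isos:
  assumes "is_etree \<rho>" "etree_iso \<phi> \<rho> \<tau>"
  shows "restrict \<phi> (verts \<rho>) \<in> etree_isos \<rho> \<tau>"
  using etree_iso_cong[OF assms] by (auto simp: etree_isos_def)

lemma etree_isos_empty_iff:
  assumes "is_etree \<rho>" "is_etree \<tau>"
  shows "etree_isos \<rho> \<tau> = {} \<longleftrightarrow> \<not> etree_equiv \<rho> \<tau>"
proof -
  have "etree_isos \<rho> \<tau> \<noteq> {}" if "etree_iso \<phi> \<rho> \<tau>" for \<phi>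
    using restrict_in_etree_isos[OF assms(1) that] by blast
  moreover have "etree_iso \<phi> \<rho> \<tau>" if "\<phi> \<in> etree_isos \<rho> \<tau>" for \<phi>
    using that by (simp add: etree_isos_def)
  ultimately show ?thesis using assms unfolding etree_equiv_def by blast
qed

text \<open>Composition with one fixed isomorphism identifies the isomorphisms with the automorphisms.\<close>

lemma card_etree_isos:
  assumes "etree_equiv \<rho> \<tau>"
  shows "card (etree_isos \<rho> \<tau>) = card (etree_auts \<rho>)"
proof -
  obtain \<theta> where \<theta>: "etree_iso \<theta> \<rho> \<tau>" and et: "is_etree \<rho>" "is_etree \<tau>"
    using assms by (auto simp: etree_equiv_def)
  let ?\<eta> = "inv_into (verts \<rho>) \<theta>"
  have bij: "bij_betw \<theta> (verts \<rho>) (verts \<tau>)" using \<theta> by (simp add: etree_iso_def)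
  have "bij_betw (\<lambda>g. restrict (\<theta> \<circ> g) (verts \<rho>)) (etree_auts \<rho>) (etree_isos \<rho> \<tau>)"
  proof (rule bij_betw_byWitness[where f' = "\<lambda>\<phi>. restrict (?\<eta> \<circ> \<phi>) (verts \<rho>)"])
    show "\<forall>g\<in>etree_auts \<rho>. restrict (?\<eta> \<circ> restrict (\<theta> \<circ> g) (verts \<rho>)) (verts \<rho>) = g"
    proof
      fix g assume g: "g \<in> etree_auts \<rho>"
      then have "g v \<in> verts \<rho>" if "v \<in> verts \<rho>" for v
        using that by (auto simp: etree_auts_def etree_iso_def dest: bij_betw_apply)
      then show "restrict (?\<eta> \<circ> restrict (\<theta> \<circ> g) (verts \<rho>)) (verts \<rho>) = g"
        using g bij_betw_inv_into_left[OF bij]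
        by (intro extensionalityI[of _ "verts \<rho>"]) (auto simp: etree_auts_def)
    qed
    show "\<forall>\<phi>\<in>etree_isos \<rho> \<tau>. restrict (\<theta> \<circ> restrict (?\<eta> \<circ> \<phi>) (verts \<rho>)) (verts \<rho>) = \<phi>"
    proof
      fix \<phi> assume \<phi>: "\<phi> \<in> etree_isos \<rho> \<tau>"
      then have "\<phi> v \<in> verts \<tau>" if "v \<in> verts \<rho>" for v
        using that by (auto simp: etree_isos_def etree_iso_def dest: bij_betw_apply)
      then show "restrict (\<theta> \<circ> restrict (?\<eta> \<circ> \<phi>) (verts \<rho>)) (verts \<rho>) = \<phi>"
        using \<phi> bij_betw_inv_into_right[OF bij]
        by (intro extensionalityI[of _ "verts \<rho>"]) (auto simp: etree_isos_def)
    qed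
    show "(\<lambda>g. restrict (\<theta> \<circ> g) (verts \<rho>)) ` etree_auts \<rho> \<subseteq> etree_isos \<rho> \<tau>"
      using etree_iso_comp[OF _ \<theta>] restrict_in_etree_isos[OF et(1)] by (auto simp: etree_auts_def)
    show "(\<lambda>\<phi>. restrict (?\<eta> \<circ> \<phi>) (verts \<rho>)) ` etree_isos \<rho> \<tau> \<subseteq> etree_auts \<rho>"
      using etree_iso_comp[OF _ etree_iso_inv[OF et(1) \<theta>]] restrict_in_etree_isos[OF et(1), of _ \<rho>]
      by (auto simp: etree_isos_def etree_auts_def)
  qed
  then show ?thesis by (simp add: bij_betw_same_card)
qed

text \<open>The new leaves \<open>S\<close> are attached below the vertices given by \<open>p\<close>, all with colour \<open>c\<close>, and \<open>P\<close> is
the decoration of the new leaves. Two cases are of interest: one $\alpha$-leaf with \<open>P = {}\<close>, and two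
$\beta$-leaves that form a pair.\<close>

definition graft :: "nat set \<Rightarrow> (nat \<Rightarrow> nat) \<Rightarrow> colour \<Rightarrow> nat set set \<Rightarrow> etree \<Rightarrow> etree" where
  "graft S p c P \<rho> =
     \<lparr>verts = verts \<rho> \<union> S, tree_root = tree_root \<rho>, edges = edges \<rho> \<union> (\<lambda>u. (u, p u)) ` S,
      colour = (\<lambda>u. if u \<in> S then Some c else colour \<rho> u), pairs = pairs \<rho> \<union> P\<rparr>"

lemma graft_simps [simp]:
  "verts (graft S p c P \<rho>) = verts \<rho> \<union> S"
  "tree_root (graft S p c P \<rho>) = tree_root \<rho>"
  "edges (graft S p c P \<rho>) = edges \<rho> \<union> (\<lambda>u. (u, p u)) ` S"
  "colour (graft S p c P \<rho>) = (\<lambda>u. if u \<in> S then Some c else colour \<rho> u)"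
  "pairs (graft S p c P \<rho>) = pairs \<rho> \<union> P"
  by (simp_all add: graft_def)

text \<open>The ways to find a copy of the bundle \<open>S\<close> among the leaves of \<open>\<tau>\<close>. The last condition says that the
decoration of these leaves is the prescribed one and that no pair is torn apart by removing them.\<close>

definition leaf_bundles :: "nat set \<Rightarrow> colour \<Rightarrow> nat set set \<Rightarrow> etree \<Rightarrow> (nat \<Rightarrow> nat) set" where
  "leaf_bundles S c P \<tau> =
     {\<kappa> \<in> extensional S. inj_on \<kappa> S \<and> \<kappa> ` S \<subseteq> coloured \<tau> c \<and> (\<forall>u\<in>S. children \<tau> (\<kappa> u) = {}) \<and>
        {q \<in> pairs \<tau>. q \<inter> \<kappa> ` S \<noteq> {}} = (`) \<kappa> ` P}"

locale grafting =
  fixes \<rho> :: etree and S :: "nat set" and c :: colour and P :: "nat set set"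
  assumes etree: "is_etree \<rho>" and S: "finite S" "S \<inter> verts \<rho> = {}"
    and P: "partition_on (if c = Beta then S else {}) P" "\<And>q. q \<in> P \<Longrightarrow> card q = 2"
begin

lemma P_subset: "q \<in> P \<Longrightarrow> q \<subseteq> S" "q \<in> P \<Longrightarrow> q \<noteq> {}"
  using partition_onD1[OF P(1)] partition_onD3[OF P(1)] by (auto split: if_splits)

lemma coloured_graft:
  "coloured (graft S p c P \<rho>) d = coloured \<rho> d \<union> (if d = c then S else {})"
  using S(2) by (auto simp: coloured_def)

lemma children_graft:
  assumes "v \<in> verts \<rho>"
  shows "children (graft S p c P \<rho>) v = children \<rho> v \<union> {u \<in> S. p u = v}"
  using assms by (auto simp: children_def)

lemma children_graft_leaf:
  assumes "p \<in> S \<rightarrow> verts \<rho>" "u \<in> S"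
  shows "children (graft S p c P \<rho>) u = {}"
  using assms etree S(2) by (auto simp: children_def is_etree_def)

lemma is_etree_graft:
  assumes p: "p \<in> S \<rightarrow> verts \<rho>"
  shows "is_etree (graft S p c P \<rho>)"
proof -
  let ?\<gamma> = "graft S p c P \<rho>"
  have e: "edges \<rho> \<subseteq> verts \<rho> \<times> verts \<rho>" and r: "tree_root \<rho> \<in> verts \<rho>"
    and source: "\<And>w. (tree_root \<rho>, w) \<notin> edges \<rho>"
    and parent: "\<And>v. v \<in> verts \<rho> - {tree_root \<rho>} \<Longrightarrow> \<exists>!w. (v, w) \<in> edges \<rho>"
    and conn: "\<And>v. v \<in> verts \<rho> \<Longrightarrow> (v, tree_root \<rho>) \<in> (edges \<rho>)\<^sup>*"
    and part: "partition_on (coloured \<rho> Beta) (pairs \<rho>)"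
    and two: "\<And>q. q \<in> pairs \<rho> \<Longrightarrow> card q = 2"
    using etree by (simp_all add: is_etree_def)
  have 1: "finite (verts ?\<gamma>)" using finite_verts[OF etree] S by simp
  have 2: "tree_root ?\<gamma> \<in> verts ?\<gamma>" "edges ?\<gamma> \<subseteq> verts ?\<gamma> \<times> verts ?\<gamma>"
    using e r p by auto
  have 3: "(tree_root ?\<gamma>, w) \<notin> edges ?\<gamma>" for w
    using source r S(2) by auto
  have 4: "\<exists>!w. (v, w) \<in> edges ?\<gamma>" if "v \<in> verts ?\<gamma> - {tree_root ?\<gamma>}" for v
  proof (cases "v \<in> S")
    case True
    then have "(v, w) \<in> edges ?\<gamma> \<longleftrightarrow> w = p v" for w using e S(2) by auto
    then show ?thesis by simp
  next
    case False
    then have "(v, w) \<in> edges ?\<gamma> \<longleftrightarrow> (v, w) \<in> edges \<rho>" for w by auto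
    moreover have "\<exists>!w. (v, w) \<in> edges \<rho>" using parent[of v] that False by simp
    ultimately show ?thesis by simp
  qed
  have star: "(v, tree_root \<rho>) \<in> (edges ?\<gamma>)\<^sup>*" if "v \<in> verts \<rho>" for v
  proof -
    have "(edges \<rho>)\<^sup>* \<subseteq> (edges ?\<gamma>)\<^sup>*" by (rule rtrancl_mono) simp
    then show ?thesis using conn[OF that] by blast
  qed
  have 5: "(v, tree_root ?\<gamma>) \<in> (edges ?\<gamma>)\<^sup>*" if "v \<in> verts ?\<gamma>" for v
  proof (cases "v \<in> verts \<rho>")
    case False
    then have "v \<in> S" using that by simp
    then have "(v, p v) \<in> edges ?\<gamma>" "p v \<in> verts \<rho>" using p by auto
    then have "(v, tree_root \<rho>) \<in> (edges ?\<gamma>)\<^sup>*"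
      using star[of "p v"] by (blast intro: converse_rtrancl_into_rtrancl)
    then show ?thesis by (simp only: graft_simps(2))
  next
    case True
    then show ?thesis using star[OF True] by (simp only: graft_simps(2))
  qed
  have 6: "dom (colour ?\<gamma>) = verts ?\<gamma> - {tree_root ?\<gamma>}"
  proof -
    have "dom (colour ?\<gamma>) = dom (colour \<rho>) \<union> S" by (auto split: if_splits)
    then show ?thesis using etree_dom_colour[OF etree] r S(2) by auto
  qed
  have 7: "partition_on (coloured ?\<gamma> Beta) (pairs ?\<gamma>)"
  proof -
    have "partition_on (coloured \<rho> Beta \<union> (if c = Beta then S else {})) (pairs \<rho> \<union> P)"
      using S(2) coloured_subset[of \<rho> Beta]
      by (intro partition_on_disjoint_union P(1) part) auto
    then show ?thesis by (simp add: coloured_graft eq_commute)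
  qed
  have 8: "card q = 2" if "q \<in> pairs ?\<gamma>" for q
    using that two P(2) by auto
  show ?thesis
    unfolding is_etree_def by (intro conjI allI ballI 1 2 3 4 5 6 7 8)
qed

lemma remove_verts_graft: "remove_verts S (graft S p c P \<rho>) = \<rho>"
proof -
  have "verts \<rho> \<union> S - S = verts \<rho>" using S(2) by auto
  moreover have "(edges \<rho> \<union> (\<lambda>u. (u, p u)) ` S) \<inter> verts \<rho> \<times> verts \<rho> = edges \<rho>"
  proof -
    have "edges \<rho> \<subseteq> verts \<rho> \<times> verts \<rho>" using etree by (simp add: is_etree_def)
    then show ?thesis using S(2) by auto
  qed
  moreover have "(\<lambda>u. if u \<in> S then Some c else colour \<rho> u) |` verts \<rho> = colour \<rho>"
  proof
    fix u
    show "((\<lambda>u. if u \<in> S then Some c else colour \<rho> u) |` verts \<rho>) u = colour \<rho> u"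
    proof (cases "u \<in> verts \<rho>")
      case True
      then have "u \<notin> S" using S(2) by blast
      then show ?thesis using True by simp
    next
      case False
      then have "u \<notin> dom (colour \<rho>)" using etree_dom_colour[OF etree] by blast
      then show ?thesis using False by (simp add: domIff)
    qed
  qed
  moreover have "{q \<in> pairs \<rho> \<union> P. q \<inter> S = {}} = pairs \<rho>"
  proof -
    have "q \<inter> S = {}" if "q \<in> pairs \<rho>" for q
      using pairs_subset_verts[OF etree that] S(2) by blast
    moreover have "q \<inter> S \<noteq> {}" if "q \<in> P" for q
      using P_subset[OF that] by (simp add: Int_absorb2)
    ultimately show ?thesis by (auto simp only: Un_iff mem_Collect_eq)
  qed
  ultimately show ?thesis by (simp add: remove_verts_def)
qed

lemma leaf_bundle_of_iso:
  assumes p: "p \<in> S \<rightarrow> verts \<rho>" and \<phi>: "etree_iso \<phi> (graft S p c P \<rho>) \<tau>"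
  shows "restrict \<phi> S \<in> leaf_bundles S c P \<tau>"
proof -
  let ?\<gamma> = "graft S p c P \<rho>"
  have \<gamma>: "is_etree ?\<gamma>" by (rule is_etree_graft[OF p])
  have inj: "inj_on \<phi> (verts \<rho> \<union> S)" using iso_inj_on[OF \<phi>] by simp
  have "\<phi> ` S \<subseteq> coloured \<tau> c"
    unfolding iso_coloured[OF \<phi>] coloured_graft by auto
  moreover have "children \<tau> (\<phi> u) = {}" if "u \<in> S" for u
    using iso_children[OF \<gamma> \<phi>, of u] children_graft_leaf[OF p that] that by simp
  moreover have "{q \<in> pairs \<tau>. q \<inter> \<phi> ` S \<noteq> {}} = (`) \<phi> ` P"
  proof -
    have pairs: "pairs \<tau> = (`) \<phi> ` (pairs \<rho> \<union> P)" using \<phi> by (simp add: etree_iso_def)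
    have "\<phi> ` r \<inter> \<phi> ` S = {}" if "r \<in> pairs \<rho>" for r
    proof -
      have r: "r \<subseteq> verts \<rho>" using pairs_subset_verts[OF etree that] .
      then have "\<phi> ` r \<inter> \<phi> ` S = \<phi> ` (r \<inter> S)" by (intro inj_on_image_Int[OF inj, symmetric]) auto
      then show ?thesis using r S(2) by blast
    qed
    moreover have "\<phi> ` r \<inter> \<phi> ` S \<noteq> {}" if "r \<in> P" for r
      using P_subset[OF that] by blast
    ultimately show ?thesis unfolding pairs by blast
  qed
  moreover have "(`) (restrict \<phi> S) ` P = (`) \<phi> ` P"
    using P_subset by (intro image_cong) auto
  moreover have "inj_on \<phi> S" using inj by (rule inj_on_subset) auto
  ultimately show ?thesis
    by (simp add: leaf_bundles_def inj_on_restrict_eq)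
qed

text \<open>An isomorphism from a graft onto \<open>\<tau>\<close> splits into its restrictions to the new leaves and to the old
vertices. Conversely these two restrictions determine where the leaves were grafted: each leaf hangs
below the preimage of the parent of its image.\<close>

lemma bij_betw_graft_isos:
  assumes \<tau>: "is_etree \<tau>"
  shows "bij_betw (\<lambda>(p, \<phi>). (restrict \<phi> S, restrict \<phi> (verts \<rho>)))
    (SIGMA p:S \<rightarrow>\<^sub>E verts \<rho>. etree_isos (graft S p c P \<rho>) \<tau>)
    (SIGMA \<kappa>:leaf_bundles S c P \<tau>. etree_isos \<rho> (remove_verts (\<kappa> ` S) \<tau>))"
    (is "bij_betw ?F ?A ?B")
proof (rule bij_betw_imageI)
  show "inj_on ?F ?A"
  proof (rule inj_onI, clarify)
    fix p \<phi> p' \<phi>' assume p: "p \<in> S \<rightarrow>\<^sub>E verts \<rho>" and p': "p' \<in> S \<rightarrow>\<^sub>E verts \<rho>"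
      and \<phi>: "\<phi> \<in> etree_isos (graft S p c P \<rho>) \<tau>" and \<phi>': "\<phi>' \<in> etree_isos (graft S p' c P \<rho>) \<tau>"
      and eq: "restrict \<phi> S = restrict \<phi>' S" "restrict \<phi> (verts \<rho>) = restrict \<phi>' (verts \<rho>)"
    have "\<phi> v = \<phi>' v" if "v \<in> verts \<rho> \<union> S" for v
      using that fun_cong[OF eq(1), of v] fun_cong[OF eq(2), of v] by (auto split: if_splits)
    then have same: "\<phi> = \<phi>'"
      using \<phi> \<phi>' by (intro extensionalityI[of _ "verts \<rho> \<union> S"]) (auto simp: etree_isos_def)
    have iso: "etree_iso \<phi> (graft S p c P \<rho>) \<tau>" "etree_iso \<phi> (graft S p' c P \<rho>) \<tau>"
      using \<phi> \<phi>' same by (auto simp: etree_isos_def)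
    have "p u = p' u" if u: "u \<in> S" for u
    proof -
      have "(\<phi> u, \<phi> (p u)) \<in> edges \<tau>" "(\<phi> u, \<phi> (p' u)) \<in> edges \<tau>"
        using edge_of_iso[OF iso(1), of u "p u"] edge_of_iso[OF iso(2), of u "p' u"] u by simp_all
      then have "\<phi> (p u) = \<phi> (p' u)" by (rule etree_edge_unique[OF \<tau>])
      moreover have "p u \<in> verts \<rho> \<union> S" "p' u \<in> verts \<rho> \<union> S"
        using PiE_mem[OF p u] PiE_mem[OF p' u] by simp_all
      ultimately show ?thesis
        using inj_onD[OF iso_inj_on[OF iso(1)], of "p u" "p' u"] by simp
    qed
    then have "p = p'" using p p' by (intro PiE_ext[of p S _ p']) auto
    then show "p = p' \<and> \<phi> = \<phi>'" using same by simp
  qed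
next
  show "?F ` ?A = ?B"
  proof (intro subset_antisym subsetI)
    fix z assume "z \<in> ?F ` ?A"
    then obtain p \<phi> where p: "p \<in> S \<rightarrow>\<^sub>E verts \<rho>" and \<phi>: "\<phi> \<in> etree_isos (graft S p c P \<rho>) \<tau>"
      and z: "z = (restrict \<phi> S, restrict \<phi> (verts \<rho>))" by auto
    have p': "p \<in> S \<rightarrow> verts \<rho>" using p by (simp add: PiE_def)
    have iso: "etree_iso \<phi> (graft S p c P \<rho>) \<tau>" using \<phi> by (simp add: etree_isos_def)
    have "etree_iso \<phi> \<rho> (remove_verts (\<phi> ` S) \<tau>)"
      using iso_remove_verts[OF is_etree_graft[OF p'] iso, of S] by (simp add: remove_verts_graft)
    then show "z \<in> ?B"
      using leaf_bundle_of_iso[OF p' iso] restrict_in_etree_isos[OF etree] z by simp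
  next
    fix z assume "z \<in> ?B"
    then obtain \<kappa> \<psi> where z: "z = (\<kappa>, \<psi>)" and \<kappa>: "\<kappa> \<in> leaf_bundles S c P \<tau>"
      and \<psi>: "\<psi> \<in> etree_isos \<rho> (remove_verts (\<kappa> ` S) \<tau>)" by auto
    let ?U = "\<kappa> ` S"
    have inj\<kappa>: "inj_on \<kappa> S" and U: "?U \<subseteq> coloured \<tau> c" "?U \<subseteq> verts \<tau>"
      and leaf: "\<And>u. u \<in> S \<Longrightarrow> children \<tau> (\<kappa> u) = {}"
      and pr: "{q \<in> pairs \<tau>. q \<inter> ?U \<noteq> {}} = (`) \<kappa> ` P"
      using \<kappa> coloured_subset[of \<tau> c] by (auto simp: leaf_bundles_def)
    have iso: "etree_iso \<psi> \<rho> (remove_verts ?U \<tau>)" using \<psi> by (simp add: etree_isos_def)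
    then have bij: "bij_betw \<psi> (verts \<rho>) (verts \<tau> - ?U)"
      and root: "\<psi> (tree_root \<rho>) = tree_root \<tau>"
      and edg: "edges \<tau> \<inter> (verts \<tau> - ?U) \<times> (verts \<tau> - ?U) = map_prod \<psi> \<psi> ` edges \<rho>"
      and col: "\<And>v. v \<in> verts \<rho> \<Longrightarrow> (colour \<tau> |` (verts \<tau> - ?U)) (\<psi> v) = colour \<rho> v"
      and prs: "{q \<in> pairs \<tau>. q \<inter> ?U = {}} = (`) \<psi> ` pairs \<rho>"
      by (simp_all add: etree_iso_def remove_verts_def)
    have edges\<tau>: "edges \<tau> \<subseteq> verts \<tau> \<times> verts \<tau>" using \<tau> by (simp add: is_etree_def)
    have noU: "b \<notin> ?U" if "(a, b) \<in> edges \<tau>" for a b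
      using that leaf by (auto simp: children_def)
    have "\<exists>v\<in>verts \<rho>. (\<kappa> u, \<psi> v) \<in> edges \<tau>" if u: "u \<in> S" for u
    proof -
      have "\<kappa> u \<in> verts \<tau> - {tree_root \<tau>}"
        using U u etree_dom_colour[OF \<tau>] by (fastforce simp: coloured_def)
      then obtain w where w: "(\<kappa> u, w) \<in> edges \<tau>" using etree_parent[OF \<tau>] by blast
      then have "w \<in> verts \<tau> - ?U" using noU[OF w] edges\<tau> by blast
      also have "verts \<tau> - ?U = \<psi> ` verts \<rho>" using bij by (simp add: bij_betw_def)
      finally have "w \<in> \<psi> ` verts \<rho>" .
      then show ?thesis using w by blast
    qed
    then obtain p0 where p0: "\<And>u. u \<in> S \<Longrightarrow> p0 u \<in> verts \<rho>" "\<And>u. u \<in> S \<Longrightarrow> (\<kappa> u, \<psi> (p0 u)) \<in> edges \<tau>"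
      using bchoice[of S "\<lambda>u v. v \<in> verts \<rho> \<and> (\<kappa> u, \<psi> v) \<in> edges \<tau>"] by blast
    define p where "p = restrict p0 S"
    have pE: "p \<in> S \<rightarrow>\<^sub>E verts \<rho>" using p0 by (auto simp: p_def)
    have pe: "(\<kappa> u, \<psi> (p u)) \<in> edges \<tau>" if "u \<in> S" for u using p0(2) that by (simp add: p_def)
    \<comment> \<open>The default value makes \<open>\<phi>\<close> extensional.\<close>
    define \<phi> where "\<phi> = (\<lambda>v. if v \<in> S then \<kappa> v else if v \<in> verts \<rho> then \<psi> v else undefined)"
    have \<phi>S: "\<phi> u = \<kappa> u" if "u \<in> S" for u using that by (simp add: \<phi>_def)
    have \<phi>V: "\<phi> v = \<psi> v" if "v \<in> verts \<rho>" for v using that S(2) by (auto simp: \<phi>_def)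
    have iso\<phi>: "etree_iso \<phi> (graft S p c P \<rho>) \<tau>"
      unfolding etree_iso_def graft_simps
    proof (intro conjI ballI)
      have "bij_betw \<phi> (verts \<rho>) (verts \<tau> - ?U)" using bij_betw_cong[of "verts \<rho>" \<phi> \<psi>] \<phi>V bij by simp
      moreover have "bij_betw \<phi> S ?U"
        using bij_betw_cong[of S \<phi> \<kappa>] \<phi>S inj_on_imp_bij_betw[OF inj\<kappa>] by simp
      ultimately have "bij_betw \<phi> (verts \<rho> \<union> S) ((verts \<tau> - ?U) \<union> ?U)"
        by (rule bij_betw_combine) auto
      moreover have "(verts \<tau> - ?U) \<union> ?U = verts \<tau>" using U by auto
      ultimately show "bij_betw \<phi> (verts \<rho> \<union> S) (verts \<tau>)" by simp
      show "\<phi> (tree_root \<rho>) = tree_root \<tau>"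
        using root \<phi>V etree by (simp add: is_etree_def)
      have "map_prod \<phi> \<phi> ` edges \<rho> = map_prod \<psi> \<psi> ` edges \<rho>"
      proof (rule image_cong[OF refl])
        fix e assume "e \<in> edges \<rho>"
        moreover have "edges \<rho> \<subseteq> verts \<rho> \<times> verts \<rho>" using etree by (simp add: is_etree_def)
        ultimately have "fst e \<in> verts \<rho>" "snd e \<in> verts \<rho>" by auto
        then show "map_prod \<phi> \<phi> e = map_prod \<psi> \<psi> e" by (cases e) (simp add: \<phi>V)
      qed
      moreover have "map_prod \<phi> \<phi> ` (\<lambda>u. (u, p u)) ` S = (\<lambda>u. (\<kappa> u, \<psi> (p u))) ` S"
      proof (unfold image_image, rule image_cong[OF refl])
        fix u assume "u \<in> S"
        then show "map_prod \<phi> \<phi> (u, p u) = (\<kappa> u, \<psi> (p u))"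
          using PiE_mem[OF pE] by (simp add: \<phi>S \<phi>V)
      qed
      moreover have "edges \<tau> = map_prod \<psi> \<psi> ` edges \<rho> \<union> (\<lambda>u. (\<kappa> u, \<psi> (p u))) ` S"
      proof (intro subset_antisym subsetI)
        fix e assume e: "e \<in> edges \<tau>"
        obtain a b where ab: "e = (a, b)" by fastforce
        show "e \<in> map_prod \<psi> \<psi> ` edges \<rho> \<union> (\<lambda>u. (\<kappa> u, \<psi> (p u))) ` S"
        proof (cases "a \<in> ?U")
          case True
          then obtain u where u: "u \<in> S" "a = \<kappa> u" by auto
          then have "b = \<psi> (p u)" using etree_edge_unique[OF \<tau>] e ab pe by blast
          then show ?thesis using u ab by auto
        next
          case False
          then have "e \<in> edges \<tau> \<inter> (verts \<tau> - ?U) \<times> (verts \<tau> - ?U)"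
            using e ab noU edges\<tau> by auto
          then show ?thesis unfolding edg by simp
        qed
      next
        fix e assume "e \<in> map_prod \<psi> \<psi> ` edges \<rho> \<union> (\<lambda>u. (\<kappa> u, \<psi> (p u))) ` S"
        then show "e \<in> edges \<tau>" unfolding edg[symmetric] using pe by auto
      qed
      ultimately show "edges \<tau> = map_prod \<phi> \<phi> ` (edges \<rho> \<union> (\<lambda>u. (u, p u)) ` S)"
        by (simp only: image_Un)
      fix v assume "v \<in> verts \<rho> \<union> S"
      then show "colour \<tau> (\<phi> v) = (if v \<in> S then Some c else colour \<rho> v)"
      proof (cases "v \<in> S")
        case True
        then have "\<kappa> v \<in> coloured \<tau> c" using U(1) by blast
        then show ?thesis using True by (simp add: \<phi>S coloured_def)
      next
        case False
        then have v: "v \<in> verts \<rho>" using \<open>v \<in> verts \<rho> \<union> S\<close> by simp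
        then have "\<psi> v \<in> verts \<tau> - ?U" using bij by (rule bij_betw_apply[rotated])
        then show ?thesis using False col[OF v] by (simp add: \<phi>V[OF v] restrict_map_def)
      qed
    next
      have "pairs \<tau> = {q \<in> pairs \<tau>. q \<inter> ?U = {}} \<union> {q \<in> pairs \<tau>. q \<inter> ?U \<noteq> {}}" by blast
      also have "\<dots> = (`) \<psi> ` pairs \<rho> \<union> (`) \<kappa> ` P" by (simp only: prs pr)
      also have "(`) \<psi> ` pairs \<rho> = (`) \<phi> ` pairs \<rho>"
        by (rule image_image_cong[OF pairs_subset_verts[OF etree]]) (simp_all add: \<phi>V)
      also have "(`) \<kappa> ` P = (`) \<phi> ` P"
        by (rule image_image_cong[OF P_subset(1)]) (simp_all add: \<phi>S)
      finally show "pairs \<tau> = (`) \<phi> ` (pairs \<rho> \<union> P)" by (simp only: image_Un)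
    qed
    have "\<phi> \<in> etree_isos (graft S p c P \<rho>) \<tau>"
      using iso\<phi> by (simp add: etree_isos_def \<phi>_def extensional_def)
    moreover have "restrict \<phi> S = \<kappa>"
      using \<kappa> \<phi>S by (intro extensionalityI[of _ S]) (auto simp: leaf_bundles_def)
    moreover have "restrict \<phi> (verts \<rho>) = \<psi>"
      using \<psi> \<phi>V by (intro extensionalityI[of _ "verts \<rho>"]) (auto simp: etree_isos_def)
    ultimately show "z \<in> ?F ` ?A"
      using pE z by (intro image_eqI[of _ _ "(p, \<phi>)"]) auto
  qed
qed

lemma finite_leaf_bundles:
  assumes "is_etree \<tau>"
  shows "finite (leaf_bundles S c P \<tau>)"
proof (rule finite_subset)
  show "leaf_bundles S c P \<tau> \<subseteq> S \<rightarrow>\<^sub>E verts \<tau>"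
    using coloured_subset[of \<tau> c] by (auto simp: leaf_bundles_def PiE_def)
  show "finite (S \<rightarrow>\<^sub>E verts \<tau>)"
    by (intro finite_PiE S(1) finite_verts assms)
qed

text \<open>Double counting through \<open>bij_betw_graft_isos\<close>. On either side each admissible choice accounts for as many isomorphisms as there are automorphisms of \<open>\<tau>\<close> or \<open>\<rho>\<close>, respectively.\<close>

lemma card_graft_equiv:
  assumes \<tau>: "is_etree \<tau>"
  shows "card {p \<in> S \<rightarrow>\<^sub>E verts \<rho>. etree_equiv (graft S p c P \<rho>) \<tau>} * card (etree_auts \<tau>) =
    card {\<kappa> \<in> leaf_bundles S c P \<tau>. etree_equiv \<rho> (remove_verts (\<kappa> ` S) \<tau>)} * card (etree_auts \<rho>)"
proof -
  have fin: "finite (S \<rightarrow>\<^sub>E verts \<rho>)"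
    by (intro finite_PiE S(1) finite_verts etree)
  have g: "is_etree (graft S p c P \<rho>)" if "p \<in> S \<rightarrow>\<^sub>E verts \<rho>" for p
    using that by (intro is_etree_graft) (simp add: PiE_def)
  have "card (SIGMA p:S \<rightarrow>\<^sub>E verts \<rho>. etree_isos (graft S p c P \<rho>) \<tau>) =
      (\<Sum>p\<in>S \<rightarrow>\<^sub>E verts \<rho>. card (etree_isos (graft S p c P \<rho>) \<tau>))"
    using fin finite_etree_isos g \<tau> by (intro card_SigmaI) auto
  also have "\<dots> = (\<Sum>p\<in>S \<rightarrow>\<^sub>E verts \<rho>. if etree_equiv (graft S p c P \<rho>) \<tau> then card (etree_auts \<tau>) else 0)"
  proof (intro sum.cong refl)
    fix p assume p: "p \<in> S \<rightarrow>\<^sub>E verts \<rho>"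
    show "card (etree_isos (graft S p c P \<rho>) \<tau>) =
      (if etree_equiv (graft S p c P \<rho>) \<tau> then card (etree_auts \<tau>) else 0)"
      using etree_isos_empty_iff[OF g[OF p] \<tau>] card_etree_isos[of "graft S p c P \<rho>" \<tau>]
        card_etree_auts_cong[of "graft S p c P \<rho>" \<tau>] by (cases "etree_equiv (graft S p c P \<rho>) \<tau>") simp_all
  qed
  also have "\<dots> = card {p \<in> S \<rightarrow>\<^sub>E verts \<rho>. etree_equiv (graft S p c P \<rho>) \<tau>} * card (etree_auts \<tau>)"
    using fin by (simp add: sum.If_cases Int_def)
  finally have 1: "card (SIGMA p:S \<rightarrow>\<^sub>E verts \<rho>. etree_isos (graft S p c P \<rho>) \<tau>) = \<dots>" .
  have r: "etree_isos \<rho> (remove_verts U \<tau>) = {} \<or> is_etree (remove_verts U \<tau>)" for U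
    using is_etree_iso_remove_verts[OF etree] by (auto simp: etree_isos_def)
  have "card (SIGMA \<kappa>:leaf_bundles S c P \<tau>. etree_isos \<rho> (remove_verts (\<kappa> ` S) \<tau>)) =
      (\<Sum>\<kappa>\<in>leaf_bundles S c P \<tau>. card (etree_isos \<rho> (remove_verts (\<kappa> ` S) \<tau>)))"
  proof (rule card_SigmaI[OF finite_leaf_bundles[OF \<tau>]], rule ballI)
    fix \<kappa>
    show "finite (etree_isos \<rho> (remove_verts (\<kappa> ` S) \<tau>))"
      using r[of "\<kappa> ` S"] finite_etree_isos[OF etree] by (elim disjE) simp_all
  qed
  also have "\<dots> = (\<Sum>\<kappa>\<in>leaf_bundles S c P \<tau>.
      if etree_equiv \<rho> (remove_verts (\<kappa> ` S) \<tau>) then card (etree_auts \<rho>) else 0)"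
  proof (intro sum.cong refl)
    fix \<kappa>
    show "card (etree_isos \<rho> (remove_verts (\<kappa> ` S) \<tau>)) =
      (if etree_equiv \<rho> (remove_verts (\<kappa> ` S) \<tau>) then card (etree_auts \<rho>) else 0)"
    proof (cases "etree_equiv \<rho> (remove_verts (\<kappa> ` S) \<tau>)")
      case True
      then show ?thesis by (simp add: card_etree_isos)
    next
      case False
      then have "etree_isos \<rho> (remove_verts (\<kappa> ` S) \<tau>) = {}"
        using r[of "\<kappa> ` S"] etree_isos_empty_iff[OF etree, of "remove_verts (\<kappa> ` S) \<tau>"] by blast
      then show ?thesis using False by simp
    qed
  qed
  also have "\<dots> = card {\<kappa> \<in> leaf_bundles S c P \<tau>. etree_equiv \<rho> (remove_verts (\<kappa> ` S) \<tau>)} * card (etree_auts \<rho>)"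
    using finite_leaf_bundles[OF \<tau>] by (simp add: sum.If_cases Int_def)
  finally have 2: "card (SIGMA \<kappa>:leaf_bundles S c P \<tau>. etree_isos \<rho> (remove_verts (\<kappa> ` S) \<tau>)) = \<dots>" .
  show ?thesis
    using bij_betw_same_card[OF bij_betw_graft_isos[OF \<tau>]] 1 2 by simp
qed

end

section \<open>Counting grafts against removals\<close>

lemma card_alpha_bundles:
  assumes \<tau>: "is_etree \<tau>"
  shows "card {\<kappa> \<in> leaf_bundles {n} Alpha {} \<tau>. etree_equiv \<rho> (remove_verts (\<kappa> ` {n}) \<tau>)} =
    card (alpha_removals \<rho> \<tau>)"
proof (rule bij_betw_same_card[of "\<lambda>\<kappa>. \<kappa> n"],
    rule bij_betw_byWitness[where f' = "\<lambda>v. \<lambda>u\<in>{n}. v"])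
  let ?X = "{\<kappa> \<in> leaf_bundles {n} Alpha {} \<tau>. etree_equiv \<rho> (remove_verts (\<kappa> ` {n}) \<tau>)}"
  show "\<forall>\<kappa>\<in>?X. (\<lambda>u\<in>{n}. \<kappa> n) = \<kappa>"
    by (auto simp: leaf_bundles_def intro!: extensionalityI[of _ "{n}"])
  show "\<forall>v\<in>alpha_removals \<rho> \<tau>. (\<lambda>u\<in>{n}. v) n = v" by simp
  show "(\<lambda>\<kappa>. \<kappa> n) ` ?X \<subseteq> alpha_removals \<rho> \<tau>"
    by (auto simp: leaf_bundles_def alpha_removals_def)
  show "(\<lambda>v. \<lambda>u\<in>{n}. v) ` alpha_removals \<rho> \<tau> \<subseteq> ?X"
  proof (rule image_subsetI)
    fix v assume v: "v \<in> alpha_removals \<rho> \<tau>"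
    then have "v \<notin> coloured \<tau> Beta" by (simp add: alpha_removals_def coloured_def)
    then have "q \<inter> {v} = {}" if "q \<in> pairs \<tau>" for q
      using etree_pairs_subset[OF \<tau> that] by blast
    then show "(\<lambda>u\<in>{n}. v) \<in> ?X"
      using v by (simp add: leaf_bundles_def alpha_removals_def)
  qed
qed

text \<open>A removable pair can be matched with the two new leaves in two orders, hence the factor 2.\<close>

lemma card_beta_bundles:
  assumes \<tau>: "is_etree \<tau>" and nm: "n \<noteq> m"
  shows "card {\<kappa> \<in> leaf_bundles {n, m} Beta {{n, m}} \<tau>. etree_equiv \<rho> (remove_verts (\<kappa> ` {n, m}) \<tau>)} =
    2 * card (beta_removals \<rho> \<tau>)"
proof -
  let ?X = "{\<kappa> \<in> leaf_bundles {n, m} Beta {{n, m}} \<tau>. etree_equiv \<rho> (remove_verts (\<kappa> ` {n, m}) \<tau>)}"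
  let ?B = "beta_removals \<rho> \<tau>"
  have "?X \<subseteq> {n, m} \<rightarrow>\<^sub>E verts \<tau>"
    using coloured_subset[of \<tau> Beta] by (auto simp: leaf_bundles_def PiE_def)
  then have fin: "finite ?X"
    by (rule finite_subset) (intro finite_PiE finite_verts[OF \<tau>], simp)
  have into: "(\<lambda>\<kappa>. \<kappa> ` {n, m}) ` ?X \<subseteq> ?B"
  proof (rule image_subsetI)
    fix \<kappa> assume \<kappa>: "\<kappa> \<in> ?X"
    then have "\<kappa> ` {n, m} \<in> {q \<in> pairs \<tau>. q \<inter> \<kappa> ` {n, m} \<noteq> {}}"
      by (simp add: leaf_bundles_def)
    then have "\<kappa> ` {n, m} \<in> pairs \<tau>" by blast
    then show "\<kappa> ` {n, m} \<in> ?B"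
      using \<kappa> by (simp add: leaf_bundles_def beta_removals_def)
  qed
  have "card {\<kappa> \<in> ?X. \<kappa> ` {n, m} = q} = 2" if q: "q \<in> ?B" for q
  proof -
    have qp: "q \<in> pairs \<tau>" using q by (simp add: beta_removals_def)
    then have "card q = 2" using \<tau> by (simp add: is_etree_def)
    then obtain a b where ab: "q = {a, b}" "a \<noteq> b" by (auto simp: card_2_iff)
    have "q \<subseteq> coloured \<tau> Beta" by (rule etree_pairs_subset[OF \<tau> qp])
    then have col: "a \<in> coloured \<tau> Beta" "b \<in> coloured \<tau> Beta" using ab by auto
    have leaf: "children \<tau> a = {}" "children \<tau> b = {}" and eq: "etree_equiv \<rho> (remove_verts q \<tau>)"
      using q ab by (simp_all add: beta_removals_def)
    have part: "partition_on (coloured \<tau> Beta) (pairs \<tau>)" using \<tau> by (simp add: is_etree_def)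
    \<comment> \<open>The pairs are disjoint, so \<open>q\<close> is the only one that meets \<open>q\<close>.\<close>
    have meet: "{r \<in> pairs \<tau>. r \<inter> q \<noteq> {}} = {q}"
      using disjointD[OF partition_onD2[OF part] _ qp] qp ab by fastforce
    let ?k = "\<lambda>c d. \<lambda>u\<in>{n, m}. if u = n then c else d"
    have kX: "?k c d \<in> ?X" if cd: "{c, d} = q" for c d
    proof -
      have img: "?k c d ` {n, m} = q" using cd nm by auto
      have "c \<noteq> d" using cd ab by auto
      then have "inj_on (?k c d) {n, m}" using nm by (simp add: inj_on_def)
      moreover have "\<forall>u\<in>{n, m}. children \<tau> (?k c d u) = {}"
        using cd leaf nm ab by (auto simp: doubleton_eq_iff)
      ultimately show ?thesis
        unfolding leaf_bundles_def mem_Collect_eq img meet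
        using img eq ab(1) col by auto
    qed
    have "{\<kappa> \<in> ?X. \<kappa> ` {n, m} = q} = {?k a b, ?k b a}"
    proof (intro subset_antisym subsetI)
      fix \<kappa> assume \<kappa>: "\<kappa> \<in> {\<kappa> \<in> ?X. \<kappa> ` {n, m} = q}"
      have "{\<kappa> n, \<kappa> m} = {a, b}" using \<kappa> ab(1) by simp
      then have "(\<kappa> n = a \<and> \<kappa> m = b) \<or> (\<kappa> n = b \<and> \<kappa> m = a)" by (auto simp: doubleton_eq_iff)
      moreover have "\<kappa> \<in> extensional {n, m}" using \<kappa> by (simp add: leaf_bundles_def)
      ultimately have "\<kappa> = ?k a b \<or> \<kappa> = ?k b a"
        using nm by (auto simp: fun_eq_iff extensional_def)
      then show "\<kappa> \<in> {?k a b, ?k b a}" by blast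
    next
      fix \<kappa> assume "\<kappa> \<in> {?k a b, ?k b a}"
      then consider "\<kappa> = ?k a b" | "\<kappa> = ?k b a" by blast
      then show "\<kappa> \<in> {\<kappa> \<in> ?X. \<kappa> ` {n, m} = q}"
      proof cases
        case 1
        have "?k a b ` {n, m} = q" using ab nm by auto
        then show ?thesis using kX[of a b] ab 1 by blast
      next
        case 2
        have "?k b a ` {n, m} = q" using ab nm by auto
        moreover have "{b, a} = q" using ab by auto
        ultimately show ?thesis using kX[of b a] 2 by blast
      qed
    qed
    moreover have "?k a b \<noteq> ?k b a"
    proof
      assume "?k a b = ?k b a"
      then have "?k a b n = ?k b a n" by (rule fun_cong)
      then show False using ab(2) by simp
    qed
    ultimately show ?thesis by simp
  qed
  then have "(\<Sum>q\<in>?B. card {\<kappa> \<in> ?X. \<kappa> ` {n, m} = q}) = 2 * card ?B" by simp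
  moreover have "(\<Sum>q\<in>?B. card {\<kappa> \<in> ?X. \<kappa> ` {n, m} = q}) = card ?X"
    using sum.group[OF fin finite_removals(2)[OF \<tau>] into, of "\<lambda>_. 1 :: nat"] by simp
  ultimately show ?thesis by simp
qed

lemma grafting_alpha: "is_etree \<rho> \<Longrightarrow> n \<notin> verts \<rho> \<Longrightarrow> grafting \<rho> {n} Alpha {}"
  by unfold_locales (auto simp: partition_on_empty)

lemma grafting_beta:
  "is_etree \<rho> \<Longrightarrow> n \<notin> verts \<rho> \<Longrightarrow> m \<notin> verts \<rho> \<Longrightarrow> n \<noteq> m \<Longrightarrow> grafting \<rho> {n, m} Beta {{n, m}}"
  by unfold_locales (auto simp: partition_on_space)

lemma etree_size_graft_alpha:
  assumes "is_etree \<rho>" "n \<notin> verts \<rho>"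
  shows "etree_size (graft {n} p Alpha {} \<rho>) = etree_size \<rho> + 1"
proof -
  interpret grafting \<rho> "{n}" Alpha "{}" by (rule grafting_alpha[OF assms])
  have "finite (coloured \<rho> Alpha)" "n \<notin> coloured \<rho> Alpha"
    using assms(2) coloured_subset[of \<rho> Alpha] finite_verts[OF assms(1)] finite_subset by auto
  then show ?thesis by (simp add: etree_size_def coloured_graft)
qed

lemma etree_size_graft_beta:
  assumes "is_etree \<rho>" "n \<notin> verts \<rho>" "m \<notin> verts \<rho>" "n \<noteq> m"
  shows "etree_size (graft {n, m} p Beta {{n, m}} \<rho>) = etree_size \<rho> + 1"
proof -
  interpret grafting \<rho> "{n, m}" Beta "{{n, m}}" by (rule grafting_beta[OF assms])
  have "finite (coloured \<rho> Beta)" "n \<notin> coloured \<rho> Beta" "m \<notin> coloured \<rho> Beta"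
    using assms(2,3) coloured_subset[of \<rho> Beta] finite_verts[OF assms(1)] finite_subset by auto
  then have "card (coloured \<rho> Beta \<union> {n, m}) = card (coloured \<rho> Beta) + 2"
    using assms(4) by simp
  then show ?thesis by (simp add: etree_size_def coloured_graft)
qed

section \<open>Derivatives of elementary differentials\<close>

definition vertex_fun ::
  "(real \<Rightarrow> real) \<Rightarrow> (real \<Rightarrow> real) \<Rightarrow> (real \<Rightarrow> real) \<Rightarrow> etree \<Rightarrow> nat \<Rightarrow> real \<Rightarrow> real" where
  "vertex_fun \<alpha> \<beta> f \<rho> v = (if v = tree_root \<rho> then f else coeff_fun \<alpha> \<beta> (the (colour \<rho> v)))"

text \<open>The elementary differential of a tree in which each vertex \<open>v\<close> is differentiated \<open>k v\<close> additional
times, as if \<open>k v\<close> further children were attached to it.\<close>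

definition raised_diff ::
  "(real \<Rightarrow> real) \<Rightarrow> (real \<Rightarrow> real) \<Rightarrow> (real \<Rightarrow> real) \<Rightarrow> etree \<Rightarrow> (nat \<Rightarrow> nat) \<Rightarrow> real \<Rightarrow> real" where
  "raised_diff \<alpha> \<beta> f \<rho> k x =
     (\<Prod>v\<in>verts \<rho>. (deriv ^^ (card (children \<rho> v) + k v)) (vertex_fun \<alpha> \<beta> f \<rho> v) x)"

lemma etree_diff_eq_raised_diff:
  assumes "is_etree \<rho>"
  shows "etree_diff \<alpha> \<beta> f x \<rho> = raised_diff \<alpha> \<beta> f \<rho> (\<lambda>_. 0) x"
proof -
  have "tree_root \<rho> \<in> verts \<rho>" using assms by (simp add: is_etree_def)
  then show ?thesis
    unfolding etree_diff_def raised_diff_def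
      prod.remove[OF finite_verts[OF assms] \<open>tree_root \<rho> \<in> verts \<rho>\<close>]
    by (auto simp: vertex_fun_def intro!: prod.cong)
qed

locale smooth_coefficients =
  fixes \<alpha> \<beta> f :: "real \<Rightarrow> real"
  assumes smooth: "C_infinity \<alpha>" "C_infinity \<beta>" "C_infinity f"
begin

lemma C_infinity_vertex_fun: "C_infinity (vertex_fun \<alpha> \<beta> f \<rho> v)"
  using smooth by (cases "the (colour \<rho> v)") (auto simp: vertex_fun_def)

text \<open>The product rule distributes one more child over all vertices.\<close>

lemma DERIV_raised_diff:
  assumes "is_etree \<rho>"
  shows "(raised_diff \<alpha> \<beta> f \<rho> k has_field_derivative
    (\<Sum>a\<in>verts \<rho>. raised_diff \<alpha> \<beta> f \<rho> (k(a := Suc (k a))) x)) (at x)"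
proof -
  let ?g = "\<lambda>k v. (deriv ^^ (card (children \<rho> v) + k v)) (vertex_fun \<alpha> \<beta> f \<rho> v)"
  have "(?g k v has_field_derivative deriv (?g k v) x) (at x)" for v
    by (intro C_infinity_DERIV C_infinity_funpow_deriv C_infinity_vertex_fun)
  then have "(raised_diff \<alpha> \<beta> f \<rho> k has_field_derivative
     (\<Sum>a\<in>verts \<rho>. deriv (?g k a) x * (\<Prod>v\<in>verts \<rho> - {a}. ?g k v x))) (at x)"
    unfolding raised_diff_def[abs_def] by (intro has_field_derivative_prod) auto
  also have "(\<Sum>a\<in>verts \<rho>. deriv (?g k a) x * (\<Prod>v\<in>verts \<rho> - {a}. ?g k v x)) =
     (\<Sum>a\<in>verts \<rho>. raised_diff \<alpha> \<beta> f \<rho> (k(a := Suc (k a))) x)"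
  proof (rule sum.cong[OF refl])
    fix a assume a: "a \<in> verts \<rho>"
    have "(\<Prod>v\<in>verts \<rho> - {a}. ?g k v x) = (\<Prod>v\<in>verts \<rho> - {a}. ?g (k(a := Suc (k a))) v x)"
      by (intro prod.cong) auto
    then show "deriv (?g k a) x * (\<Prod>v\<in>verts \<rho> - {a}. ?g k v x) =
        raised_diff \<alpha> \<beta> f \<rho> (k(a := Suc (k a))) x"
      unfolding raised_diff_def
      by (subst prod.remove[OF finite_verts[OF assms] a]) simp
  qed
  finally show ?thesis .
qed

text \<open>Iterating the product rule attaches the elements of \<open>S\<close>, one after the other, to arbitrary vertices.\<close>

lemma deriv_raised_diff:
  fixes S :: "nat set"
  assumes \<rho>: "is_etree \<rho>" and "finite S"
  shows "(deriv ^^ card S) (raised_diff \<alpha> \<beta> f \<rho> (\<lambda>_. 0)) =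
    (\<lambda>x. \<Sum>p\<in>S \<rightarrow>\<^sub>E verts \<rho>. raised_diff \<alpha> \<beta> f \<rho> (\<lambda>v. card {u \<in> S. p u = v}) x)"
  using assms(2)
proof (induction S rule: finite_induct)
  case empty
  then show ?case by simp
next
  case (insert s S)
  let ?V = "verts \<rho>" and ?r = "raised_diff \<alpha> \<beta> f \<rho>"
  let ?k = "\<lambda>S p v. card {u \<in> S. p u = v}"
  \<comment> \<open>Attaching \<open>s\<close> to \<open>a\<close> adds one to the number of elements attached to \<open>a\<close>.\<close>
  have k: "?k (insert s S) (p(s := a)) = (?k S p)(a := Suc (?k S p a))" for p :: "nat \<Rightarrow> nat" and a
  proof
    fix v
    have "{u \<in> insert s S. (p(s := a)) u = v} =
        (if v = a then insert s {u \<in> S. p u = v} else {u \<in> S. p u = v})"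
      using insert.hyps(2) by auto
    then show "?k (insert s S) (p(s := a)) v = ((?k S p)(a := Suc (?k S p a))) v"
      using insert.hyps by simp
  qed
  have "(deriv ^^ card (insert s S)) (?r (\<lambda>_. 0)) = deriv (\<lambda>x. \<Sum>p\<in>S \<rightarrow>\<^sub>E ?V. ?r (?k S p) x)"
    using insert by simp
  also have "\<dots> = (\<lambda>x. \<Sum>p\<in>S \<rightarrow>\<^sub>E ?V. \<Sum>a\<in>?V. ?r ((?k S p)(a := Suc (?k S p a))) x)"
    by (intro ext DERIV_imp_deriv DERIV_sum DERIV_raised_diff[OF \<rho>])
  also have "\<dots> = (\<lambda>x. \<Sum>p\<in>insert s S \<rightarrow>\<^sub>E ?V. ?r (?k (insert s S) p) x)"
  proof
    fix x
    have "(\<Sum>p\<in>insert s S \<rightarrow>\<^sub>E ?V. ?r (?k (insert s S) p) x) =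
        (\<Sum>(a, p)\<in>?V \<times> (S \<rightarrow>\<^sub>E ?V). ?r (?k (insert s S) (p(s := a))) x)"
      unfolding PiE_insert_eq
      by (subst sum.reindex[OF inj_combinator[OF insert.hyps(2)]]) (simp add: case_prod_beta)
    also have "\<dots> = (\<Sum>a\<in>?V. \<Sum>p\<in>S \<rightarrow>\<^sub>E ?V. ?r ((?k S p)(a := Suc (?k S p a))) x)"
      unfolding k by (simp add: sum.cartesian_product)
    also have "\<dots> = (\<Sum>p\<in>S \<rightarrow>\<^sub>E ?V. \<Sum>a\<in>?V. ?r ((?k S p)(a := Suc (?k S p a))) x)"
      by (rule sum.swap)
    finally show "(\<Sum>p\<in>S \<rightarrow>\<^sub>E ?V. \<Sum>a\<in>?V. ?r ((?k S p)(a := Suc (?k S p a))) x) =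
        (\<Sum>p\<in>insert s S \<rightarrow>\<^sub>E ?V. ?r (?k (insert s S) p) x)" by simp
  qed
  finally show ?case .
qed

end

lemma (in grafting) etree_diff_graft:
  assumes p: "p \<in> S \<rightarrow> verts \<rho>"
  shows "etree_diff \<alpha> \<beta> f x (graft S p c P \<rho>) =
    coeff_fun \<alpha> \<beta> c x ^ card S * raised_diff \<alpha> \<beta> f \<rho> (\<lambda>v. card {u \<in> S. p u = v}) x"
proof -
  let ?\<gamma> = "graft S p c P \<rho>"
  let ?F = "\<lambda>v. (deriv ^^ card (children ?\<gamma> v)) (vertex_fun \<alpha> \<beta> f ?\<gamma> v) x"
  have root: "tree_root \<rho> \<in> verts \<rho>" using etree by (simp add: is_etree_def)
  have "etree_diff \<alpha> \<beta> f x ?\<gamma> = (\<Prod>v\<in>verts \<rho> \<union> S. ?F v)"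
    unfolding etree_diff_eq_raised_diff[OF is_etree_graft[OF p]] by (simp add: raised_diff_def)
  also have "\<dots> = (\<Prod>v\<in>verts \<rho>. ?F v) * (\<Prod>v\<in>S. ?F v)"
    using S by (intro prod.union_disjoint finite_verts[OF etree]) auto
  also have "(\<Prod>v\<in>S. ?F v) = (\<Prod>v\<in>S. coeff_fun \<alpha> \<beta> c x)"
  proof (rule prod.cong[OF refl])
    fix v assume v: "v \<in> S"
    then have "v \<noteq> tree_root \<rho>" using root S(2) by blast
    then show "?F v = coeff_fun \<alpha> \<beta> c x"
      using v by (simp add: children_graft_leaf[OF p v] vertex_fun_def)
  qed
  also have "(\<Prod>v\<in>verts \<rho>. ?F v) = raised_diff \<alpha> \<beta> f \<rho> (\<lambda>v. card {u \<in> S. p u = v}) x"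
    unfolding raised_diff_def
  proof (rule prod.cong[OF refl])
    fix v assume v: "v \<in> verts \<rho>"
    then have "v \<notin> S" using S(2) by blast
    then have "vertex_fun \<alpha> \<beta> f ?\<gamma> v = vertex_fun \<alpha> \<beta> f \<rho> v" by (simp add: vertex_fun_def)
    moreover have "card (children ?\<gamma> v) = card (children \<rho> v) + card {u \<in> S. p u = v}"
      unfolding children_graft[OF v]
      using S children_subset[OF etree, of v] finite_subset[OF children_subset finite_verts, OF etree etree]
      by (intro card_Un_disjoint) auto
    ultimately show "?F v = (deriv ^^ (card (children \<rho> v) + card {u \<in> S. p u = v})) (vertex_fun \<alpha> \<beta> f \<rho> v) x"
      by simp
  qed
  finally show ?thesis by simp
qed

text \<open>The first and the second derivative attach one and two children, and the coefficients $\alpha$ and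
$\beta^2$ supply the factors that belong to the new leaves.\<close>

lemma (in smooth_coefficients) generator_etree_diff:
  assumes \<rho>: "is_etree \<rho>" "n \<notin> verts \<rho>" "m \<notin> verts \<rho>" "n \<noteq> m"
  shows "generator \<alpha> \<beta> (\<lambda>x. etree_diff \<alpha> \<beta> f x \<rho>) x =
    (\<Sum>p\<in>{n} \<rightarrow>\<^sub>E verts \<rho>. etree_diff \<alpha> \<beta> f x (graft {n} p Alpha {} \<rho>)) +
    1/2 * (\<Sum>p\<in>{n, m} \<rightarrow>\<^sub>E verts \<rho>. etree_diff \<alpha> \<beta> f x (graft {n, m} p Beta {{n, m}} \<rho>))"
proof -
  interpret a: grafting \<rho> "{n}" Alpha "{}" by (rule grafting_alpha[OF \<rho>(1,2)])
  interpret b: grafting \<rho> "{n, m}" Beta "{{n, m}}" by (rule grafting_beta[OF \<rho>])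
  let ?r = "raised_diff \<alpha> \<beta> f \<rho>"
  have two: "card {n, m} = 2" using \<rho>(4) by simp
  have "(\<lambda>x. etree_diff \<alpha> \<beta> f x \<rho>) = ?r (\<lambda>_. 0)"
    by (simp add: etree_diff_eq_raised_diff[OF \<rho>(1)] fun_eq_iff)
  moreover have "deriv (?r (\<lambda>_. 0)) x = (\<Sum>p\<in>{n} \<rightarrow>\<^sub>E verts \<rho>. ?r (\<lambda>v. card {u \<in> {n}. p u = v}) x)"
    using fun_cong[OF deriv_raised_diff[OF \<rho>(1), of "{n}"], of x] by (simp del: insert_iff)
  moreover have "deriv (deriv (?r (\<lambda>_. 0))) x =
      (\<Sum>p\<in>{n, m} \<rightarrow>\<^sub>E verts \<rho>. ?r (\<lambda>v. card {u \<in> {n, m}. p u = v}) x)"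
    using fun_cong[OF deriv_raised_diff[OF \<rho>(1), of "{n, m}"], of x]
    by (simp add: two numeral_2_eq_2 del: insert_iff)
  moreover have "(\<Sum>p\<in>{n} \<rightarrow>\<^sub>E verts \<rho>. etree_diff \<alpha> \<beta> f x (graft {n} p Alpha {} \<rho>)) =
     \<alpha> x * (\<Sum>p\<in>{n} \<rightarrow>\<^sub>E verts \<rho>. ?r (\<lambda>v. card {u \<in> {n}. p u = v}) x)"
    unfolding sum_distrib_left
    by (intro sum.cong refl) (subst a.etree_diff_graft, auto simp del: insert_iff)
  moreover have "(\<Sum>p\<in>{n, m} \<rightarrow>\<^sub>E verts \<rho>. etree_diff \<alpha> \<beta> f x (graft {n, m} p Beta {{n, m}} \<rho>)) =
     (\<beta> x)\<^sup>2 * (\<Sum>p\<in>{n, m} \<rightarrow>\<^sub>E verts \<rho>. ?r (\<lambda>v. card {u \<in> {n, m}. p u = v}) x)"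
    unfolding sum_distrib_left using \<rho>(4)
    by (intro sum.cong refl) (subst b.etree_diff_graft, auto simp del: insert_iff simp: two PiE_def)
  ultimately show ?thesis by (simp add: generator_def)
qed

section \<open>Isomorphism classes of trees\<close>

lemma abs_exotic_tree_eq_iff:
  assumes "is_etree \<rho>" "is_etree \<tau>"
  shows "abs_exotic_tree \<rho> = abs_exotic_tree \<tau> \<longleftrightarrow> etree_equiv \<rho> \<tau>"
  using Quotient3_rel[OF Quotient3_exotic_tree, of \<rho> \<tau>] etree_equiv_refl assms by blast

lemma
  assumes "is_etree \<rho>"
  shows tree_size_abs: "tree_size (abs_exotic_tree \<rho>) = etree_size \<rho>"
    and symmetry_factor_abs: "symmetry_factor (abs_exotic_tree \<rho>) = card (etree_auts \<rho>)"
    and elementary_differential_abs: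
      "elementary_differential \<alpha> \<beta> f x (abs_exotic_tree \<rho>) = etree_diff \<alpha> \<beta> f x \<rho>"
  using etree_equiv_refl[OF assms]
  by (simp_all add: tree_size.abs_eq symmetry_factor.abs_eq elementary_differential.abs_eq)

lemma
  assumes "is_etree \<rho>" "is_etree \<tau>"
  shows m_alpha_abs: "m_alpha (abs_exotic_tree \<rho>) (abs_exotic_tree \<tau>) = card (alpha_removals \<rho> \<tau>)"
    and m_beta_abs: "m_beta (abs_exotic_tree \<rho>) (abs_exotic_tree \<tau>) = card (beta_removals \<rho> \<tau>)"
  using etree_equiv_refl[OF assms(1)] etree_equiv_refl[OF assms(2)]
  by (simp_all add: m_alpha.abs_eq m_beta.abs_eq)

lemma symmetry_factor_pos: "symmetry_factor \<tau> > 0"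
proof -
  obtain \<rho> where \<rho>: "is_etree \<rho>" "abs_exotic_tree \<rho> = \<tau>" by (rule rep_exotic_tree)
  have "restrict id (verts \<rho>) \<in> etree_auts \<rho>"
    using etree_iso_cong[OF \<rho>(1) etree_iso_id] by (auto simp: etree_auts_def)
  then have "card (etree_auts \<rho>) > 0" using finite_etree_auts[OF \<rho>(1)] by (auto simp: card_gt_0_iff)
  then show ?thesis using symmetry_factor_abs[OF \<rho>(1)] \<rho>(2) by simp
qed

lemma etree_iso_image:
  assumes \<rho>: "is_etree \<rho>" and h: "inj_on h (verts \<rho>)"
  defines "\<rho>' \<equiv> \<lparr>verts = h ` verts \<rho>, tree_root = h (tree_root \<rho>), edges = map_prod h h ` edges \<rho>,
    colour = (\<lambda>v. if v \<in> h ` verts \<rho> then colour \<rho> (inv_into (verts \<rho>) h v) else None),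
    pairs = (`) h ` pairs \<rho>\<rparr>"
  shows "etree_iso h \<rho> \<rho>'" "is_etree \<rho>'"
proof -
  show iso: "etree_iso h \<rho> \<rho>'"
    using h by (auto simp: etree_iso_def \<rho>'_def bij_betw_def)
  show "is_etree \<rho>'"
    by (rule is_etree_iso[OF \<rho> iso]) (auto simp: \<rho>'_def split: if_splits)
qed

lemma card_verts_le_size:
  assumes "is_etree \<rho>"
  shows "card (verts \<rho>) \<le> 2 * etree_size \<rho>"
proof -
  have fin: "finite (coloured \<rho> c)" for c
    using finite_subset[OF coloured_subset finite_verts[OF assms]] .
  have "verts \<rho> \<subseteq> insert (tree_root \<rho>) (coloured \<rho> Alpha \<union> coloured \<rho> Beta)"
  proof
    fix v assume v: "v \<in> verts \<rho>"
    show "v \<in> insert (tree_root \<rho>) (coloured \<rho> Alpha \<union> coloured \<rho> Beta)"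
    proof (cases "v = tree_root \<rho>")
      case False
      then obtain c where "colour \<rho> v = Some c" using etree_dom_colour[OF assms] v by blast
      then show ?thesis using v by (cases c) (auto simp: coloured_def)
    qed simp
  qed
  then have "card (verts \<rho>) \<le> card (insert (tree_root \<rho>) (coloured \<rho> Alpha \<union> coloured \<rho> Beta))"
    using fin by (intro card_mono) auto
  also have "\<dots> \<le> Suc (card (coloured \<rho> Alpha) + card (coloured \<rho> Beta))"
    by (rule order_trans[OF card_insert_le_m1]) (auto intro: card_Un_le)
  finally show ?thesis by (simp add: etree_size_def)
qed

text \<open>Every class has a representative whose vertices lie in a fixed finite initial segment of the
naturals, since the size bounds the number of vertices. Finiteness is what gives the sum over all
trees of one size its intended meaning.\<close>

lemma finite_trees_of_size: "finite {\<tau>. tree_size \<tau> = k}"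
proof -
  define A where "A = {0..<2 * k}"
  have finA: "finite A" by (simp add: A_def)
  have UNIV_colour: "(UNIV :: colour set) = {Alpha, Beta}" using colour.exhaust by auto
  define F where "F = (\<lambda>(V, r, E, c, Q). \<lparr>verts = V, tree_root = r, edges = E, colour = c, pairs = Q\<rparr> :: etree) `
    (Pow A \<times> A \<times> Pow (A \<times> A) \<times> (\<Union>B\<in>Pow A. {c. dom c = B \<and> ran c \<subseteq> UNIV}) \<times> Pow (Pow A))"
  have "finite {c :: nat \<rightharpoonup> colour. dom c = B \<and> ran c \<subseteq> UNIV}" if "B \<in> Pow A" for B
    using that finA finite_subset by (intro finite_set_of_finite_maps) (auto simp: UNIV_colour)
  then have "finite F"
    unfolding F_def using finA by (intro finite_imageI finite_cartesian_product finite_UN_I) auto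
  moreover have "{\<tau>. tree_size \<tau> = k} \<subseteq> abs_exotic_tree ` F"
  proof
    fix \<tau> assume "\<tau> \<in> {\<tau>. tree_size \<tau> = k}"
    then have k: "tree_size \<tau> = k" by simp
    obtain \<rho> where \<rho>: "is_etree \<rho>" "abs_exotic_tree \<rho> = \<tau>" by (rule rep_exotic_tree)
    have "card (verts \<rho>) \<le> 2 * k"
      using card_verts_le_size[OF \<rho>(1)] tree_size_abs[OF \<rho>(1)] \<rho>(2) k by simp
    moreover obtain h where h: "bij_betw h (verts \<rho>) {0..<card (verts \<rho>)}"
      using ex_bij_betw_finite_nat[OF finite_verts[OF \<rho>(1)]] by blast
    ultimately have hA: "h ` verts \<rho> \<subseteq> A" by (auto simp: bij_betw_def A_def)
    have inj: "inj_on h (verts \<rho>)" using h by (simp add: bij_betw_def)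
    define \<rho>' :: etree where "\<rho>' = \<lparr>verts = h ` verts \<rho>, tree_root = h (tree_root \<rho>), edges = map_prod h h ` edges \<rho>,
      colour = (\<lambda>v. if v \<in> h ` verts \<rho> then colour \<rho> (inv_into (verts \<rho>) h v) else None),
      pairs = (`) h ` pairs \<rho>\<rparr>"
    have \<rho>': "etree_iso h \<rho> \<rho>'" "is_etree \<rho>'"
      unfolding \<rho>'_def by (rule etree_iso_image[OF \<rho>(1) inj])+
    then have "abs_exotic_tree \<rho>' = \<tau>"
      using abs_exotic_tree_eq_iff[OF \<rho>(1) \<rho>'(2)] \<rho> by (auto simp: etree_equiv_def)
    moreover have "\<rho>' \<in> F"
    proof -
      have V: "verts \<rho>' \<in> Pow A" using hA by (simp add: \<rho>'_def)
      have r: "tree_root \<rho>' \<in> verts \<rho>'" and E: "edges \<rho>' \<subseteq> verts \<rho>' \<times> verts \<rho>'"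
        using \<rho>'(2) by (simp_all add: is_etree_def)
      have "dom (colour \<rho>') \<in> Pow A" using etree_dom_colour[OF \<rho>'(2)] V by blast
      then have c: "colour \<rho>' \<in> (\<Union>B\<in>Pow A. {c. dom c = B \<and> ran c \<subseteq> UNIV})" by blast
      have Q: "pairs \<rho>' \<in> Pow (Pow A)" using pairs_subset_verts[OF \<rho>'(2)] V by blast
      have "edges \<rho>' \<in> Pow (A \<times> A)" using E V by blast
      then show ?thesis
        unfolding F_def using V r c Q
        by (intro image_eqI[of _ _ "(verts \<rho>', tree_root \<rho>', edges \<rho>', colour \<rho>', pairs \<rho>')"]) auto
    qed
    ultimately show "\<tau> \<in> abs_exotic_tree ` F" by blast
  qed
  ultimately show ?thesis using finite_subset by blast
qed

text \<open>A single $\beta$-vertex would not change the size, because half the number of $\beta$-vertices is rounded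
down; it is excluded as it could not belong to a pair.\<close>

lemma trees_of_size_1: "{\<tau>. tree_size \<tau> = 1} = {abs_exotic_tree single_root}"
proof (intro subset_antisym subsetI)
  fix \<tau> assume "\<tau> \<in> {\<tau>. tree_size \<tau> = 1}"
  then have 1: "tree_size \<tau> = 1" by simp
  obtain \<rho> where \<rho>: "is_etree \<rho>" "abs_exotic_tree \<rho> = \<tau>" by (rule rep_exotic_tree)
  have fin: "finite (coloured \<rho> c)" for c
    using finite_subset[OF coloured_subset finite_verts[OF \<rho>(1)]] .
  have "etree_size \<rho> = 1" using tree_size_abs[OF \<rho>(1)] \<rho>(2) 1 by simp
  then have card: "card (coloured \<rho> Alpha) = 0" "card (coloured \<rho> Beta) < 2"
    by (auto simp: etree_size_def)
  have part: "partition_on (coloured \<rho> Beta) (pairs \<rho>)" and two: "\<And>p. p \<in> pairs \<rho> \<Longrightarrow> card p = 2"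
    using \<rho>(1) by (simp_all add: is_etree_def)
  have P: "pairs \<rho> = {}"
  proof (rule equals0I)
    fix p assume p: "p \<in> pairs \<rho>"
    have "card p \<le> card (coloured \<rho> Beta)" by (rule card_mono[OF fin etree_pairs_subset[OF \<rho>(1) p]])
    then show False using two[OF p] card(2) by simp
  qed
  then have B: "coloured \<rho> Beta = {}" using partition_onD1[OF part] by simp
  have A: "coloured \<rho> Alpha = {}" using card(1) fin by simp
  have only: "v = tree_root \<rho>" if v: "v \<in> verts \<rho>" for v
  proof (rule ccontr)
    assume "v \<noteq> tree_root \<rho>"
    then obtain c where "colour \<rho> v = Some c" using etree_dom_colour[OF \<rho>(1)] v by blast
    then have "v \<in> coloured \<rho> c" using v by (simp add: coloured_def)
    then show False using A B by (cases c) auto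
  qed
  have r: "tree_root \<rho> \<in> verts \<rho>" and e: "edges \<rho> \<subseteq> verts \<rho> \<times> verts \<rho>"
    and source: "\<And>w. (tree_root \<rho>, w) \<notin> edges \<rho>" using \<rho>(1) by (simp_all add: is_etree_def)
  have V: "verts \<rho> = {tree_root \<rho>}" using only r by blast
  have E: "edges \<rho> = {}"
  proof (rule equals0I)
    fix e assume "e \<in> edges \<rho>"
    then have "e = (tree_root \<rho>, snd e)" using e only[of "fst e"] by (cases e) auto
    then show False using \<open>e \<in> edges \<rho>\<close> source by metis
  qed
  have "colour \<rho> (tree_root \<rho>) = None" using etree_dom_colour[OF \<rho>(1)] by blast
  then have "etree_iso (\<lambda>_. 0) \<rho> single_root"
    using V E P by (simp add: etree_iso_def single_root_def bij_betw_def)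
  then have "etree_equiv \<rho> single_root"
    using \<rho>(1) is_etree_single_root by (auto simp: etree_equiv_def)
  then show "\<tau> \<in> {abs_exotic_tree single_root}"
    using abs_exotic_tree_eq_iff[OF \<rho>(1) is_etree_single_root] \<rho>(2) by simp
next
  fix \<tau> assume "\<tau> \<in> {abs_exotic_tree single_root}"
  then show "\<tau> \<in> {\<tau>. tree_size \<tau> = 1}"
    using tree_size_abs[OF is_etree_single_root]
    by (simp add: etree_size_def coloured_def single_root_def)
qed

lemma obtain_two_fresh:
  assumes "finite (V :: nat set)"
  obtains n m where "n \<notin> V" "m \<notin> V" "n \<noteq> m"
proof -
  obtain n where n: "n \<notin> V" using ex_new_if_finite[OF infinite_UNIV_nat assms] by blast
  obtain m where "m \<notin> insert n V" using ex_new_if_finite[OF infinite_UNIV_nat, of "insert n V"] assms by blast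
  then show ?thesis using that n by auto
qed

lemma card_alpha_grafts:
  assumes "is_etree \<rho>" "is_etree \<tau>" "n \<notin> verts \<rho>"
  shows "card {p \<in> {n} \<rightarrow>\<^sub>E verts \<rho>. etree_equiv (graft {n} p Alpha {} \<rho>) \<tau>} * card (etree_auts \<tau>) =
    card (alpha_removals \<rho> \<tau>) * card (etree_auts \<rho>)"
  using grafting.card_graft_equiv[OF grafting_alpha[OF assms(1,3)] assms(2)]
  by (simp only: card_alpha_bundles[OF assms(2)])

lemma card_beta_grafts:
  assumes "is_etree \<rho>" "is_etree \<tau>" "n \<notin> verts \<rho>" "m \<notin> verts \<rho>" "n \<noteq> m"
  shows "card {p \<in> {n, m} \<rightarrow>\<^sub>E verts \<rho>. etree_equiv (graft {n, m} p Beta {{n, m}} \<rho>) \<tau>} * card (etree_auts \<tau>) =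
    2 * card (beta_removals \<rho> \<tau>) * card (etree_auts \<rho>)"
  using grafting.card_graft_equiv[OF grafting_beta[OF assms(1,3-5)] assms(2)]
  by (simp only: card_beta_bundles[OF assms(2,5)])

text \<open>A nonzero multiplicity means that \<open>\<tau>\<close> is obtained from \<open>\<tau>'\<close> by grafting, which raises the size by
one. The sums that define the tree factorial therefore run over trees of one and the same size.\<close>

lemma m_alpha_size_eq:
  assumes "m_alpha \<tau>' \<tau> \<noteq> 0"
  shows "tree_size \<tau> = tree_size \<tau>' + 1"
proof -
  obtain \<rho>' where \<rho>': "is_etree \<rho>'" "abs_exotic_tree \<rho>' = \<tau>'" by (rule rep_exotic_tree)
  obtain \<rho> where \<rho>: "is_etree \<rho>" "abs_exotic_tree \<rho> = \<tau>" by (rule rep_exotic_tree)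
  obtain n m where n: "n \<notin> verts \<rho>'" "m \<notin> verts \<rho>'" "n \<noteq> m"
    using obtain_two_fresh[OF finite_verts[OF \<rho>'(1)]] .
  have "card (alpha_removals \<rho>' \<rho>) \<noteq> 0" using m_alpha_abs[OF \<rho>'(1) \<rho>(1)] \<rho>'(2) \<rho>(2) assms by simp
  moreover have "card (etree_auts \<rho>') \<noteq> 0"
    using symmetry_factor_pos[of \<tau>'] symmetry_factor_abs[OF \<rho>'(1)] \<rho>'(2) by simp
  ultimately have "card {p \<in> {n} \<rightarrow>\<^sub>E verts \<rho>'. etree_equiv (graft {n} p Alpha {} \<rho>') \<rho>} \<noteq> 0"
    using card_alpha_grafts[OF \<rho>'(1) \<rho>(1) n(1)] by (metis mult_eq_0_iff)
  then obtain p where "etree_equiv (graft {n} p Alpha {} \<rho>') \<rho>" by fastforce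
  from etree_size_cong[OF this] have "etree_size \<rho> = etree_size \<rho>' + 1"
    by (simp add: etree_size_graft_alpha[OF \<rho>'(1) n(1)])
  then show ?thesis using tree_size_abs[OF \<rho>(1)] tree_size_abs[OF \<rho>'(1)] \<rho>(2) \<rho>'(2) by simp
qed

lemma m_beta_size_eq:
  assumes "m_beta \<tau>' \<tau> \<noteq> 0"
  shows "tree_size \<tau> = tree_size \<tau>' + 1"
proof -
  obtain \<rho>' where \<rho>': "is_etree \<rho>'" "abs_exotic_tree \<rho>' = \<tau>'" by (rule rep_exotic_tree)
  obtain \<rho> where \<rho>: "is_etree \<rho>" "abs_exotic_tree \<rho> = \<tau>" by (rule rep_exotic_tree)
  obtain n m where n: "n \<notin> verts \<rho>'" "m \<notin> verts \<rho>'" "n \<noteq> m"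
    using obtain_two_fresh[OF finite_verts[OF \<rho>'(1)]] .
  have "card (beta_removals \<rho>' \<rho>) \<noteq> 0" using m_beta_abs[OF \<rho>'(1) \<rho>(1)] \<rho>'(2) \<rho>(2) assms by simp
  moreover have "card (etree_auts \<rho>') \<noteq> 0"
    using symmetry_factor_pos[of \<tau>'] symmetry_factor_abs[OF \<rho>'(1)] \<rho>'(2) by simp
  ultimately have "card {p \<in> {n, m} \<rightarrow>\<^sub>E verts \<rho>'. etree_equiv (graft {n, m} p Beta {{n, m}} \<rho>') \<rho>} \<noteq> 0"
    using card_beta_grafts[OF \<rho>'(1) \<rho>(1) n] by (metis mult_eq_0_iff zero_neq_numeral)
  then obtain p where "etree_equiv (graft {n, m} p Beta {{n, m}} \<rho>') \<rho>" by fastforce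
  from etree_size_cong[OF this] have "etree_size \<rho> = etree_size \<rho>' + 1"
    by (simp add: etree_size_graft_beta[OF \<rho>'(1) n])
  then show ?thesis using tree_size_abs[OF \<rho>(1)] tree_size_abs[OF \<rho>'(1)] \<rho>(2) \<rho>'(2) by simp
qed

section \<open>The exotic B-series of powers of the generator\<close>

text \<open>The number $|\tau|!/\tau!$ counts the orders in which \<open>\<tau>\<close> can be taken apart by removing
$\alpha$-leaves and paired $\beta$-leaves.\<close>

definition tree_coefficient :: "exotic_tree \<Rightarrow> real" where
  "tree_coefficient \<tau> = fact (tree_size \<tau>) * inv_tree_factorial \<tau> / real (symmetry_factor \<tau>)"

lemma inv_tree_factorial_step:
  assumes "tree_size \<tau> = k + 1" "k \<ge> 1"
  shows "real (tree_size \<tau>) * inv_tree_factorial \<tau> =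
    (\<Sum>\<tau>'\<in>{\<tau>'. tree_size \<tau>' = k}. real (m_alpha \<tau>' \<tau> + m_beta \<tau>' \<tau>) * inv_tree_factorial \<tau>')"
proof -
  have "(\<Sum>\<tau>'\<in>{\<tau>'. m_alpha \<tau>' \<tau> \<noteq> 0}. real (m_alpha \<tau>' \<tau>) * inv_tree_factorial \<tau>') =
      (\<Sum>\<tau>'\<in>{\<tau>'. tree_size \<tau>' = k}. real (m_alpha \<tau>' \<tau>) * inv_tree_factorial \<tau>')"
    using assms m_alpha_size_eq[of _ \<tau>]
    by (intro sum.mono_neutral_left finite_trees_of_size) auto
  moreover have "(\<Sum>\<tau>'\<in>{\<tau>'. m_beta \<tau>' \<tau> \<noteq> 0}. real (m_beta \<tau>' \<tau>) * inv_tree_factorial \<tau>') =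
      (\<Sum>\<tau>'\<in>{\<tau>'. tree_size \<tau>' = k}. real (m_beta \<tau>' \<tau>) * inv_tree_factorial \<tau>')"
    using assms m_beta_size_eq[of _ \<tau>]
    by (intro sum.mono_neutral_left finite_trees_of_size) auto
  moreover have "real (tree_size \<tau>) * inv_tree_factorial \<tau> =
      (\<Sum>\<tau>'\<in>{\<tau>'. m_alpha \<tau>' \<tau> \<noteq> 0}. real (m_alpha \<tau>' \<tau>) * inv_tree_factorial \<tau>') +
      (\<Sum>\<tau>'\<in>{\<tau>'. m_beta \<tau>' \<tau> \<noteq> 0}. real (m_beta \<tau>' \<tau>) * inv_tree_factorial \<tau>')"
  proof -
    have "tree_size \<tau> \<noteq> 1" and nz: "real (tree_size \<tau>) \<noteq> 0" using assms by simp_all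
    then show ?thesis
      by (subst inv_tree_factorial.simps)
         (simp only: if_False times_divide_eq_right nonzero_mult_div_cancel_left[OF nz])
  qed
  ultimately show ?thesis by (simp only: sum.distrib[symmetric] of_nat_add distrib_right)
qed

text \<open>After multiplication by $(|\tau|-1)!$ the recursion of the tree factorial involves only
$|\tau'|!/\tau'!$ on the right, as $|\tau'| = |\tau| - 1$.\<close>

lemma tree_coefficient_step:
  assumes "tree_size \<tau> = k + 1" "k \<ge> 1"
  shows "tree_coefficient \<tau> =
    (\<Sum>\<tau>'\<in>{\<tau>'. tree_size \<tau>' = k}. tree_coefficient \<tau>' *
       (real (m_alpha \<tau>' \<tau> + m_beta \<tau>' \<tau>) * real (symmetry_factor \<tau>') / real (symmetry_factor \<tau>)))"
proof -
  have "tree_coefficient \<tau> = fact k / real (symmetry_factor \<tau>) * (real (tree_size \<tau>) * inv_tree_factorial \<tau>)"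
    using assms by (simp add: tree_coefficient_def)
  also have "\<dots> = (\<Sum>\<tau>'\<in>{\<tau>'. tree_size \<tau>' = k}. fact k / real (symmetry_factor \<tau>) *
      (real (m_alpha \<tau>' \<tau> + m_beta \<tau>' \<tau>) * inv_tree_factorial \<tau>'))"
    unfolding inv_tree_factorial_step[OF assms] by (rule sum_distrib_left)
  also have "\<dots> = (\<Sum>\<tau>'\<in>{\<tau>'. tree_size \<tau>' = k}. tree_coefficient \<tau>' *
       (real (m_alpha \<tau>' \<tau> + m_beta \<tau>' \<tau>) * real (symmetry_factor \<tau>') / real (symmetry_factor \<tau>)))"
    using symmetry_factor_pos by (intro sum.cong refl) (simp add: tree_coefficient_def less_imp_neq[symmetric])
  finally show ?thesis .
qed

context smooth_coefficients
begin

abbreviation ed :: "exotic_tree \<Rightarrow> real \<Rightarrow> real" where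
  "ed \<tau> \<equiv> \<lambda>x. elementary_differential \<alpha> \<beta> f x \<tau>"

text \<open>The graftings onto a representative of \<open>\<tau>'\<close> are collected according to the class of the result; the
double counting lemmas then express the number of graftings in each class.\<close>

lemma generator_elementary_differential:
  assumes "tree_size \<tau>' = k"
  shows "generator \<alpha> \<beta> (ed \<tau>') x = (\<Sum>\<tau>\<in>{\<tau>. tree_size \<tau> = k + 1}.
    real (m_alpha \<tau>' \<tau> + m_beta \<tau>' \<tau>) * real (symmetry_factor \<tau>') / real (symmetry_factor \<tau>) * ed \<tau> x)"
proof -
  let ?T = "{\<tau>. tree_size \<tau> = k + 1}"
  obtain \<rho> where \<rho>: "is_etree \<rho>" "abs_exotic_tree \<rho> = \<tau>'" by (rule rep_exotic_tree)
  have size: "etree_size \<rho> = k" using tree_size_abs[OF \<rho>(1)] \<rho>(2) assms by simp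
  obtain n m where n: "n \<notin> verts \<rho>" "m \<notin> verts \<rho>" "n \<noteq> m"
    using obtain_two_fresh[OF finite_verts[OF \<rho>(1)]] .
  interpret a: grafting \<rho> "{n}" Alpha "{}" by (rule grafting_alpha[OF \<rho>(1) n(1)])
  interpret b: grafting \<rho> "{n, m}" Beta "{{n, m}}" by (rule grafting_beta[OF \<rho>(1) n])
  have collect: "(\<Sum>p\<in>X. etree_diff \<alpha> \<beta> f x (g p)) =
      (\<Sum>\<tau>\<in>?T. real (card {p \<in> X. abs_exotic_tree (g p) = \<tau>}) * ed \<tau> x)"
    if "finite X" "\<And>p. p \<in> X \<Longrightarrow> is_etree (g p)" "\<And>p. p \<in> X \<Longrightarrow> etree_size (g p) = k + 1"
    for X :: "(nat \<Rightarrow> nat) set" and g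
  proof -
    have "(\<Sum>p\<in>X. etree_diff \<alpha> \<beta> f x (g p)) = (\<Sum>p\<in>X. ed (abs_exotic_tree (g p)) x)"
      using that(2) by (intro sum.cong refl) (simp add: elementary_differential_abs)
    also have "\<dots> = (\<Sum>\<tau>\<in>?T. \<Sum>p\<in>{p \<in> X. abs_exotic_tree (g p) = \<tau>}. ed (abs_exotic_tree (g p)) x)"
      using that by (intro sum.group[symmetric] finite_trees_of_size) (auto simp: tree_size_abs)
    also have "\<dots> = (\<Sum>\<tau>\<in>?T. real (card {p \<in> X. abs_exotic_tree (g p) = \<tau>}) * ed \<tau> x)"
      by (intro sum.cong refl) simp
    finally show ?thesis .
  qed
  have fin: "finite ({n} \<rightarrow>\<^sub>E verts \<rho>)" "finite ({n, m} \<rightarrow>\<^sub>E verts \<rho>)"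
    by (intro finite_PiE finite_verts[OF \<rho>(1)]; simp)+
  have ga: "is_etree (graft {n} p Alpha {} \<rho>)" if "p \<in> {n} \<rightarrow>\<^sub>E verts \<rho>" for p
    by (rule a.is_etree_graft) (use that in \<open>simp add: PiE_def\<close>)
  have gb: "is_etree (graft {n, m} p Beta {{n, m}} \<rho>)" if "p \<in> {n, m} \<rightarrow>\<^sub>E verts \<rho>" for p
    by (rule b.is_etree_graft) (use that in \<open>simp add: PiE_def\<close>)
  have ca: "real (card {p \<in> {n} \<rightarrow>\<^sub>E verts \<rho>. abs_exotic_tree (graft {n} p Alpha {} \<rho>) = \<tau>}) =
      real (m_alpha \<tau>' \<tau>) * real (symmetry_factor \<tau>') / real (symmetry_factor \<tau>)"
    and cb: "real (card {p \<in> {n, m} \<rightarrow>\<^sub>E verts \<rho>. abs_exotic_tree (graft {n, m} p Beta {{n, m}} \<rho>) = \<tau>}) =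
      2 * real (m_beta \<tau>' \<tau>) * real (symmetry_factor \<tau>') / real (symmetry_factor \<tau>)" for \<tau>
  proof -
    obtain \<theta> where \<theta>: "is_etree \<theta>" "abs_exotic_tree \<theta> = \<tau>" by (rule rep_exotic_tree)
    have pos: "real (symmetry_factor \<tau>) \<noteq> 0" using symmetry_factor_pos[of \<tau>] by simp
    have sym: "card (etree_auts \<theta>) = symmetry_factor \<tau>" "card (etree_auts \<rho>) = symmetry_factor \<tau>'"
      using symmetry_factor_abs[OF \<theta>(1)] symmetry_factor_abs[OF \<rho>(1)] \<theta>(2) \<rho>(2) by simp_all
    have mm: "card (alpha_removals \<rho> \<theta>) = m_alpha \<tau>' \<tau>" "card (beta_removals \<rho> \<theta>) = m_beta \<tau>' \<tau>"
      using m_alpha_abs[OF \<rho>(1) \<theta>(1)] m_beta_abs[OF \<rho>(1) \<theta>(1)] \<theta>(2) \<rho>(2) by simp_all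
    have "{p \<in> {n} \<rightarrow>\<^sub>E verts \<rho>. abs_exotic_tree (graft {n} p Alpha {} \<rho>) = \<tau>} =
        {p \<in> {n} \<rightarrow>\<^sub>E verts \<rho>. etree_equiv (graft {n} p Alpha {} \<rho>) \<theta>}"
    proof (intro Collect_cong conj_cong refl)
      fix p assume "p \<in> {n} \<rightarrow>\<^sub>E verts \<rho>"
      from abs_exotic_tree_eq_iff[OF ga[OF this] \<theta>(1)]
      show "abs_exotic_tree (graft {n} p Alpha {} \<rho>) = \<tau> \<longleftrightarrow> etree_equiv (graft {n} p Alpha {} \<rho>) \<theta>"
        by (simp only: \<theta>(2))
    qed
    then have "card {p \<in> {n} \<rightarrow>\<^sub>E verts \<rho>. abs_exotic_tree (graft {n} p Alpha {} \<rho>) = \<tau>} * symmetry_factor \<tau> =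
        m_alpha \<tau>' \<tau> * symmetry_factor \<tau>'"
      using card_alpha_grafts[OF \<rho>(1) \<theta>(1) n(1)] by (simp only: sym mm)
    then have "real (card {p \<in> {n} \<rightarrow>\<^sub>E verts \<rho>. abs_exotic_tree (graft {n} p Alpha {} \<rho>) = \<tau>}) *
        real (symmetry_factor \<tau>) = real (m_alpha \<tau>' \<tau>) * real (symmetry_factor \<tau>')"
      by (simp only: of_nat_mult[symmetric])
    then show "real (card {p \<in> {n} \<rightarrow>\<^sub>E verts \<rho>. abs_exotic_tree (graft {n} p Alpha {} \<rho>) = \<tau>}) =
      real (m_alpha \<tau>' \<tau>) * real (symmetry_factor \<tau>') / real (symmetry_factor \<tau>)"
      by (simp only: nonzero_eq_divide_eq[OF pos])
    have "{p \<in> {n, m} \<rightarrow>\<^sub>E verts \<rho>. abs_exotic_tree (graft {n, m} p Beta {{n, m}} \<rho>) = \<tau>} =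
        {p \<in> {n, m} \<rightarrow>\<^sub>E verts \<rho>. etree_equiv (graft {n, m} p Beta {{n, m}} \<rho>) \<theta>}"
    proof (intro Collect_cong conj_cong refl)
      fix p assume "p \<in> {n, m} \<rightarrow>\<^sub>E verts \<rho>"
      from abs_exotic_tree_eq_iff[OF gb[OF this] \<theta>(1)]
      show "abs_exotic_tree (graft {n, m} p Beta {{n, m}} \<rho>) = \<tau> \<longleftrightarrow> etree_equiv (graft {n, m} p Beta {{n, m}} \<rho>) \<theta>"
        by (simp only: \<theta>(2))
    qed
    then have "card {p \<in> {n, m} \<rightarrow>\<^sub>E verts \<rho>. abs_exotic_tree (graft {n, m} p Beta {{n, m}} \<rho>) = \<tau>} * symmetry_factor \<tau> =
        2 * m_beta \<tau>' \<tau> * symmetry_factor \<tau>'"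
      using card_beta_grafts[OF \<rho>(1) \<theta>(1) n] by (simp only: sym mm)
    then have "real (card {p \<in> {n, m} \<rightarrow>\<^sub>E verts \<rho>. abs_exotic_tree (graft {n, m} p Beta {{n, m}} \<rho>) = \<tau>}) *
        real (symmetry_factor \<tau>) = real (2 * m_beta \<tau>' \<tau>) * real (symmetry_factor \<tau>')"
      by (simp only: of_nat_mult[symmetric])
    then show "real (card {p \<in> {n, m} \<rightarrow>\<^sub>E verts \<rho>. abs_exotic_tree (graft {n, m} p Beta {{n, m}} \<rho>) = \<tau>}) =
      2 * real (m_beta \<tau>' \<tau>) * real (symmetry_factor \<tau>') / real (symmetry_factor \<tau>)"
      by (simp only: nonzero_eq_divide_eq[OF pos] of_nat_mult of_nat_numeral)
  qed
  have "ed \<tau>' = (\<lambda>x. etree_diff \<alpha> \<beta> f x \<rho>)"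
    using elementary_differential_abs[OF \<rho>(1)] \<rho>(2) by (simp add: fun_eq_iff)
  then have "generator \<alpha> \<beta> (ed \<tau>') x =
    (\<Sum>\<tau>\<in>?T. real (m_alpha \<tau>' \<tau>) * real (symmetry_factor \<tau>') / real (symmetry_factor \<tau>) * ed \<tau> x) +
    1/2 * (\<Sum>\<tau>\<in>?T. 2 * real (m_beta \<tau>' \<tau>) * real (symmetry_factor \<tau>') / real (symmetry_factor \<tau>) * ed \<tau> x)"
    using generator_etree_diff[OF \<rho>(1) n, of x]
      collect[OF fin(1) ga] collect[OF fin(2) gb] etree_size_graft_alpha[OF \<rho>(1) n(1)]
      etree_size_graft_beta[OF \<rho>(1) n] size
    by (simp only: ca cb)
  also have "\<dots> = (\<Sum>\<tau>\<in>?T.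
    real (m_alpha \<tau>' \<tau> + m_beta \<tau>' \<tau>) * real (symmetry_factor \<tau>') / real (symmetry_factor \<tau>) * ed \<tau> x)"
    unfolding sum_distrib_left sum.distrib[symmetric]
    by (intro sum.cong refl) (simp add: add_divide_distrib distrib_right)
  finally show ?thesis .
qed

lemma ed_differentiable:
  shows "(ed \<tau> has_field_derivative deriv (ed \<tau>) x) (at x)"
    and "(deriv (ed \<tau>) has_field_derivative deriv (deriv (ed \<tau>)) x) (at x)"
proof -
  obtain \<rho> where \<rho>: "is_etree \<rho>" "abs_exotic_tree \<rho> = \<tau>" by (rule rep_exotic_tree)
  have ed: "ed \<tau> = raised_diff \<alpha> \<beta> f \<rho> (\<lambda>_. 0)"
    using elementary_differential_abs[OF \<rho>(1)] \<rho>(2) by (simp add: fun_eq_iff etree_diff_eq_raised_diff[OF \<rho>(1)])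
  have D: "deriv (raised_diff \<alpha> \<beta> f \<rho> k) =
      (\<lambda>x. \<Sum>a\<in>verts \<rho>. raised_diff \<alpha> \<beta> f \<rho> (k(a := Suc (k a))) x)" for k
    by (intro ext DERIV_imp_deriv DERIV_raised_diff \<rho>(1))
  show "(ed \<tau> has_field_derivative deriv (ed \<tau>) x) (at x)"
    unfolding ed D by (rule DERIV_raised_diff[OF \<rho>(1)])
  have d: "(deriv (ed \<tau>) has_field_derivative (\<Sum>a\<in>verts \<rho>. \<Sum>b\<in>verts \<rho>.
     raised_diff \<alpha> \<beta> f \<rho> (((\<lambda>_. 0)(a := Suc 0))(b := Suc (((\<lambda>_. 0)(a := Suc 0)) b))) x)) (at x)"
    unfolding ed D by (intro DERIV_sum DERIV_raised_diff \<rho>(1))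
  show "(deriv (ed \<tau>) has_field_derivative deriv (deriv (ed \<tau>)) x) (at x)"
    unfolding DERIV_imp_deriv[OF d] by (rule d)
qed

lemma generator_sum:
  "generator \<alpha> \<beta> (\<lambda>x. \<Sum>\<tau>\<in>T. c \<tau> * ed \<tau> x) = (\<lambda>x. \<Sum>\<tau>\<in>T. c \<tau> * generator \<alpha> \<beta> (ed \<tau>) x)"
proof -
  have 1: "deriv (\<lambda>x. \<Sum>\<tau>\<in>T. c \<tau> * ed \<tau> x) = (\<lambda>x. \<Sum>\<tau>\<in>T. c \<tau> * deriv (ed \<tau>) x)"
    by (intro ext DERIV_imp_deriv DERIV_sum DERIV_cmult ed_differentiable)
  have 2: "deriv (\<lambda>x. \<Sum>\<tau>\<in>T. c \<tau> * deriv (ed \<tau>) x) = (\<lambda>x. \<Sum>\<tau>\<in>T. c \<tau> * deriv (deriv (ed \<tau>)) x)"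
    by (intro ext DERIV_imp_deriv DERIV_sum DERIV_cmult ed_differentiable)
  show ?thesis
    unfolding generator_def 1 2 by (simp add: sum_distrib_left sum.distrib[symmetric] algebra_simps)
qed

text \<open>Induction on \<open>N\<close>: applying the generator to the sum over trees of size $N+1$ and exchanging the order
of summation, the coefficient of each tree of size $N+2$ is the one of \<open>tree_coefficient_step\<close>.\<close>

theorem generator_power_eq_tree_sum:
  "(generator \<alpha> \<beta> ^^ N) f = (\<lambda>x. \<Sum>\<tau>\<in>{\<tau>. tree_size \<tau> = N + 1}. tree_coefficient \<tau> * ed \<tau> x)"
proof (induction N)
  case 0
  have root: "{\<tau>. tree_size \<tau> = 0 + 1} = {abs_exotic_tree single_root}"
    using trees_of_size_1 by simp
  have size: "tree_size (abs_exotic_tree single_root) = 1" using root by auto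
  have "etree_auts single_root = {\<lambda>v\<in>{0}. 0}"
    by (auto simp: etree_auts_def etree_iso_def single_root_def bij_betw_def fun_eq_iff extensional_def)
  then have "symmetry_factor (abs_exotic_tree single_root) = 1"
    by (simp add: symmetry_factor_abs[OF is_etree_single_root])
  then have "tree_coefficient (abs_exotic_tree single_root) = 1"
    using size by (simp add: tree_coefficient_def inv_tree_factorial.simps)
  moreover have "ed (abs_exotic_tree single_root) = f"
    unfolding elementary_differential_abs[OF is_etree_single_root]
    by (simp add: etree_diff_def single_root_def children_def)
  ultimately show ?case unfolding root by (simp add: fun_eq_iff)
next
  case (Suc N)
  let ?T = "\<lambda>k. {\<tau>. tree_size \<tau> = k}"
  let ?w = "\<lambda>\<tau>' \<tau>. real (m_alpha \<tau>' \<tau> + m_beta \<tau>' \<tau>) * real (symmetry_factor \<tau>') / real (symmetry_factor \<tau>)"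
  have "(generator \<alpha> \<beta> ^^ Suc N) f = (\<lambda>x. \<Sum>\<tau>'\<in>?T (N + 1). tree_coefficient \<tau>' * generator \<alpha> \<beta> (ed \<tau>') x)"
    by (simp add: Suc generator_sum)
  also have "\<dots> = (\<lambda>x. \<Sum>\<tau>'\<in>?T (N + 1). \<Sum>\<tau>\<in>?T (N + 1 + 1). tree_coefficient \<tau>' * ?w \<tau>' \<tau> * ed \<tau> x)"
    by (intro ext sum.cong refl, subst generator_elementary_differential)
       (simp_all only: mem_Collect_eq sum_distrib_left mult.assoc)
  also have "\<dots> = (\<lambda>x. \<Sum>\<tau>\<in>?T (N + 1 + 1). \<Sum>\<tau>'\<in>?T (N + 1). tree_coefficient \<tau>' * ?w \<tau>' \<tau> * ed \<tau> x)"
    by (intro ext sum.swap)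
  also have "\<dots> = (\<lambda>x. \<Sum>\<tau>\<in>?T (N + 1 + 1). tree_coefficient \<tau> * ed \<tau> x)"
  proof (intro ext sum.cong refl)
    fix x \<tau> assume "\<tau> \<in> ?T (N + 1 + 1)"
    then have "tree_size \<tau> = N + 1 + 1" by simp
    then show "(\<Sum>\<tau>'\<in>?T (N + 1). tree_coefficient \<tau>' * ?w \<tau>' \<tau> * ed \<tau> x) = tree_coefficient \<tau> * ed \<tau> x"
      by (subst tree_coefficient_step[of _ "N + 1"]) (simp_all only: sum_distrib_right)
  qed
  finally show ?case by simp
qed

end

theorem proposition1p2:
  fixes T u\<^sub>0 :: real and \<alpha> \<beta> f :: "real \<Rightarrow> real"
    and M :: "'a measure" and F :: "real \<Rightarrow> 'a measure" and W :: "real \<Rightarrow> 'a \<Rightarrow> real"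
  assumes "T > 0"
    and "C_infinity \<alpha>" "real_analytic \<alpha>"
    and "C_infinity \<beta>" "real_analytic \<beta>"
    and "C_infinity f" "real_analytic f"
    and "brownian_motion M F W"
    and "sde_unique_solution M F W \<alpha> \<beta> u\<^sub>0 T"
  shows "\<forall>N. \<forall>t\<in>{0..T}.
    msr_term \<alpha> \<beta> f u\<^sub>0 T N t =
    (\<Sum>\<tau>\<in>{\<tau>. tree_size \<tau> = N + 1}.
       real (tree_size \<tau>) / real (symmetry_factor \<tau>) * inv_tree_factorial \<tau> *
       elementary_differential \<alpha> \<beta> f u\<^sub>0 \<tau> * t ^ (tree_size \<tau> - 1))"
proof (intro allI ballI)
  fix N t assume t: "t \<in> {0..T}"
  interpret smooth_coefficients \<alpha> \<beta> f
    using assms by unfold_locales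
  have "msr_term \<alpha> \<beta> f u\<^sub>0 T N t = t ^ N / fact N * (generator \<alpha> \<beta> ^^ N) f u\<^sub>0"
    using t by (intro msr_term_eq_generator smooth) auto
  also have "\<dots> = (\<Sum>\<tau>\<in>{\<tau>. tree_size \<tau> = N + 1}. t ^ N / fact N * (tree_coefficient \<tau> * ed \<tau> u\<^sub>0))"
    unfolding generator_power_eq_tree_sum by (rule sum_distrib_left)
  also have "\<dots> = (\<Sum>\<tau>\<in>{\<tau>. tree_size \<tau> = N + 1}.
       real (tree_size \<tau>) / real (symmetry_factor \<tau>) * inv_tree_factorial \<tau> *
       elementary_differential \<alpha> \<beta> f u\<^sub>0 \<tau> * t ^ (tree_size \<tau> - 1))"
  proof (intro sum.cong refl)
    fix \<tau> assume "\<tau> \<in> {\<tau>. tree_size \<tau> = N + 1}"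
    then have size: "tree_size \<tau> = N + 1" by simp
    have cancel: "a / b * ((k * b) * i / d * e) = k / d * i * e * a" if "b \<noteq> 0" for a b k i d e :: real
      using that by (cases "d = 0") (simp_all add: field_simps)
    have "fact (N + 1) = real (N + 1) * fact N" by simp
    then show "t ^ N / fact N * (tree_coefficient \<tau> * ed \<tau> u\<^sub>0) =
       real (tree_size \<tau>) / real (symmetry_factor \<tau>) * inv_tree_factorial \<tau> *
       elementary_differential \<alpha> \<beta> f u\<^sub>0 \<tau> * t ^ (tree_size \<tau> - 1)"
      unfolding tree_coefficient_def size by (simp only: cancel[OF fact_nonzero] add_diff_cancel_right')
  qed
  finally show "msr_term \<alpha> \<beta> f u\<^sub>0 T N t =
    (\<Sum>\<tau>\<in>{\<tau>. tree_size \<tau> = N + 1}.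
       real (tree_size \<tau>) / real (symmetry_factor \<tau>) * inv_tree_factorial \<tau> *
       elementary_differential \<alpha> \<beta> f u\<^sub>0 \<tau> * t ^ (tree_size \<tau> - 1))" .
qed

end
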